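(* Let $n\ge 1$, let $0\leq k\leq n$ and $0\leq \ell\leq n-k$ be integers, and let $A_1,\ldots,A_k\in\mathcal K(\mathbb C^n)$. Then $$\int_{B_{2n}}\Big(\bigwedge_{j=1}^k dd^c h_{A_j}\Big)\wedge(dd^c h_{B_{2n}}^2)^{\wedge(n-k)}=2^{\ell}\int_{B_{2n}}\Big(\bigwedge_{j=1}^k dd^c h_{A_j}\Big)\wedge(dd^c h_{B_{2n}})^{\wedge \ell}\wedge(dd^c h_{B_{2n}}^2)^{\wedge(n-k-\ell)}.$$ In particular, $$Q_n(A_1,\ldots,A_k,B_{2n}[n-k])=\frac{1}{2^{n-k}\,n!\,\varkappa_n}\int_{B_{2n}}\Big(\bigwedge_{j=1}^k dd^c h_{A_j}\Big)\wedge(dd^c h_{B_{2n}}^2)^{\wedge(n-k)}.$$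
   Context: $\mathbb C^n$ carries the Hermitian product $\langle z,w\rangle=\sum_\ell z_\ell\bar w_\ell$. $\mathcal K(\mathbb C^n)$ is the set of convex bodies (non-empty compact convex subsets) of $\mathbb C^n$; the support function of $A$ is $h_A(z)=\max_{v\in A}\operatorname{Re}\langle z,v\rangle$. $B_{2n}$ is the closed unit ball of $\mathbb C^n$ centred at the origin, so $h_{B_{2n}}(z)=\|z\|$ and $h_{B_{2n}}^2(z)=\|z\|^2$. $\varkappa_m$ is the Lebesgue measure of the unit ball of $\mathbb R^m$. $d^c=i(\bar\partial-\partial)$, so $dd^c=2i\partial\bar\partial$. Wedge products of currents $dd^c u$ with $u$ continuous plurisubharmonic are taken in the Bedford–Taylor sense; a product of $n$ of them is a positive measure, and the integral over $B_{2n}$ is the measure of $B_{2n}$. The Kazarnovskiĭ mixed pseudovolume is $$Q_n(A_1,\ldots,A_n)=\frac{1}{n!\,\varkappa_n}\int_{B_{2n}}dd^c h_{A_1}\wedge\cdots\wedge dd^c h_{A_n}.$$ $A[m]$ denotes $A$ repeated $m$ times. *)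

theory Defs
  imports "HOL-Analysis.Analysis"
begin

section \<open>Convex bodies and support functions\<close>

definition hermitian :: "complex ^ 'n \<Rightarrow> complex ^ 'n \<Rightarrow> complex" where
  "hermitian z w = (\<Sum>j\<in>UNIV. z $ j * cnj (w $ j))"

definition convex_body :: "(complex ^ 'n) set \<Rightarrow> bool" where
  "convex_body A \<longleftrightarrow> A \<noteq> {} \<and> compact A \<and> convex A"

text \<open>For a convex body the supremum is attained, so it is the maximum.\<close>

definition support_fun :: "(complex ^ 'n) set \<Rightarrow> complex ^ 'n \<Rightarrow> real" where
  "support_fun A z = (SUP v\<in>A. Re (hermitian z v))"


section \<open>Test functions and Wirtinger derivatives\<close>

primrec Ck :: "nat \<Rightarrow> (complex ^ 'n \<Rightarrow> complex) \<Rightarrow> bool" where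
  "Ck 0 f \<longleftrightarrow> continuous_on UNIV f"
| "Ck (Suc r) f \<longleftrightarrow> (\<forall>z. f differentiable (at z)) \<and>
     (\<forall>v. Ck r (\<lambda>z. frechet_derivative f (at z) v))"

definition Cc :: "(complex ^ 'n \<Rightarrow> complex) set" where
  "Cc = {f. continuous_on UNIV f \<and> compact (closure {z. f z \<noteq> 0})}"

definition Cc_smooth :: "(complex ^ 'n \<Rightarrow> complex) set" where
  "Cc_smooth = {f \<in> Cc. \<forall>r. Ck r f}"

definition d_z :: "'n \<Rightarrow> (complex ^ 'n \<Rightarrow> complex) \<Rightarrow> complex ^ 'n \<Rightarrow> complex" where
  "d_z a f z = (frechet_derivative f (at z) (axis a 1) -
                \<i> * frechet_derivative f (at z) (axis a \<i>)) / 2"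

definition d_zbar :: "'n \<Rightarrow> (complex ^ 'n \<Rightarrow> complex) \<Rightarrow> complex ^ 'n \<Rightarrow> complex" where
  "d_zbar b f z = (frechet_derivative f (at z) (axis b 1) +
                   \<i> * frechet_derivative f (at z) (axis b \<i>)) / 2"


section \<open>Currents with measure coefficients\<close>

text \<open>
  Complex Radon measures, as the linear functionals on the continuous compactly supported functions
  that are bounded on every compact set.  Functionals take the value 0 outside \<open>Cc\<close>, so that they
  are determined by their values on \<open>Cc\<close>.
\<close>

definition radon_functional :: "((complex ^ 'n \<Rightarrow> complex) \<Rightarrow> complex) \<Rightarrow> bool" where
  "radon_functional S \<longleftrightarrow>
     (\<forall>f\<in>Cc. \<forall>g\<in>Cc. S (\<lambda>z. f z + g z) = S f + S g) \<and>
     (\<forall>c. \<forall>f\<in>Cc. S (\<lambda>z. c * f z) = c * S f) \<and>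
     (\<forall>K. compact K \<longrightarrow> (\<exists>C. \<forall>f\<in>Cc. (\<forall>z. z \<notin> K \<longrightarrow> f z = 0) \<longrightarrow>
        cmod (S f) \<le> C * (SUP z. cmod (f z)))) \<and>
     (\<forall>f. f \<notin> Cc \<longrightarrow> S f = 0)"

text \<open>
  A current \<open>T\<close> of bidimension \<open>(m,m)\<close> with measure coefficients is determined by its values on the
  forms \<open>f dz\<^bsub>a\<^sub>1\<^esub> \<and> dzbar\<^bsub>b\<^sub>1\<^esub> \<and> \<dots> \<and> dz\<^bsub>a\<^sub>m\<^esub> \<and> dzbar\<^bsub>b\<^sub>m\<^esub>\<close> with \<open>f\<close> in \<open>Cc\<close>, which span the continuous
  compactly supported \<open>(m,m)\<close>-forms.  It is represented by the function that maps the list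
  \<open>[(a\<^sub>1,b\<^sub>1), \<dots>, (a\<^sub>m,b\<^sub>m)]\<close> and \<open>f\<close> to that value.
\<close>

type_synonym 'n current = "('n \<times> 'n) list \<Rightarrow> (complex ^ 'n \<Rightarrow> complex) \<Rightarrow> complex"

text \<open>
  The current of integration over the whole space (the constant function 1).  If \<open>a\<^sub>1,\<dots>,a\<^sub>n\<close> and
  \<open>b\<^sub>1,\<dots>,b\<^sub>n\<close> both enumerate the coordinates and \<open>\<pi>\<close> is the permutation with \<open>\<pi> a\<^sub>j = b\<^sub>j\<close>, then
  \<open>dz\<^bsub>a\<^sub>1\<^esub> \<and> dzbar\<^bsub>b\<^sub>1\<^esub> \<and> \<dots> \<and> dz\<^bsub>a\<^sub>n\<^esub> \<and> dzbar\<^bsub>b\<^sub>n\<^esub>\<close> is \<open>sign \<pi>\<close> times the product of the commuting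
  2-forms \<open>dz\<^sub>j \<and> dzbar\<^sub>j = -2\<i> dx\<^sub>j \<and> dy\<^sub>j\<close>; if an index is repeated among the \<open>a\<^sub>j\<close> or among the
  \<open>b\<^sub>j\<close>, the form is zero.
\<close>

definition integration_current :: "'n::finite current" where
  "integration_current ab f =
     (if length ab = CARD('n) \<and> distinct (map fst ab) \<and> distinct (map snd ab)
      then of_int (sign (\<lambda>a. the (map_of ab a))) * (- 2 * \<i>) ^ CARD('n) * (LINT z|lborel. f z)
      else 0)"

text \<open>
  The Bedford--Taylor product \<open>dd\<^sup>c u \<and> T = dd\<^sup>c (u T)\<close> of \<open>dd\<^sup>c u\<close>, \<open>u\<close> continuous plurisubharmonic,
  with a closed positive current \<open>T\<close>.  It is the current with measure coefficients that takes the
  value \<open>T (u dd\<^sup>c \<phi>)\<close> at every smooth compactly supported form \<open>\<phi>\<close>; for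
  \<open>\<phi> = f dz\<^bsub>a\<^sub>1\<^esub> \<and> dzbar\<^bsub>b\<^sub>1\<^esub> \<and> \<dots>\<close> the form \<open>dd\<^sup>c \<phi>\<close> is
  \<open>\<Sum>a b. 2\<i> (d_z a (d_zbar b f)) dz\<^sub>a \<and> dzbar\<^sub>b \<and> dz\<^bsub>a\<^sub>1\<^esub> \<and> dzbar\<^bsub>b\<^sub>1\<^esub> \<and> \<dots>\<close>.
  The products taken below are again closed and positive, which gives existence; uniqueness holds
  because \<open>Cc_smooth\<close> is dense in \<open>Cc\<close>.
\<close>

definition ddc_wedge :: "(complex ^ 'n \<Rightarrow> real) \<Rightarrow> 'n::finite current \<Rightarrow> 'n current" where
  "ddc_wedge u T ab = (THE S. radon_functional S \<and>
     (\<forall>f\<in>Cc_smooth. S f = (\<Sum>a\<in>UNIV. \<Sum>b\<in>UNIV.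
        2 * \<i> * T ((a, b) # ab) (\<lambda>z. of_real (u z) * d_z a (d_zbar b f) z))))"

definition ddc_product :: "(complex ^ 'n \<Rightarrow> real) list \<Rightarrow> 'n::finite current" where
  "ddc_product us = foldr ddc_wedge us integration_current"

text \<open>
  For a list of \<open>CARD('n)\<close> functions the product has bidimension \<open>(0,0)\<close>; its only coefficient, at
  the empty list, is a positive measure.
\<close>

definition ddc_measure :: "(complex ^ 'n \<Rightarrow> real) list \<Rightarrow> (complex ^ 'n::finite) measure" where
  "ddc_measure us = (THE \<mu>. sets \<mu> = sets borel \<and>
     (\<forall>K. compact K \<longrightarrow> emeasure \<mu> K < \<infinity>) \<and>
     (\<forall>f\<in>Cc. ddc_product us [] f = (LINT z|\<mu>. f z)))"

definition ddc_ball_integral :: "(complex ^ 'n::finite \<Rightarrow> real) list \<Rightarrow> real" where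
  "ddc_ball_integral us = measure (ddc_measure us) (cball 0 1)"


section \<open>Kazarnovskii mixed pseudovolume\<close>

definition mixed_pseudovolume :: "(complex ^ 'n::finite) set list \<Rightarrow> real" where
  "mixed_pseudovolume As =
     1 / (fact CARD('n) * measure lborel (cball (0 :: real ^ 'n) 1)) *
     ddc_ball_integral (map support_fun As)"

end

theory Submission
  imports Defs
begin

text \<open>
  The support function of a convex body is a limit, uniform relative to \<open>1 + norm z\<close>, of functions
  \<open>1/p * ln (\<Sum>v. exp (p * (z \<bullet> v)))\<close> with \<open>v\<close> in finite subsets of the body; their complex Hessians
  are covariance matrices, hence explicit sums of rank-one squares.  For such functions \<open>dd\<^sup>c\<close>-products
  are densities.  Integration by parts and positivity bound their masses on compact sets uniformly, so
  the densities converge weakly to the Bedford--Taylor product, which is therefore symmetric in its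
  factors.

  It then suffices to compare \<open>T \<and> dd\<^sup>c h\<^sup>2\<close> with \<open>2 T \<and> dd\<^sup>c h\<close> on the closed unit ball, where \<open>h z = norm z\<close>.
  As \<open>dd\<^sup>c 1 = 0\<close>, the difference of their integrals against a cutoff \<open>\<psi>\<close> is the value of \<open>T\<close> at
  \<open>(h - 1)\<^sup>2 dd\<^sup>c \<psi>\<close>.  For cutoffs whose Hessians live on disjoint shells shrinking to the sphere these
  forms stay bounded, and a functional bounded on a compact set tends to 0 along bounded functions with
  disjoint supports.
\<close>

section \<open>Calculus of smooth functions\<close>

text \<open>Both \<open>ddc_wedge\<close> and \<open>ddc_measure\<close> are definite descriptions,
  so nothing can be computed before existence and uniqueness are known; this forces the density of
  smooth test functions and a Riesz representation theorem. Symmetry of the products is needed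
  because the defining equation of \<open>ddc_wedge\<close> speaks of the outermost factor only,
  while the factors to be exchanged stand behind the fixed ones. Soft maxima serve better than
  convolutions: their Hessians are explicit sums of squares, so the positivity of wedge products is
  algebra and needs no diagonalisation. The final comparison cannot neglect the boundary, since mass
  on the unit sphere counts. The function \<open>2 * norm z - 1\<close> is the tangent at
  \<open>norm z = 1\<close> of the square, which is the origin of the factor 2; the resulting
  second-order zero offsets exactly the growth of the second derivatives of a cutoff. That yields
  boundedness and not smallness; smallness comes from the disjointness of the shells alone.\<close>

definition smooth :: "(complex ^ 'n \<Rightarrow> complex) \<Rightarrow> bool" where
  "smooth f \<longleftrightarrow> (\<forall>r. Ck r f)"

text \<open>\<open>Ck\<close> refers to \<open>frechet_derivative\<close>; here any explicit
  derivative is accepted, so the closure rules below can proceed by exhibiting the one given by the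
  usual calculus rule.\<close>

lemma Ck_SucI:
  assumes "\<And>z. (f has_derivative (\<lambda>v. D v z)) (at z)" "\<And>v. Ck r (D v)"
  shows "Ck (Suc r) f"
proof -
  have "frechet_derivative f (at z) = (\<lambda>v. D v z)" for z
    using frechet_derivative_at[OF assms(1)[of z]] by simp
  then show ?thesis using assms by (auto simp: differentiable_def)
qed

lemma Ck_imp_has_derivative:
  "Ck (Suc r) f \<Longrightarrow> (f has_derivative frechet_derivative f (at z)) (at z)"
  by (simp add: frechet_derivative_works)

lemma Ck_Suc_imp_Ck: "Ck (Suc r) f \<Longrightarrow> Ck r f"
proof (induction r arbitrary: f)
  case 0
  then show ?case by (auto intro!: continuous_at_imp_continuous_on differentiable_imp_continuous_within)
next
  case (Suc r)
  then show ?case by auto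
qed

lemma Ck_imp_continuous: "Ck r f \<Longrightarrow> continuous_on UNIV f"
  by (induction r) (auto dest: Ck_Suc_imp_Ck simp del: Ck.simps(2))

lemma Ck_const: "Ck r (\<lambda>z. c)"
  by (induction r arbitrary: c) (auto intro!: Ck_SucI[where D="\<lambda>v z. 0"] simp del: Ck.simps(2))

lemma Ck_add: "Ck r f \<Longrightarrow> Ck r g \<Longrightarrow> Ck r (\<lambda>z. f z + g z)"
proof (induction r arbitrary: f g)
  case 0
  then show ?case by (auto intro: continuous_intros)
next
  case (Suc r)
  show ?case
    by (rule Ck_SucI[where D="\<lambda>v z. frechet_derivative f (at z) v + frechet_derivative g (at z) v"])
       (use Suc in \<open>auto intro!: has_derivative_add Ck_imp_has_derivative\<close>)
qed

lemma Ck_mult: "Ck r f \<Longrightarrow> Ck r g \<Longrightarrow> Ck r (\<lambda>z. f z * g z)"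
proof (induction r arbitrary: f g)
  case 0
  then show ?case by (auto intro: continuous_intros)
next
  case (Suc r)
  show ?case
  proof (rule Ck_SucI[where D="\<lambda>v z. f z * frechet_derivative g (at z) v + frechet_derivative f (at z) v * g z"])
    show "((\<lambda>z. f z * g z) has_derivative (\<lambda>v. f z * frechet_derivative g (at z) v
            + frechet_derivative f (at z) v * g z)) (at z)" for z
      using Suc.prems by (intro has_derivative_mult Ck_imp_has_derivative)
    show "Ck r (\<lambda>z. f z * frechet_derivative g (at z) v + frechet_derivative f (at z) v * g z)" for v
      using Suc.prems Ck_Suc_imp_Ck[OF Suc.prems(1)] Ck_Suc_imp_Ck[OF Suc.prems(2)]
      by (intro Ck_add Suc.IH) auto
  qed
qed

lemma Ck_bounded_linear: "bounded_linear f \<Longrightarrow> Ck r f"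
proof (cases r)
  case 0
  assume "bounded_linear f"
  then show ?thesis using 0 by (simp add: linear_continuous_on)
next
  case (Suc r')
  assume f: "bounded_linear f"
  show ?thesis unfolding Suc
    by (rule Ck_SucI[where D="\<lambda>v z. f v"])
       (use f in \<open>auto intro: bounded_linear_imp_has_derivative Ck_const\<close>)
qed

lemma Ck_inverse: "Ck r f \<Longrightarrow> (\<And>z. f z \<noteq> 0) \<Longrightarrow> Ck r (\<lambda>z. inverse (f z))"
proof (induction r arbitrary: f)
  case 0
  then show ?case by (auto intro: continuous_intros)
next
  case (Suc r)
  show ?case
  proof (rule Ck_SucI[where D="\<lambda>v z. - 1 * (inverse (f z) * frechet_derivative f (at z) v * inverse (f z))"])
    show "((\<lambda>z. inverse (f z)) has_derivative (\<lambda>v. -1 * (inverse (f z) * frechet_derivative f (at z) v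
            * inverse (f z)))) (at z)" for z
      using Deriv.has_derivative_inverse[OF _ Ck_imp_has_derivative[OF Suc.prems(1)]] Suc.prems(2) by simp
    show "Ck r (\<lambda>z. -1 * (inverse (f z) * frechet_derivative f (at z) v * inverse (f z)))" for v
      using Suc.prems Ck_Suc_imp_Ck[OF Suc.prems(1)] by (intro Ck_mult Suc.IH Ck_const) auto
  qed
qed

lemma Ck_exp: "Ck r f \<Longrightarrow> Ck r (\<lambda>z. exp (f z))"
proof (induction r arbitrary: f)
  case 0
  then show ?case by (auto intro: continuous_intros)
next
  case (Suc r)
  show ?case
  proof (rule Ck_SucI[where D="\<lambda>v z. frechet_derivative f (at z) v * exp (f z)"])
    show "((\<lambda>z. exp (f z)) has_derivative (\<lambda>v. frechet_derivative f (at z) v * exp (f z))) (at z)" for z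
      using has_derivative_compose[OF Ck_imp_has_derivative[OF Suc.prems(1)]
          DERIV_exp[unfolded has_field_derivative_def]]
      by (simp add: mult.commute)
    show "Ck r (\<lambda>z. frechet_derivative f (at z) v * exp (f z))" for v
      using Suc.prems Ck_Suc_imp_Ck[OF Suc.prems(1)] by (intro Ck_mult Suc.IH) auto
  qed
qed

lemma has_derivative_Ln:
  fixes f :: "'a::real_normed_vector \<Rightarrow> complex"
  assumes "(f has_derivative D) (at z)" "Re (f z) > 0"
  shows "((\<lambda>z. Ln (f z)) has_derivative (\<lambda>v. D v * inverse (f z))) (at z)"
proof -
  have "f z \<notin> \<real>\<^sub>\<le>\<^sub>0" using assms(2) by (auto simp: complex_nonpos_Reals_iff)
  then have "(Ln has_derivative (*) (inverse (f z))) (at (f z))"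
    using has_field_derivative_Ln unfolding has_field_derivative_def by blast
  from has_derivative_compose[OF assms(1) this] show ?thesis by (simp add: mult.commute)
qed

text \<open>The logarithm disappears after one differentiation, leaving the derivative of
  \<open>f\<close> times \<open>inverse (f z)\<close>, so smoothness of \<open>f\<close> to all
  orders replaces an induction. Positive real part keeps the values off the branch cut.\<close>

lemma Ck_Ln:
  assumes "\<And>r. Ck r f" "\<And>z. Re (f z) > 0"
  shows "Ck r (\<lambda>z. Ln (f z))"
proof -
  have "Ck (Suc r) (\<lambda>z. Ln (f z))" for r
  proof (rule Ck_SucI[where D="\<lambda>v z. frechet_derivative f (at z) v * inverse (f z)"])
    show "((\<lambda>z. Ln (f z)) has_derivative (\<lambda>v. frechet_derivative f (at z) v * inverse (f z))) (at z)" for z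
      using assms by (intro has_derivative_Ln Ck_imp_has_derivative)
    have "f z \<noteq> 0" for z using assms(2)[of z] by auto
    then show "Ck r (\<lambda>z. frechet_derivative f (at z) v * inverse (f z))" for v
      using assms(1)[of "Suc r"] by (intro Ck_mult Ck_inverse assms(1)) auto
  qed
  then show ?thesis using Ck_Suc_imp_Ck by blast
qed

lemma smooth_const [intro!]: "smooth (\<lambda>z. c)" by (simp add: smooth_def Ck_const)
lemma smooth_add [intro]: "smooth f \<Longrightarrow> smooth g \<Longrightarrow> smooth (\<lambda>z. f z + g z)" by (simp add: smooth_def Ck_add)
lemma smooth_mult [intro]: "smooth f \<Longrightarrow> smooth g \<Longrightarrow> smooth (\<lambda>z. f z * g z)" by (simp add: smooth_def Ck_mult)
lemma smooth_bounded_linear: "bounded_linear f \<Longrightarrow> smooth f" by (simp add: smooth_def Ck_bounded_linear)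
lemma smooth_inverse: "smooth f \<Longrightarrow> (\<And>z. f z \<noteq> 0) \<Longrightarrow> smooth (\<lambda>z. inverse (f z))" by (simp add: smooth_def Ck_inverse)
lemma smooth_exp: "smooth f \<Longrightarrow> smooth (\<lambda>z. exp (f z))" by (simp add: smooth_def Ck_exp)
lemma smooth_Ln: "smooth f \<Longrightarrow> (\<And>z. Re (f z) > 0) \<Longrightarrow> smooth (\<lambda>z. Ln (f z))" by (simp add: smooth_def Ck_Ln)
lemma smooth_sum [intro]: "(\<And>i. i \<in> I \<Longrightarrow> smooth (f i)) \<Longrightarrow> smooth (\<lambda>z. \<Sum>i\<in>I. f i z)"
  by (induction I rule: infinite_finite_induct) (auto intro!: smooth_add)

lemma smooth_imp_continuous: "smooth f \<Longrightarrow> continuous_on S f"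
  using Ck_imp_continuous continuous_on_subset[OF _ subset_UNIV] unfolding smooth_def by blast

lemma smooth_imp_has_derivative: "smooth f \<Longrightarrow> (f has_derivative frechet_derivative f (at z)) (at z)"
  using Ck_imp_has_derivative unfolding smooth_def by blast

lemma smooth_derivative: "smooth f \<Longrightarrow> smooth (\<lambda>z. frechet_derivative f (at z) v)"
  unfolding smooth_def by (metis Ck.simps(2))

text \<open>The value \<open>c = - \<i>\<close> gives \<open>d_z\<close> and \<open>c = \<i>\<close>
  gives \<open>d_zbar\<close>; rules proved once for the family are specialised by folding.\<close>

definition wirtinger :: "complex \<Rightarrow> 'n \<Rightarrow> (complex ^ 'n \<Rightarrow> complex) \<Rightarrow> complex ^ 'n \<Rightarrow> complex" where
  "wirtinger c a f z = (frechet_derivative f (at z) (axis a 1) + c * frechet_derivative f (at z) (axis a \<i>)) / 2"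

lemma d_z_wirtinger: "d_z = wirtinger (- \<i>)"
  by (intro ext) (simp add: d_z_def wirtinger_def)

lemma d_zbar_wirtinger: "d_zbar = wirtinger \<i>"
  by (intro ext) (simp add: d_zbar_def wirtinger_def)

lemma smooth_wirtinger: "smooth f \<Longrightarrow> smooth (wirtinger c a f)"
proof -
  assume f: "smooth f"
  have "smooth (\<lambda>z. (frechet_derivative f (at z) (axis a 1) + c * frechet_derivative f (at z) (axis a \<i>)) * (1/2))"
    by (intro smooth_mult smooth_add smooth_const smooth_derivative f)
  then show ?thesis by (simp add: wirtinger_def[abs_def])
qed

lemma wirtinger_eqI:
  "(f has_derivative D) (at z) \<Longrightarrow> wirtinger c a f z = (D (axis a 1) + c * D (axis a \<i>)) / 2"
  unfolding wirtinger_def using frechet_derivative_at by metis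

lemma wirtinger_const: "wirtinger c a (\<lambda>z. k) z = 0"
  by (subst wirtinger_eqI[OF has_derivative_const]) simp

lemma wirtinger_add:
  "smooth f \<Longrightarrow> smooth g \<Longrightarrow> wirtinger c a (\<lambda>z. f z + g z) z = wirtinger c a f z + wirtinger c a g z"
  by (subst wirtinger_eqI[OF has_derivative_add[OF smooth_imp_has_derivative smooth_imp_has_derivative]])
     (auto simp: wirtinger_def field_simps)

lemma wirtinger_mult:
  "smooth f \<Longrightarrow> smooth g \<Longrightarrow> wirtinger c a (\<lambda>z. f z * g z) z = f z * wirtinger c a g z + wirtinger c a f z * g z"
  by (subst wirtinger_eqI[OF has_derivative_mult[OF smooth_imp_has_derivative smooth_imp_has_derivative]])
     (auto simp: wirtinger_def field_simps)

lemma wirtinger_cmult: "smooth f \<Longrightarrow> wirtinger c a (\<lambda>z. k * f z) z = k * wirtinger c a f z"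
  using wirtinger_mult[of "\<lambda>z. k" f] by (auto simp: wirtinger_const)

lemma wirtinger_sum:
  "(\<And>i. i \<in> I \<Longrightarrow> smooth (f i)) \<Longrightarrow> wirtinger c a (\<lambda>z. \<Sum>i\<in>I. f i z) z = (\<Sum>i\<in>I. wirtinger c a (f i) z)"
proof (induction I rule: infinite_finite_induct)
  case (insert x F)
  then have "wirtinger c a (\<lambda>z. f x z + (\<Sum>i\<in>F. f i z)) z = wirtinger c a (f x) z + wirtinger c a (\<lambda>z. \<Sum>i\<in>F. f i z) z"
    by (intro wirtinger_add) auto
  then show ?case using insert by simp
qed (auto simp: wirtinger_const)

lemmas smooth_d_z [intro] = smooth_wirtinger[where c="- \<i>", folded d_z_wirtinger]
lemmas smooth_d_zbar [intro] = smooth_wirtinger[where c="\<i>", folded d_zbar_wirtinger]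
lemmas d_zbar_eqI = wirtinger_eqI[where c="\<i>", folded d_zbar_wirtinger]
lemmas d_z_const [simp] = wirtinger_const[where c="- \<i>", folded d_z_wirtinger]
lemmas d_zbar_const [simp] = wirtinger_const[where c="\<i>", folded d_zbar_wirtinger]
lemmas d_z_mult = wirtinger_mult[where c="- \<i>", folded d_z_wirtinger]
lemmas d_zbar_mult = wirtinger_mult[where c="\<i>", folded d_zbar_wirtinger]
lemmas d_z_cmult = wirtinger_cmult[where c="- \<i>", folded d_z_wirtinger]
lemmas d_zbar_cmult = wirtinger_cmult[where c="\<i>", folded d_zbar_wirtinger]
lemmas d_z_sum = wirtinger_sum[where c="- \<i>", folded d_z_wirtinger]
lemmas d_zbar_sum = wirtinger_sum[where c="\<i>", folded d_zbar_wirtinger]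

lemma d_z_eqI: "(f has_derivative D) (at z) \<Longrightarrow> d_z a f z = (D (axis a 1) - \<i> * D (axis a \<i>)) / 2"
  by (simp add: wirtinger_eqI d_z_wirtinger)

section \<open>Mean value estimates and the symmetry of second derivatives\<close>

lemma increment_bound:
  fixes f :: "'a::real_normed_vector \<Rightarrow> complex"
  assumes f: "\<And>z. (f has_derivative D z) (at z)"
    and B: "\<And>t. 0 \<le> t \<Longrightarrow> t \<le> 1 \<Longrightarrow> norm (D (z + t *\<^sub>R v) v - c) \<le> B"
  shows "norm (f (z + v) - f z - c) \<le> B"
proof -
  \<comment> \<open>The mean value inequality for the curve
    \<open>f (z + t *\<^sub>R v) - t *\<^sub>R c\<close> on the unit interval; subtracting the
    linear term turns a bound on the derivative into a bound on the deviation from the increment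
    \<open>c\<close>.\<close>
  have "norm ((f (z + 1 *\<^sub>R v) - 1 *\<^sub>R c) - (f (z + 0 *\<^sub>R v) - 0 *\<^sub>R c)) \<le> B * norm (1 - 0 :: real)"
  proof (rule differentiable_bound[where S="{0..1}" and f="\<lambda>t. f (z + t *\<^sub>R v) - t *\<^sub>R c"
        and f'="\<lambda>t h. D (z + t *\<^sub>R v) (h *\<^sub>R v) - h *\<^sub>R c"])
    fix t :: real assume t: "t \<in> {0..1}"
    have "((\<lambda>t. z + t *\<^sub>R v) has_derivative (\<lambda>h. h *\<^sub>R v)) (at t)"
      by (auto intro!: derivative_eq_intros)
    from has_derivative_compose[OF this f]
    have "((\<lambda>t. f (z + t *\<^sub>R v)) has_derivative (\<lambda>h. D (z + t *\<^sub>R v) (h *\<^sub>R v))) (at t)" .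
    then have "((\<lambda>t. f (z + t *\<^sub>R v) - t *\<^sub>R c) has_derivative
        (\<lambda>h. D (z + t *\<^sub>R v) (h *\<^sub>R v) - h *\<^sub>R c)) (at t)"
      by (rule has_derivative_diff[OF _ bounded_linear_imp_has_derivative[OF bounded_linear_scaleR_left]])
    then show "((\<lambda>t. f (z + t *\<^sub>R v) - t *\<^sub>R c) has_derivative
        (\<lambda>h. D (z + t *\<^sub>R v) (h *\<^sub>R v) - h *\<^sub>R c)) (at t within {0..1})"
      by (rule has_derivative_at_withinI)
    show "onorm (\<lambda>h. D (z + t *\<^sub>R v) (h *\<^sub>R v) - h *\<^sub>R c) \<le> B"
    proof (rule onorm_bound)
      show "0 \<le> B" by (rule order_trans[OF norm_ge_zero B[of 0]]) simp_all
      fix h :: real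
      have "D (z + t *\<^sub>R v) (h *\<^sub>R v) - h *\<^sub>R c = h *\<^sub>R (D (z + t *\<^sub>R v) v - c)"
        using linear_scale[OF has_derivative_linear[OF f]] by (simp add: scaleR_diff_right)
      then show "norm (D (z + t *\<^sub>R v) (h *\<^sub>R v) - h *\<^sub>R c) \<le> B * norm h"
        using mult_left_mono[OF B[of t], of "\<bar>h\<bar>"] t by (simp add: mult.commute)
    qed
  qed auto
  then show ?thesis by (simp add: algebra_simps)
qed

text \<open>The mean value inequality is used twice: in direction \<open>w\<close> for the
  derivative along \<open>v\<close>, then in direction \<open>v\<close> for the map taking
  \<open>x\<close> to \<open>f (x + s *\<^sub>R w) - f x\<close>. Only one of the two mixed
  derivatives is involved, although the second difference itself is symmetric.\<close>

lemma second_difference_bound: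
  assumes f: "smooth f" and s: "s > 0"
    and B: "\<And>t t'. 0 \<le> t \<Longrightarrow> t \<le> s \<Longrightarrow> 0 \<le> t' \<Longrightarrow> t' \<le> s \<Longrightarrow>
      norm (frechet_derivative (\<lambda>z. frechet_derivative f (at z) v) (at (z + t *\<^sub>R v + t' *\<^sub>R w)) w - A) \<le> e"
  shows "norm (f (z + s *\<^sub>R v + s *\<^sub>R w) - f (z + s *\<^sub>R v) - (f (z + s *\<^sub>R w) - f z) - (s * s) *\<^sub>R A) \<le> s * s * e"
proof -
  let ?Dv = "\<lambda>z. frechet_derivative f (at z) v"
  have lin: "linear (frechet_derivative g (at z))" if "smooth g" for g z
    using has_derivative_linear[OF smooth_imp_has_derivative[OF that]] .
  have *: "norm (?Dv (z + t *\<^sub>R v + s *\<^sub>R w) - ?Dv (z + t *\<^sub>R v) - s *\<^sub>R A) \<le> s * e" if t: "0 \<le> t" "t \<le> s" for t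
  proof (rule increment_bound[OF smooth_imp_has_derivative[OF smooth_derivative[OF f]]])
    fix t' :: real assume t': "0 \<le> t'" "t' \<le> 1"
    have "norm (frechet_derivative ?Dv (at (z + t *\<^sub>R v + (t' * s) *\<^sub>R w)) w - A) \<le> e"
      using t t' s by (intro B) (auto simp: mult_le_cancel_right1)
    then show "norm (frechet_derivative ?Dv (at (z + t *\<^sub>R v + t' *\<^sub>R s *\<^sub>R w)) (s *\<^sub>R w) - s *\<^sub>R A) \<le> s * e"
      using s unfolding linear_scale[OF lin[OF smooth_derivative[OF f]]] scaleR_diff_right[symmetric]
      by simp
  qed
  have d: "((\<lambda>x. f (x + s *\<^sub>R w) - f x) has_derivative
        (\<lambda>h. frechet_derivative f (at (x + s *\<^sub>R w)) h - frechet_derivative f (at x) h)) (at x)" for x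
  proof (rule has_derivative_diff[OF _ smooth_imp_has_derivative[OF f]])
    show "((\<lambda>x. f (x + s *\<^sub>R w)) has_derivative frechet_derivative f (at (x + s *\<^sub>R w))) (at x)"
      by (rule has_derivative_compose[OF _ smooth_imp_has_derivative[OF f]])
         (rule has_derivative_add_const[OF has_derivative_ident])
  qed
  have "norm ((f (z + s *\<^sub>R v + s *\<^sub>R w) - f (z + s *\<^sub>R v)) - (f (z + s *\<^sub>R w) - f z) - (s * s) *\<^sub>R A) \<le> s * s * e"
  proof (rule increment_bound[OF d])
    fix t :: real assume t: "0 \<le> t" "t \<le> 1"
    have "norm (?Dv (z + (t * s) *\<^sub>R v + s *\<^sub>R w) - ?Dv (z + (t * s) *\<^sub>R v) - s *\<^sub>R A) \<le> s * e"
      using t s by (intro *) (auto simp: mult_le_cancel_right1)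
    from mult_left_mono[OF this, of s]
    show "norm (frechet_derivative f (at (z + t *\<^sub>R s *\<^sub>R v + s *\<^sub>R w)) (s *\<^sub>R v) -
         frechet_derivative f (at (z + t *\<^sub>R s *\<^sub>R v)) (s *\<^sub>R v) - (s * s) *\<^sub>R A) \<le> s * s * e"
      using s unfolding linear_scale[OF lin[OF f]] scaleR_scaleR[symmetric] scaleR_diff_right[symmetric]
      by (simp add: mult.assoc)
  qed
  then show ?thesis by simp
qed

text \<open>The second difference is symmetric in \<open>v\<close> and \<open>w\<close>, and divided
  by \<open>s * s\<close> it tends to either mixed derivative.\<close>

lemma second_derivative_commute:
  assumes f: "smooth f"
  shows "frechet_derivative (\<lambda>z. frechet_derivative f (at z) v) (at z) w =
         frechet_derivative (\<lambda>z. frechet_derivative f (at z) w) (at z) v" (is "?A v w z = ?A w v z")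
proof -
  have main: "\<exists>d>0. \<forall>s. 0 < s \<and> s < d \<longrightarrow>
      norm (f (z + s *\<^sub>R v + s *\<^sub>R w) - f (z + s *\<^sub>R v) - (f (z + s *\<^sub>R w) - f z) - (s * s) *\<^sub>R ?A v w z) \<le> s * s * e"
    if e: "e > 0" for e :: real and v w
  proof -
    have "continuous (at z) (\<lambda>z. ?A v w z)"
      using smooth_imp_continuous[OF smooth_derivative[OF smooth_derivative[OF f]], of UNIV]
      by (simp add: continuous_on_eq_continuous_at)
    then obtain d where d: "d > 0" "\<And>x. dist x z < d \<Longrightarrow> dist (?A v w x) (?A v w z) < e"
      using e unfolding continuous_at_eps_delta by (metis (no_types, lifting))
    \<comment> \<open>For \<open>t\<close> and \<open>t'\<close> below \<open>d'\<close> the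
      displacement by \<open>t *\<^sub>R v + t' *\<^sub>R w\<close> is shorter than
      \<open>d\<close>; the summand 1 keeps the denominator positive.\<close>
    define d' where "d' = d / (1 + norm v + norm w)"
    have "d' > 0" unfolding d'_def using d by (auto intro!: divide_pos_pos add_pos_nonneg)
    moreover have "norm (f (z + s *\<^sub>R v + s *\<^sub>R w) - f (z + s *\<^sub>R v) - (f (z + s *\<^sub>R w) - f z) - (s * s) *\<^sub>R ?A v w z)
        \<le> s * s * e" if s: "0 < s" "s < d'" for s
    proof (rule second_difference_bound[OF f s(1)])
      fix t t' assume t: "0 \<le> t" "t \<le> s" "0 \<le> t'" "t' \<le> s"
      have "norm (t *\<^sub>R v + t' *\<^sub>R w) \<le> t * norm v + t' * norm w"
        using t norm_triangle_ineq[of "t *\<^sub>R v" "t' *\<^sub>R w"] by simp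
      also have "\<dots> \<le> s * norm v + s * norm w" using t by (intro add_mono mult_right_mono) auto
      also have "\<dots> < s * (1 + norm v + norm w)" using s by (simp add: algebra_simps)
      also have "\<dots> \<le> d' * (1 + norm v + norm w)" using s by (intro mult_right_mono) auto
      also have "\<dots> = d" unfolding d'_def
        using add_pos_nonneg[of 1 "norm v + norm w"] by (simp add: add.assoc)
      finally have "dist (z + t *\<^sub>R v + t' *\<^sub>R w) z < d" by (simp add: dist_norm add.assoc)
      from d(2)[OF this] show "norm (?A v w (z + t *\<^sub>R v + t' *\<^sub>R w) - ?A v w z) \<le> e"
        by (simp add: dist_norm)
    qed
    ultimately show ?thesis by blast
  qed
  have "norm (?A v w z - ?A w v z) \<le> e" if "e > 0" for e
  proof -
    have e2: "e / 2 > 0" using that by simp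
    obtain d1 where d1: "d1 > 0" "\<And>s. 0 < s \<Longrightarrow> s < d1 \<Longrightarrow>
      norm (f (z + s *\<^sub>R v + s *\<^sub>R w) - f (z + s *\<^sub>R v) - (f (z + s *\<^sub>R w) - f z) - (s * s) *\<^sub>R ?A v w z) \<le> s * s * (e/2)"
      using main[OF e2, of v w] by blast
    obtain d2 where d2: "d2 > 0" "\<And>s. 0 < s \<Longrightarrow> s < d2 \<Longrightarrow>
      norm (f (z + s *\<^sub>R w + s *\<^sub>R v) - f (z + s *\<^sub>R w) - (f (z + s *\<^sub>R v) - f z) - (s * s) *\<^sub>R ?A w v z) \<le> s * s * (e/2)"
      using main[OF e2, of w v] by blast
    define s where "s = min d1 d2 / 2"
    have s: "0 < s" "s < d1" "s < d2" using d1(1) d2(1) by (auto simp: s_def)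
    let ?X = "f (z + s *\<^sub>R v + s *\<^sub>R w) - f (z + s *\<^sub>R v) - (f (z + s *\<^sub>R w) - f z)"
    have X: "f (z + s *\<^sub>R w + s *\<^sub>R v) - f (z + s *\<^sub>R w) - (f (z + s *\<^sub>R v) - f z) = ?X"
      by (simp add: add_ac)
    have "norm ((?X - (s * s) *\<^sub>R ?A w v z) - (?X - (s * s) *\<^sub>R ?A v w z)) \<le> s * s * (e/2) + s * s * (e/2)"
      by (rule order_trans[OF norm_triangle_ineq4 add_mono]) (use d1(2)[of s] d2(2)[of s] s X in auto)
    also have "(?X - (s * s) *\<^sub>R ?A w v z) - (?X - (s * s) *\<^sub>R ?A v w z) = (s * s) *\<^sub>R (?A v w z - ?A w v z)"
      by (simp add: scaleR_diff_right)
    also have "s * s * (e/2) + s * s * (e/2) = (s * s) * e" by (simp add: field_simps)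
    finally have "(s * s) * norm (?A v w z - ?A w v z) \<le> (s * s) * e" by simp
    moreover have "0 < s * s" using s by simp
    ultimately show ?thesis by (rule mult_left_le_imp_le)
  qed
  then have "norm (?A v w z - ?A w v z) \<le> 0"
    by (rule field_le_epsilon) (simp only: add_0)
  then show ?thesis by (simp only: norm_le_zero_iff right_minus_eq)
qed

lemma derivative_lincomb:
  assumes "smooth f" "smooth g"
  shows "frechet_derivative (\<lambda>z. (f z + c * g z) / 2) (at z) v =
    (frechet_derivative f (at z) v + c * frechet_derivative g (at z) v) / 2"
proof -
  have "((\<lambda>z. (1/2) * (f z + c * g z)) has_derivative
     (\<lambda>v. (1/2) * (frechet_derivative f (at z) v + c * frechet_derivative g (at z) v))) (at z)"
    by (rule has_derivative_mult_right has_derivative_add smooth_imp_has_derivative assms)+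
  then have "((\<lambda>z. (f z + c * g z) / 2) has_derivative
     (\<lambda>v. (frechet_derivative f (at z) v + c * frechet_derivative g (at z) v) / 2)) (at z)"
    by simp
  then show ?thesis by (subst frechet_derivative_at[symmetric]) (assumption, rule refl)
qed

lemma wirtinger_commute:
  assumes f: "smooth f"
  shows "wirtinger c a (wirtinger d b f) z = wirtinger d b (wirtinger c a f) z"
  unfolding wirtinger_def derivative_lincomb[OF smooth_derivative[OF f] smooth_derivative[OF f]]
  using second_derivative_commute[OF f, of "axis a 1" z "axis b 1"]
    second_derivative_commute[OF f, of "axis a 1" z "axis b \<i>"]
    second_derivative_commute[OF f, of "axis a \<i>" z "axis b 1"]
    second_derivative_commute[OF f, of "axis a \<i>" z "axis b \<i>"]
  by (simp add: field_simps)

lemma d_z_d_zbar_commute: "smooth f \<Longrightarrow> d_z a (d_zbar b f) z = d_zbar b (d_z a f) z"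
  unfolding d_z_wirtinger d_zbar_wirtinger by (rule wirtinger_commute)

lemma d_z_commute: "smooth f \<Longrightarrow> d_z a (d_z b f) z = d_z b (d_z a f) z"
  unfolding d_z_wirtinger by (rule wirtinger_commute)

lemma d_zbar_commute: "smooth f \<Longrightarrow> d_zbar a (d_zbar b f) z = d_zbar b (d_zbar a f) z"
  unfolding d_zbar_wirtinger by (rule wirtinger_commute)

section \<open>Compactly supported functions and integration by parts\<close>

lemma CcI:
  assumes "continuous_on UNIV f" "compact K" "\<And>z. z \<notin> K \<Longrightarrow> f z = 0"
  shows "f \<in> Cc"
proof -
  have "closure {z. f z \<noteq> 0} \<subseteq> K"
    using assms by (intro closure_minimal compact_imp_closed) auto
  then have "compact (closure {z. f z \<noteq> 0})"
    using assms(2) compact_closure bounded_subset compact_imp_bounded closure_subset by metis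
  then show ?thesis using assms by (simp add: Cc_def)
qed

lemma Cc_continuous: "f \<in> Cc \<Longrightarrow> continuous_on S f"
  using continuous_on_subset[OF _ subset_UNIV] by (auto simp: Cc_def)

lemma Cc_radius:
  assumes "f \<in> Cc"
  obtains r where "r > 0" "\<And>z. norm z \<ge> r \<Longrightarrow> f z = 0"
proof -
  have "bounded {z. f z \<noteq> 0}"
    using assms by (auto simp: Cc_def intro: bounded_subset[OF compact_imp_bounded closure_subset])
  then obtain b where b: "\<And>z. f z \<noteq> 0 \<Longrightarrow> norm z \<le> b" by (auto simp: bounded_iff)
  show ?thesis
  proof (rule that)
    show "\<bar>b\<bar> + 1 > 0" by simp
    show "f z = 0" if "norm z \<ge> \<bar>b\<bar> + 1" for z using b[of z] that by (cases "f z = 0") auto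
  qed
qed

lemma CcI_radius: "continuous_on UNIV f \<Longrightarrow> (\<And>z. norm z \<ge> r \<Longrightarrow> f z = 0) \<Longrightarrow> f \<in> Cc"
  by (rule CcI[of f "cball 0 r"]) auto

lemma Cc_mult_left: "f \<in> Cc \<Longrightarrow> continuous_on UNIV g \<Longrightarrow> (\<lambda>z. g z * f z) \<in> Cc"
  by (rule CcI[where K="closure {z. f z \<noteq> 0}"])
     (auto simp: Cc_def closure_def intro!: continuous_intros)

lemma Cc_mult_right: "f \<in> Cc \<Longrightarrow> continuous_on UNIV g \<Longrightarrow> (\<lambda>z. f z * g z) \<in> Cc"
  using Cc_mult_left[of f g] by (simp add: mult.commute)

lemma Cc_cmult: "f \<in> Cc \<Longrightarrow> (\<lambda>z. c * f z) \<in> Cc"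
  by (rule Cc_mult_left) auto

lemma Cc_zero [simp]: "(\<lambda>z. 0) \<in> Cc"
  by (rule CcI[of _ "{}"]) auto

lemma Cc_add:
  assumes "f \<in> Cc" "g \<in> Cc" shows "(\<lambda>z. f z + g z) \<in> Cc"
proof -
  obtain r where r: "\<And>z. norm z \<ge> r \<Longrightarrow> f z = 0" using Cc_radius[OF assms(1)] by blast
  obtain s where s: "\<And>z. norm z \<ge> s \<Longrightarrow> g z = 0" using Cc_radius[OF assms(2)] by blast
  show ?thesis
    by (rule CcI_radius[where r="max r s"])
       (use assms r s in \<open>auto intro: continuous_on_add Cc_continuous\<close>)
qed

lemma Cc_diff: "f \<in> Cc \<Longrightarrow> g \<in> Cc \<Longrightarrow> (\<lambda>z. f z - g z) \<in> Cc"
  using Cc_add[OF _ Cc_cmult[of g "-1"], of f] by simp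

lemma Cc_sum: "(\<And>i. i \<in> I \<Longrightarrow> f i \<in> Cc) \<Longrightarrow> (\<lambda>z. \<Sum>i\<in>I. f i z) \<in> Cc"
  by (induction I rule: infinite_finite_induct) (auto intro!: Cc_add)

lemma Cc_bdd_above:
  assumes "f \<in> Cc" shows "bdd_above (range (\<lambda>z. cmod (f z)))"
proof -
  obtain r where r: "r > 0" "\<And>z. norm z \<ge> r \<Longrightarrow> f z = 0" using Cc_radius[OF assms] by blast
  have "compact (f ` cball 0 r)"
    by (intro compact_continuous_image Cc_continuous assms) auto
  then obtain b where "\<forall>x\<in>f ` cball 0 r. cmod x \<le> b"
    using compact_imp_bounded bounded_iff by blast
  then have b: "cmod (f z) \<le> b" if "norm z \<le> r" for z using that by auto
  have "cmod (f z) \<le> \<bar>b\<bar>" for z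
    using b[of z] r(2)[of z] by (cases "norm z \<le> r") auto
  then show ?thesis by (intro bdd_aboveI) auto
qed

definition sup_norm :: "(complex ^ 'n \<Rightarrow> complex) \<Rightarrow> real" where
  "sup_norm f = (SUP z. cmod (f z))"

lemma sup_norm_upper: "f \<in> Cc \<Longrightarrow> cmod (f z) \<le> sup_norm f"
  unfolding sup_norm_def by (intro cSUP_upper Cc_bdd_above) auto

lemma sup_norm_least: "(\<And>z. cmod (f z) \<le> B) \<Longrightarrow> sup_norm f \<le> B"
  unfolding sup_norm_def by (intro cSUP_least) auto

lemma sup_norm_nonneg: "f \<in> Cc \<Longrightarrow> 0 \<le> sup_norm f"
  using order_trans[OF norm_ge_zero sup_norm_upper] .

lemma Cc_integrable: 
  assumes "f \<in> Cc" shows "integrable lborel f"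
proof -
  obtain r where r: "\<And>z. norm z \<ge> r \<Longrightarrow> f z = 0" using Cc_radius[OF assms] by blast
  have "(\<lambda>x. indicator (cball 0 r) x *\<^sub>R f x) = f" using r by (auto simp: indicator_def fun_eq_iff)
  then show ?thesis
    using borel_integrable_compact[OF compact_cball Cc_continuous[OF assms], of 0 r] by simp
qed

lemma Cc_smooth_iff: "f \<in> Cc_smooth \<longleftrightarrow> f \<in> Cc \<and> smooth f"
  by (simp add: Cc_smooth_def smooth_def)

lemma Cc_smooth_derivative:
  assumes "f \<in> Cc_smooth" shows "(\<lambda>z. frechet_derivative f (at z) v) \<in> Cc_smooth"
proof -
  have f: "f \<in> Cc" "smooth f" using assms by (auto simp: Cc_smooth_iff)
  let ?K = "closure {z. f z \<noteq> 0}"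
  have "frechet_derivative f (at z) v = 0" if "z \<notin> ?K" for z
  proof -
    have "(f has_derivative (\<lambda>v. 0)) (at z)"
    proof (rule has_derivative_transform_within_open[OF has_derivative_const[of 0]])
      show "open (- ?K)" by (rule open_Compl[OF closed_closure])
    qed (use that closure_subset[of "{z. f z \<noteq> 0}"] in auto)
    from frechet_derivative_at[OF this] show ?thesis by (simp add: fun_eq_iff)
  qed
  then have "(\<lambda>z. frechet_derivative f (at z) v) \<in> Cc"
    using f by (intro CcI[where K="?K"] smooth_imp_continuous smooth_derivative) (auto simp: Cc_def)
  then show ?thesis using smooth_derivative[OF f(2)] by (simp add: Cc_smooth_iff)
qed

lemma Cc_smooth_mult: "f \<in> Cc_smooth \<Longrightarrow> smooth g \<Longrightarrow> (\<lambda>z. f z * g z) \<in> Cc_smooth"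
  by (auto simp: Cc_smooth_iff intro!: Cc_mult_right smooth_imp_continuous)

lemma Cc_smooth_add: "f \<in> Cc_smooth \<Longrightarrow> g \<in> Cc_smooth \<Longrightarrow> (\<lambda>z. f z + g z) \<in> Cc_smooth"
  by (auto simp: Cc_smooth_iff intro!: Cc_add)

lemma Cc_smooth_wirtinger:
  assumes "f \<in> Cc_smooth" shows "wirtinger c a f \<in> Cc_smooth"
proof -
  have "(\<lambda>z. (frechet_derivative f (at z) (axis a 1) +
          frechet_derivative f (at z) (axis a \<i>) * c) * (1/2)) \<in> Cc_smooth"
    by (intro Cc_smooth_mult Cc_smooth_add Cc_smooth_derivative assms smooth_const)
  then show ?thesis by (simp add: wirtinger_def[abs_def] mult.commute)
qed

lemmas Cc_smooth_d_z = Cc_smooth_wirtinger[where c="- \<i>", folded d_z_wirtinger]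
lemmas Cc_smooth_d_zbar = Cc_smooth_wirtinger[where c="\<i>", folded d_zbar_wirtinger]

section \<open>Integration by parts for compactly supported functions\<close>

lemma lborel_integral_translation:
  fixes f :: "'a::euclidean_space \<Rightarrow> complex"
  assumes "f \<in> borel_measurable borel"
  shows "(LINT z|lborel. f (z + c)) = (LINT z|lborel. f z)"
proof -
  have "(LINT z|lborel. f z) = (LINT z|distr lborel borel ((+) c). f z)"
    by (simp only: lborel_distr_plus)
  also have "\<dots> = (LINT z|lborel. f (c + z))"
    using assms by (intro integral_distr) auto
  finally show ?thesis by (simp add: add.commute)
qed

text \<open>Translation invariance makes the integrals of all difference quotients vanish; dominated
  convergence passes this on to the derivative.\<close>

lemma integral_derivative_eq_0:
  assumes "f \<in> Cc_smooth"
  shows "(LINT z|lborel. frechet_derivative f (at z) v) = 0"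
proof -
  have f: "f \<in> Cc" "smooth f" using assms by (auto simp: Cc_smooth_iff)
  let ?D = "\<lambda>z. frechet_derivative f (at z) v"
  have D: "?D \<in> Cc" using Cc_smooth_derivative[OF assms] by (simp add: Cc_smooth_iff)
  obtain r where r: "r > 0" "\<And>z. norm z \<ge> r \<Longrightarrow> f z = 0" using Cc_radius[OF f(1)] by blast
  define s where "s n = inverse (real (Suc n))" for n
  have s: "s n > 0" "s n \<le> 1" for n by (auto simp: s_def inverse_le_1_iff)
  define F where "F n z = (f (z + s n *\<^sub>R v) - f z) /\<^sub>R s n" for n z
  have meas: "f \<in> borel_measurable borel" "?D \<in> borel_measurable borel"
    by (auto intro!: borel_measurable_continuous_onI Cc_continuous f D)
  have cont: "continuous_on UNIV (\<lambda>z. f (z + c))" for c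
    by (rule continuous_on_compose2[OF Cc_continuous[OF f(1), of UNIV]]) (auto intro!: continuous_intros)
  have shift: "(\<lambda>z. f (z + c)) \<in> Cc" for c
  proof (rule CcI_radius[OF cont])
    show "f (z + c) = 0" if "norm z \<ge> r + norm c" for z
      using r(2)[of "z + c"] that norm_triangle_ineq4[of "z + c" c] by simp
  qed
  have F0: "(LINT z|lborel. F n z) = 0" for n
    unfolding F_def
    by (simp add: Bochner_Integration.integral_diff Cc_integrable shift f lborel_integral_translation meas)
  \<comment> \<open>By the mean value inequality every quotient is bounded by the supremum of the
    derivative, and since the steps \<open>s n\<close> are at most 1 all quotients vanish outside
    the ball of radius \<open>r + norm v\<close>.\<close>
  have "(\<lambda>n. LINT z|lborel. F n z) \<longlonglongrightarrow> (LINT z|lborel. ?D z)"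
  proof (rule integral_dominated_convergence[where w="\<lambda>z. indicator (cball 0 (r + norm v)) z *\<^sub>R sup_norm ?D"])
    show "F n \<in> borel_measurable lborel" for n
      unfolding F_def using meas cont[of "s n *\<^sub>R v"]
      by (auto intro!: borel_measurable_continuous_onI continuous_intros Cc_continuous f)
    show "integrable lborel (\<lambda>z. indicator (cball 0 (r + norm v)) z *\<^sub>R sup_norm ?D)"
      by (rule borel_integrable_compact) auto
    show "AE z in lborel. (\<lambda>n. F n z) \<longlonglongrightarrow> ?D z"
    proof (rule AE_I2)
      fix z
      have "((\<lambda>t. f (z + t *\<^sub>R v)) has_vector_derivative ?D z) (at 0)"
      proof -
        have "((\<lambda>t. z + t *\<^sub>R v) has_derivative (\<lambda>h. h *\<^sub>R v)) (at 0)"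
          by (auto intro!: derivative_eq_intros)
        from has_derivative_compose[OF this, of f "frechet_derivative f (at z)"]
        show ?thesis
          using smooth_imp_has_derivative[OF f(2), of z]
          by (simp add: has_vector_derivative_def linear_scale[OF has_derivative_linear[OF smooth_imp_has_derivative[OF f(2)]]])
      qed
      then have lim: "((\<lambda>h. norm (f (z + h *\<^sub>R v) - f z - h *\<^sub>R ?D z) / norm h) \<longlongrightarrow> 0) (at 0)"
        by (simp add: has_vector_derivative_def has_derivative_at)
      have "filterlim s (at 0) sequentially"
        unfolding filterlim_at using s LIMSEQ_inverse_real_of_nat
        by (auto simp: s_def[abs_def] simp del: of_nat_Suc)
      from filterlim_compose[OF lim this]
      have "(\<lambda>n. norm (f (z + s n *\<^sub>R v) - f z - s n *\<^sub>R ?D z) / norm (s n)) \<longlonglongrightarrow> 0" .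
      also have "(\<lambda>n. norm (f (z + s n *\<^sub>R v) - f z - s n *\<^sub>R ?D z) / norm (s n)) = (\<lambda>n. norm (F n z - ?D z))"
      proof
        fix n
        have "F n z - ?D z = (f (z + s n *\<^sub>R v) - f z - s n *\<^sub>R ?D z) /\<^sub>R s n"
          using s(1)[of n] by (simp add: F_def scaleR_diff_right)
        then show "norm (f (z + s n *\<^sub>R v) - f z - s n *\<^sub>R ?D z) / norm (s n) = norm (F n z - ?D z)"
          using s(1)[of n] by (simp add: divide_inverse mult.commute)
      qed
      finally show "(\<lambda>n. F n z) \<longlonglongrightarrow> ?D z"
        by (rule LIM_zero_cancel[OF tendsto_norm_zero_cancel])
    qed
    show "AE z in lborel. norm (F n z) \<le> indicator (cball 0 (r + norm v)) z *\<^sub>R sup_norm ?D" for n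
    proof (rule AE_I2)
      fix z
      have lin: "frechet_derivative f (at x) (s n *\<^sub>R v) = s n *\<^sub>R frechet_derivative f (at x) v" for x
        by (rule linear_scale[OF has_derivative_linear[OF smooth_imp_has_derivative[OF f(2)]]])
      have "norm (f (z + s n *\<^sub>R v) - f z - 0) \<le> s n * sup_norm ?D"
      proof (rule increment_bound[OF smooth_imp_has_derivative[OF f(2)]])
        fix t :: real
        have "norm (frechet_derivative f (at (z + t *\<^sub>R s n *\<^sub>R v)) (s n *\<^sub>R v) - 0) =
            s n * norm (frechet_derivative f (at (z + t *\<^sub>R s n *\<^sub>R v)) v)"
          unfolding lin diff_zero norm_scaleR using s(1)[of n] by (simp only: abs_of_pos)
        also have "\<dots> \<le> s n * sup_norm ?D"
          by (rule mult_left_mono[OF sup_norm_upper[OF D] less_imp_le[OF s(1)]])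
        finally show "norm (frechet_derivative f (at (z + t *\<^sub>R s n *\<^sub>R v)) (s n *\<^sub>R v) - 0) \<le> s n * sup_norm ?D" .
      qed
      then have "inverse (s n) * norm (f (z + s n *\<^sub>R v) - f z) \<le> inverse (s n) * (s n * sup_norm ?D)"
        unfolding diff_zero by (rule mult_left_mono) (use s(1)[of n] in simp)
      also have "inverse (s n) * (s n * sup_norm ?D) = sup_norm ?D"
        using s(1)[of n] by (simp add: mult.assoc[symmetric])
      also have "inverse (s n) * norm (f (z + s n *\<^sub>R v) - f z) = norm (F n z)"
        unfolding F_def norm_scaleR using s(1)[of n] by (simp only: abs_of_pos positive_imp_inverse_positive)
      finally have "norm (F n z) \<le> sup_norm ?D" .
      moreover have "F n z = 0" if "z \<notin> cball 0 (r + norm v)"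
      proof -
        have "norm (s n *\<^sub>R v) \<le> norm v" using s[of n] by (simp add: mult_left_le_one_le)
        moreover have "r + norm v < norm z" using that by simp
        moreover have "norm z \<le> norm (z + s n *\<^sub>R v) + norm (s n *\<^sub>R v)"
          using norm_triangle_ineq4[of "z + s n *\<^sub>R v" "s n *\<^sub>R v"] by simp
        ultimately have "norm (z + s n *\<^sub>R v) \<ge> r" "norm z \<ge> r"
          using norm_ge_zero[of v] by linarith+
        then show ?thesis using r by (simp add: F_def)
      qed
      ultimately show "norm (F n z) \<le> indicator (cball 0 (r + norm v)) z *\<^sub>R sup_norm ?D"
        by (auto simp: indicator_def)
    qed
  qed (use meas in auto)
  then show ?thesis unfolding F0 by (simp add: LIMSEQ_const_iff)
qed

lemma integral_wirtinger_eq_0: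
  assumes "f \<in> Cc_smooth" shows "(LINT z|lborel. wirtinger c a f z) = 0"
  using Cc_smooth_derivative[OF assms, of "axis a 1"] Cc_smooth_derivative[OF assms, of "axis a \<i>"]
  by (simp add: wirtinger_def Bochner_Integration.integral_add Cc_smooth_iff Cc_integrable Cc_cmult
      integral_derivative_eq_0[OF assms])

lemma integration_by_parts:
  assumes "f \<in> Cc_smooth" "smooth g"
  shows "(LINT z|lborel. f z * wirtinger c a g z) = - (LINT z|lborel. wirtinger c a f z * g z)"
proof -
  have f: "f \<in> Cc" "smooth f" "wirtinger c a f \<in> Cc"
    using assms Cc_smooth_wirtinger[OF assms(1)] by (auto simp: Cc_smooth_iff)
  have "0 = (LINT z|lborel. wirtinger c a (\<lambda>z. f z * g z) z)"
    using integral_wirtinger_eq_0[OF Cc_smooth_mult[OF assms]] by simp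
  also have "\<dots> = (LINT z|lborel. f z * wirtinger c a g z + wirtinger c a f z * g z)"
    by (simp add: wirtinger_mult[OF f(2) assms(2)])
  also have "\<dots> = (LINT z|lborel. f z * wirtinger c a g z) + (LINT z|lborel. wirtinger c a f z * g z)"
    by (intro Bochner_Integration.integral_add Cc_integrable Cc_mult_right f smooth_imp_continuous smooth_wirtinger assms)
  finally show ?thesis by (simp add: eq_neg_iff_add_eq_0)
qed

section \<open>Smooth cutoff functions\<close>

text \<open>The derivative is quantified existentially, so a closure rule only has to name it;
  \<open>Ck_radial\<close> transports the class to functions of several complex variables.\<close>

primrec Cr :: "nat \<Rightarrow> (real \<Rightarrow> real) \<Rightarrow> bool" where
  "Cr 0 g \<longleftrightarrow> continuous_on UNIV g"
| "Cr (Suc r) g \<longleftrightarrow> (\<exists>g'. (\<forall>x. (g has_real_derivative g' x) (at x)) \<and> Cr r g')"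

lemma Cr_SucI: "(\<And>x. (g has_real_derivative g' x) (at x)) \<Longrightarrow> Cr r g' \<Longrightarrow> Cr (Suc r) g"
  by auto

lemma Cr_Suc_imp_Cr: "Cr (Suc r) g \<Longrightarrow> Cr r g"
proof (induction r arbitrary: g)
  case 0
  then show ?case by (auto intro!: continuous_at_imp_continuous_on intro: DERIV_isCont)
next
  case (Suc r)
  from Suc.prems obtain g' where "\<And>x. (g has_real_derivative g' x) (at x)" "Cr (Suc r) g'"
    unfolding Cr.simps(2)[of "Suc r"] by blast
  then show ?case using Suc.IH[of g'] by (intro Cr_SucI)
qed

lemma Cr_affine: "Cr r (\<lambda>x. c * x + d)"
proof -
  have const: "Cr r (\<lambda>x. c)" for r c
    by (induction r arbitrary: c) (auto intro!: exI[of _ "\<lambda>x. 0"])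
  have "((\<lambda>x. c * x + d) has_real_derivative c) (at x)" for x
    by (auto intro!: derivative_eq_intros)
  then show ?thesis by (cases r) (auto intro!: const exI[of _ "\<lambda>x. c"] continuous_intros)
qed

lemma Cr_add: "Cr r f \<Longrightarrow> Cr r g \<Longrightarrow> Cr r (\<lambda>x. f x + g x)"
proof (induction r arbitrary: f g)
  case 0
  then show ?case by (auto intro: continuous_intros)
next
  case (Suc r)
  then obtain f' g' where d: "\<And>x. (f has_real_derivative f' x) (at x)" "Cr r f'"
    "\<And>x. (g has_real_derivative g' x) (at x)" "Cr r g'" by auto
  have "((\<lambda>x. f x + g x) has_real_derivative f' x + g' x) (at x)" for x
    by (intro DERIV_add d)
  from this Suc.IH[OF d(2,4)] show ?case by (rule Cr_SucI)
qed

lemma Cr_mult: "Cr r f \<Longrightarrow> Cr r g \<Longrightarrow> Cr r (\<lambda>x. f x * g x)"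
proof (induction r arbitrary: f g)
  case 0
  then show ?case by (auto intro: continuous_intros)
next
  case (Suc r)
  from Suc.prems obtain f' g' where d: "\<And>x. (f has_real_derivative f' x) (at x)" "Cr r f'"
    "\<And>x. (g has_real_derivative g' x) (at x)" "Cr r g'" by auto
  have "((\<lambda>x. f x * g x) has_real_derivative f' x * g x + g' x * f x) (at x)" for x
    by (intro DERIV_mult d)
  moreover have "Cr r (\<lambda>x. f' x * g x + g' x * f x)"
    using Suc.prems[THEN Cr_Suc_imp_Cr] by (intro Cr_add Suc.IH d)
  ultimately show ?case by (rule Cr_SucI)
qed

lemma Cr_inverse: "Cr r f \<Longrightarrow> (\<And>x. f x \<noteq> 0) \<Longrightarrow> Cr r (\<lambda>x. inverse (f x))"
proof (induction r arbitrary: f)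
  case 0
  then show ?case by (auto intro: continuous_intros)
next
  case (Suc r)
  from Suc.prems obtain f' where d: "\<And>x. (f has_real_derivative f' x) (at x)" "Cr r f'" by auto
  \<comment> \<open>\<open>0 * x + (-1)\<close> is the constant -1 in the shape that
    \<open>Cr_affine\<close> accepts.\<close>
  let ?g = "\<lambda>x. (0 * x + (-1)) * (inverse (f x) * f' x * inverse (f x))"
  have "((\<lambda>x. inverse (f x)) has_real_derivative ?g x) (at x)" for x
    using DERIV_inverse'[OF d(1) Suc.prems(2)] by simp
  moreover have "Cr r ?g"
    using Suc.prems(1)[THEN Cr_Suc_imp_Cr] Suc.prems(2) by (intro Cr_mult Suc.IH d Cr_affine) auto
  ultimately show ?case by (rule Cr_SucI)
qed

lemma Cr_compose_affine: "Cr r g \<Longrightarrow> Cr r (\<lambda>x. g (c * x + d))"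
proof (induction r arbitrary: g)
  case 0
  then show ?case by (auto intro!: continuous_intros intro: continuous_on_compose2)
next
  case (Suc r)
  from Suc.prems obtain g' where d: "\<And>x. (g has_real_derivative g' x) (at x)" "Cr r g'" by auto
  let ?h = "\<lambda>x. g' (c * x + d) * (0 * x + c)"
  have "((\<lambda>x. g (c * x + d)) has_real_derivative ?h x) (at x)" for x
  proof -
    have "((\<lambda>x. c * x + d) has_real_derivative c) (at x)" by (auto intro!: derivative_eq_intros)
    from DERIV_chain2[OF d(1) this] show ?thesis by simp
  qed
  moreover have "Cr r ?h" by (intro Cr_mult Suc.IH d Cr_affine)
  ultimately show ?case by (rule Cr_SucI)
qed

text \<open>The case \<open>k = 0\<close> is the classical flat function; the exponent makes the family closed
  under differentiation.\<close>

definition flat :: "nat \<Rightarrow> real \<Rightarrow> real" where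
  "flat k x = (if x > 0 then exp (- inverse x) * inverse x ^ k else 0)"

text \<open>In the variable \<open>inverse x\<close> this is the dominance of the exponential over
  powers; on the left the function is identically 0.\<close>

lemma flat_tendsto_0: "(flat k \<longlongrightarrow> 0) (at 0)"
proof -
  have "((\<lambda>x. inverse x ^ k / exp (inverse x)) \<longlongrightarrow> 0) (at_right (0::real))"
    by (rule filterlim_compose[OF tendsto_power_div_exp_0 filterlim_inverse_at_top_right])
  then have "(flat k \<longlongrightarrow> 0) (at_right 0)"
    by (rule Lim_transform_eventually)
       (auto simp: flat_def eventually_at_right_less exp_minus divide_inverse mult.commute
         intro!: eventually_at_right_less[THEN eventually_mono])
  moreover have "(flat k \<longlongrightarrow> 0) (at_left 0)"
    by (rule tendsto_eventually) (auto simp: flat_def eventually_at_left_field intro!: exI[of _ "-1"])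
  ultimately show ?thesis by (simp add: filterlim_split_at)
qed

lemma flat_has_derivative:
  "(flat k has_real_derivative flat (k + 2) x - real k * flat (k + 1) x) (at x)"
proof (cases x "0 :: real" rule: linorder_cases)
  case less
  have "((\<lambda>x. 0) has_real_derivative 0) (at x)" by simp
  then have "(flat k has_real_derivative 0) (at x)"
    by (rule has_field_derivative_transform_within_open[where S="{..<0}"])
       (use less in \<open>auto simp: flat_def\<close>)
  then show ?thesis using less by (simp add: flat_def)
next
  case equal
  \<comment> \<open>At the origin the difference quotient of \<open>flat k\<close> is
    \<open>flat (k + 1)\<close>, so the limit for the next exponent gives the derivative 0.\<close>
  have "((\<lambda>h. (flat k (0 + h) - flat k 0) / h) \<longlongrightarrow> 0) (at 0)"
  proof (rule Lim_transform_eventually[OF flat_tendsto_0[of "k+1"]])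
    show "\<forall>\<^sub>F h in at 0. flat (k + 1) h = (flat k (0 + h) - flat k 0) / h"
      by (auto simp: flat_def divide_inverse intro!: always_eventually)
  qed
  then show ?thesis using equal by (simp add: DERIV_def flat_def)
next
  case greater
  have "((\<lambda>x. exp (- inverse x) * inverse x ^ k) has_real_derivative
      flat (k + 2) x - real k * flat (k + 1) x) (at x)"
  proof (cases k)
    case 0
    then show ?thesis using greater
      by (auto intro!: derivative_eq_intros simp: flat_def power2_eq_square)
  next
    case (Suc m)
    then show ?thesis using greater
      by (auto intro!: derivative_eq_intros simp: flat_def power2_eq_square algebra_simps;
          metis power_minus_mult mult.commute neq0_conv One_nat_def)
  qed
  then show ?thesis
    by (rule has_field_derivative_transform_within_open[where S="{0<..}"])
       (use greater in \<open>auto simp: flat_def\<close>)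
qed

lemma Cr_flat: "Cr r (flat k)"
proof (induction r arbitrary: k)
  case 0
  then show ?case
    using DERIV_isCont[OF flat_has_derivative] by (simp add: continuous_at_imp_continuous_on)
next
  case (Suc r)
  have "Cr r (\<lambda>x. flat (k + 2) x + (0 * x + (- real k)) * flat (k + 1) x)"
    by (intro Cr_add Cr_mult Suc Cr_affine)
  then have "Cr r (\<lambda>x. flat (k + 2) x - real k * flat (k + 1) x)" by simp
  with flat_has_derivative show ?case by (rule Cr_SucI)
qed

text \<open>\<open>f\<close> is positive exactly to the left of 1 and \<open>h\<close> exactly to
  the right of 1/2, so \<open>f + h\<close> never vanishes and the quotient
  \<open>f / (f + h)\<close> is a smooth transition. Its first two derivatives live between 1/2 and
  1 and are bounded by compactness; the ratio 2 of these endpoints will separate shells scaled by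
  4.\<close>

lemma smooth_transition:
  obtains G G' G'' :: "real \<Rightarrow> real" and M
  where "\<And>r. Cr r G" "\<And>r. Cr r G'" "\<And>x. (G has_real_derivative G' x) (at x)" "\<And>x. (G' has_real_derivative G'' x) (at x)"
    "\<And>x. x \<le> 1/2 \<Longrightarrow> G x = 1" "\<And>x. x \<ge> 1 \<Longrightarrow> G x = 0" "\<And>x. 0 \<le> G x" "\<And>x. G x \<le> 1"
    "\<And>x. x < 1/2 \<or> x > 1 \<Longrightarrow> G' x = 0" "\<And>x. x < 1/2 \<or> x > 1 \<Longrightarrow> G'' x = 0"
    "\<And>x. \<bar>G' x\<bar> \<le> M" "\<And>x. \<bar>G'' x\<bar> \<le> M"
proof -
  define f where "f x = flat 0 ((-1) * x + 1)" for x
  define h where "h x = flat 0 (1 * x + (- 1/2))" for x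
  define G where "G x = f x * inverse (f x + h x)" for x
  have nn: "0 \<le> f x" "0 \<le> h x" for x by (auto simp: f_def h_def flat_def)
  have pos: "f x + h x > 0" for x
    by (cases "x < 1") (auto simp: f_def h_def flat_def intro: add_pos_nonneg add_nonneg_pos)
  have C: "Cr r G" for r
  proof -
    have f: "Cr r f" and h: "Cr r h"
      unfolding f_def[abs_def] h_def[abs_def] by (rule Cr_compose_affine[OF Cr_flat])+
    show ?thesis
      unfolding G_def by (rule Cr_mult[OF f Cr_inverse[OF Cr_add[OF f h]]]) (use pos less_irrefl in metis)
  qed
  \<comment> \<open>Each \<open>Cr\<close> fact hides a derivative of its own; uniqueness identifies
    them all with \<open>deriv G\<close> and \<open>deriv G'\<close>, so that one pair serves all
    orders.\<close>
  define G' where "G' = deriv G"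
  define G'' where "G'' = deriv G'"
  have D1: "(G has_real_derivative G' x) (at x)" for x
    using C[of "Suc 0"] unfolding G'_def Cr.simps(2) by (metis DERIV_imp_deriv)
  have C': "Cr r G'" for r
  proof -
    obtain g where g: "\<forall>x. (G has_real_derivative g x) (at x)" "Cr r g" using C[of "Suc r"] by auto
    have "g = G'" using D1 g(1) DERIV_unique by blast
    then show ?thesis using g by simp
  qed
  have D2: "(G' has_real_derivative G'' x) (at x)" for x
    using C'[of "Suc 0"] unfolding G''_def Cr.simps(2) by (metis DERIV_imp_deriv)
  have C'': "Cr 0 G''"
  proof -
    obtain g where g: "\<forall>x. (G' has_real_derivative g x) (at x)" "Cr 0 g" using C'[of "Suc 0"] by auto
    have "g = G''" using D2 g(1) DERIV_unique by blast
    then show ?thesis using g by simp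
  qed
  have G1: "G x = 1" if "x \<le> 1/2" for x
    using that pos[of x] by (simp add: G_def h_def flat_def)
  have G0: "G x = 0" if "x \<ge> 1" for x
    using that by (simp add: G_def f_def flat_def)
  have "0 \<le> G x" for x unfolding G_def using nn[of x] pos[of x] by (intro mult_nonneg_nonneg) auto
  moreover have "G x \<le> 1" for x unfolding G_def using nn[of x] pos[of x]
    by (simp add: field_simps)
  moreover have G'0: "G' x = 0" if "x < 1/2 \<or> x > 1" for x
    using that
  proof
    assume x: "x < 1/2"
    have "(G has_real_derivative 0) (at x)"
      by (rule has_field_derivative_transform_within_open[OF DERIV_const[of 1], where S="{..<1/2}"])
         (use x G1 in auto)
    then show ?thesis using D1 DERIV_unique by blast
  next
    assume x: "x > 1"
    have "(G has_real_derivative 0) (at x)"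
      by (rule has_field_derivative_transform_within_open[OF DERIV_const[of 0], where S="{1<..}"])
         (use x G0 in auto)
    then show ?thesis using D1 DERIV_unique by blast
  qed
  moreover have G''0: "G'' x = 0" if "x < 1/2 \<or> x > 1" for x
    using that
  proof
    assume x: "x < 1/2"
    have "(G' has_real_derivative 0) (at x)"
      by (rule has_field_derivative_transform_within_open[OF DERIV_const[of 0], where S="{..<1/2}"])
         (use x G'0 in auto)
    then show ?thesis using D2 DERIV_unique by blast
  next
    assume x: "x > 1"
    have "(G' has_real_derivative 0) (at x)"
      by (rule has_field_derivative_transform_within_open[OF DERIV_const[of 0], where S="{1<..}"])
         (use x G'0 in auto)
    then show ?thesis using D2 DERIV_unique by blast
  qed
  moreover obtain M where "\<And>x. \<bar>G' x\<bar> \<le> M" "\<And>x. \<bar>G'' x\<bar> \<le> M"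
  proof -
    have bd: "\<exists>M. \<forall>x. \<bar>g x\<bar> \<le> M" if "continuous_on UNIV g" "\<And>x. x < 1/2 \<or> x > 1 \<Longrightarrow> g x = 0" for g :: "real \<Rightarrow> real"
    proof -
      have "compact (g ` {1/2..1})"
        using that(1) by (intro compact_continuous_image) (auto intro: continuous_on_subset)
      then obtain b where b: "\<forall>y\<in>g ` {1/2..1}. norm y \<le> b" using compact_imp_bounded bounded_iff by blast
      have "\<bar>g x\<bar> \<le> \<bar>b\<bar>" for x
      proof (cases "x \<in> {1/2..1}")
        case True
        then have "norm (g x) \<le> b" using b by blast
        then show ?thesis by simp
      next
        case False
        then show ?thesis using that(2)[of x] by auto
      qed
      then show ?thesis by blast
    qed
    obtain M1 where M1: "\<forall>x. \<bar>G' x\<bar> \<le> M1" using bd[of G'] C'[of 0] G'0 by auto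
    obtain M2 where M2: "\<forall>x. \<bar>G'' x\<bar> \<le> M2" using bd[of G''] C'' G''0 by auto
    show ?thesis by (rule that[of "max M1 M2"]) (use M1 M2 in \<open>auto simp: le_max_iff_disj\<close>)
  qed
  ultimately show ?thesis using that[OF C C' D1 D2 G1 G0] by blast
qed

text \<open>The argument is a polynomial in the squared norm, hence smooth at the origin as well.
  Differentiation replaces \<open>g\<close> by its derivative and adds a linear factor, so induction
  on the order applies.\<close>

lemma Ck_radial: "Cr r g \<Longrightarrow> Ck r (\<lambda>z::complex^'n. of_real (g (c * (z \<bullet> z) + d)))"
proof (induction r arbitrary: g)
  case 0
  then have "continuous_on UNIV g" by simp
  then have "continuous_on UNIV (\<lambda>z::complex^'n. g (c * (z \<bullet> z) + d))"
    by (rule continuous_on_compose2[of UNIV g]) (auto intro!: continuous_on_add continuous_on_mult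
        continuous_on_const continuous_on_inner continuous_on_id)
  then show ?case by (simp add: continuous_on_of_real)
next
  case (Suc r)
  from Suc.prems obtain g' where g': "\<And>x. (g has_real_derivative g' x) (at x)" "Cr r g'" by auto
  show ?case
  proof (rule Ck_SucI[where D="\<lambda>v z. of_real (g' (c * (z \<bullet> z) + d)) * of_real (2 * c * (z \<bullet> v))"])
    fix z :: "complex ^ 'n"
    have "((\<lambda>z. c * (z \<bullet> z) + d) has_derivative (\<lambda>v. 2 * c * (z \<bullet> v))) (at z)"
      by (auto intro!: derivative_eq_intros simp: inner_commute)
    from has_derivative_compose[OF this g'(1)[unfolded has_field_derivative_def]]
    have "((\<lambda>z. g (c * (z \<bullet> z) + d)) has_derivative (\<lambda>v. g' (c * (z \<bullet> z) + d) * (2 * c * (z \<bullet> v)))) (at z)" .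
    from bounded_linear.has_derivative[OF bounded_linear_of_real this]
    show "((\<lambda>z. complex_of_real (g (c * (z \<bullet> z) + d))) has_derivative
        (\<lambda>v. of_real (g' (c * (z \<bullet> z) + d)) * of_real (2 * c * (z \<bullet> v)))) (at z)"
      by simp
  next
    fix v :: "complex ^ 'n"
    have "Ck r (\<lambda>z. complex_of_real (2 * c * (z \<bullet> v)))"
      by (intro Ck_bounded_linear bounded_linear_compose[OF bounded_linear_of_real]
          bounded_linear_compose[OF bounded_linear_mult_right] bounded_linear_inner_left)
    from Suc.IH[OF g'(2)] this
    show "Ck r (\<lambda>z. complex_of_real (g' (c * (z \<bullet> z) + d)) * of_real (2 * c * (z \<bullet> v)))"
      by (rule Ck_mult)
  qed
qed

lemma has_derivative_radial:
  fixes z :: "complex ^ 'n"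
  assumes "\<And>x. (g has_real_derivative g' x) (at x)"
  shows "((\<lambda>z. complex_of_real (g (c * (z \<bullet> z) + d))) has_derivative
     (\<lambda>v. of_real (g' (c * (z \<bullet> z) + d) * (2 * c * (z \<bullet> v))))) (at z)"
proof -
  have "((\<lambda>z. c * (z \<bullet> z) + d) has_derivative (\<lambda>v. 2 * c * (z \<bullet> v))) (at z)"
    by (auto intro!: derivative_eq_intros simp: inner_commute)
  from has_derivative_compose[OF this assms[unfolded has_field_derivative_def]]
  have "((\<lambda>z. g (c * (z \<bullet> z) + d)) has_derivative (\<lambda>v. g' (c * (z \<bullet> z) + d) * (2 * c * (z \<bullet> v)))) (at z)" .
  from bounded_linear.has_derivative[OF bounded_linear_of_real this]
  show ?thesis .
qed

lemma smooth_radial: "(\<And>r. Cr r g) \<Longrightarrow> smooth (\<lambda>z. of_real (g (c * (z \<bullet> z) + d)))"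
  by (simp add: smooth_def Ck_radial)

lemma inner_axis_complex:
  fixes z :: "complex ^ 'n"
  shows "z \<bullet> axis a 1 = Re (z $ a)" "z \<bullet> axis a \<i> = Im (z $ a)"
  by (simp_all add: inner_axis inner_complex_def)

lemma d_z_radial:
  assumes "\<And>x. (g has_real_derivative g' x) (at x)"
  shows "d_z a (\<lambda>z. of_real (g (c * (z \<bullet> z) + d))) z = of_real (g' (c * (z \<bullet> z) + d) * c) * cnj (z $ a)"
  unfolding d_z_eqI[OF has_derivative_radial[OF assms]] inner_axis_complex
  by (simp add: complex_eq_iff)

lemma d_zbar_radial:
  assumes "\<And>x. (g has_real_derivative g' x) (at x)"
  shows "d_zbar a (\<lambda>z. of_real (g (c * (z \<bullet> z) + d))) z = of_real (g' (c * (z \<bullet> z) + d) * c) * z $ a"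
  unfolding d_zbar_eqI[OF has_derivative_radial[OF assms]] inner_axis_complex
  by (simp add: complex_eq_iff)

lemma bounded_linear_component: "bounded_linear (\<lambda>z::complex^'n. z $ a)"
  by (rule bounded_linear_vec_nth)

lemma d_z_component: "d_z a (\<lambda>z::complex^'n. z $ b) z = (if a = b then 1 else 0)"
  by (subst d_z_eqI[OF bounded_linear_imp_has_derivative[OF bounded_linear_component]])
     (simp add: axis_def)

lemma hessian_radial:
  assumes "\<And>x. (g has_real_derivative g' x) (at x)" "\<And>x. (g' has_real_derivative g'' x) (at x)" "\<And>r. Cr r g'"
  shows "d_z a (d_zbar b (\<lambda>z. of_real (g (c * (z \<bullet> z) + d)))) z =
    of_real (g'' (c * (z \<bullet> z) + d) * c\<^sup>2) * cnj (z $ a) * z $ b +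
    (if a = b then of_real (g' (c * (z \<bullet> z) + d) * c) else 0)"
proof -
  have "d_zbar b (\<lambda>z. of_real (g (c * (z \<bullet> z) + d))) = (\<lambda>z. of_real c * (of_real (g' (c * (z \<bullet> z) + d)) * z $ b))"
    by (rule ext) (simp add: d_zbar_radial[OF assms(1)])
  then show ?thesis
    by (simp add: d_z_cmult d_z_mult smooth_mult smooth_radial assms(3) smooth_bounded_linear bounded_linear_component
        d_z_radial[OF assms(2)] d_z_component power2_eq_square) (simp add: algebra_simps)
qed

lemma bump_exists:
  assumes "r > 0"
  obtains \<eta> :: "complex ^ 'n \<Rightarrow> complex" where "\<eta> \<in> Cc_smooth"
    "\<And>z. norm z \<le> r \<Longrightarrow> \<eta> z = 1" "\<And>z. norm z \<ge> 2 * r \<Longrightarrow> \<eta> z = 0"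
    "\<And>z. \<exists>x. \<eta> z = of_real x \<and> 0 \<le> x \<and> x \<le> 1"
proof -
  obtain G :: "real \<Rightarrow> real" where G: "\<And>r. Cr r G" "\<And>x. x \<le> 1/2 \<Longrightarrow> G x = 1" "\<And>x. x \<ge> 1 \<Longrightarrow> G x = 0"
    "\<And>x. 0 \<le> G x" "\<And>x. G x \<le> 1"
    by (rule smooth_transition) blast
  \<comment> \<open>This scaling sends the sphere of radius \<open>r\<close> to 1/2, where
    \<open>G\<close> is still 1, and the sphere of radius \<open>2 * r\<close> to 2, where
    \<open>G\<close> is 0.\<close>
  define c where "c = 1 / (2 * r\<^sup>2)"
  define \<eta> :: "complex ^ 'n \<Rightarrow> complex" where "\<eta> z = of_real (G (c * (z \<bullet> z) + 0))" for z
  have s: "smooth \<eta>" unfolding \<eta>_def[abs_def] by (rule smooth_radial[OF G(1)])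
  have c: "c * (z \<bullet> z) = (norm z / r)\<^sup>2 / 2" for z :: "complex ^ 'n"
    using assms by (simp add: c_def dot_square_norm power_divide)
  have 1: "\<eta> z = 1" if "norm z \<le> r" for z
  proof -
    have "(norm z / r)\<^sup>2 \<le> 1" using that assms by (simp add: power_le_one_iff divide_le_eq_1)
    then show ?thesis by (simp add: \<eta>_def c G(2))
  qed
  have 2: "\<eta> z = 0" if "norm z \<ge> 2 * r" for z
  proof -
    have "2 \<le> norm z / r" using that assms by (simp add: pos_le_divide_eq)
    then have "2\<^sup>2 \<le> (norm z / r)\<^sup>2" by (intro power_mono) auto
    then show ?thesis by (simp add: \<eta>_def c G(3))
  qed
  have "\<eta> \<in> Cc_smooth" using s 2 by (auto simp: Cc_smooth_iff intro!: CcI_radius smooth_imp_continuous)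
  moreover have "\<exists>x. \<eta> z = of_real x \<and> 0 \<le> x \<and> x \<le> 1" for z using G(4,5) unfolding \<eta>_def by blast
  ultimately show ?thesis using that 1 2 by blast
qed

section \<open>Density of the smooth test functions\<close>

lemma smooth_real_polynomial_function: "real_polynomial_function q \<Longrightarrow> smooth (\<lambda>z. of_real (q z))"
proof (induction rule: real_polynomial_function.induct)
  case (linear f)
  then show ?case by (intro smooth_bounded_linear bounded_linear_compose[OF bounded_linear_of_real])
qed (auto intro!: smooth_add smooth_mult)

lemma smooth_polynomial_function:
  fixes p :: "complex ^ 'n \<Rightarrow> complex"
  assumes "polynomial_function p" shows "smooth p"
proof -
  have "real_polynomial_function (\<lambda>z. Re (p z))" "real_polynomial_function (\<lambda>z. Im (p z))"
    using assms bounded_linear_Re bounded_linear_Im by (auto simp: polynomial_function_def o_def)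
  then have "smooth (\<lambda>z. of_real (Re (p z)) + \<i> * of_real (Im (p z)))"
    by (intro smooth_add smooth_mult smooth_const smooth_real_polynomial_function)
  then show ?thesis by (simp flip: complex_eq)
qed

text \<open>A polynomial close to \<open>f\<close> on the larger ball is multiplied by a cutoff.
  Since \<open>f\<close> equals the cutoff times \<open>f\<close> and the cutoff is at most 1 in
  modulus, the error does not grow. The control of the support is essential: the functionals to be
  compared are bounded only on compact sets.\<close>

lemma Cc_smooth_dense:
  fixes f :: "complex ^ 'n \<Rightarrow> complex"
  assumes f: "f \<in> Cc" "\<And>z. norm z \<ge> r \<Longrightarrow> f z = 0" and r: "r > 0" and e: "e > 0"
  obtains g where "g \<in> Cc_smooth" "\<And>z. cmod (f z - g z) \<le> e" "\<And>z. norm z \<ge> 2 * r \<Longrightarrow> g z = 0"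
proof -
  obtain \<eta> :: "complex ^ 'n \<Rightarrow> complex" where \<eta>: "\<eta> \<in> Cc_smooth"
    "\<And>z. norm z \<le> r \<Longrightarrow> \<eta> z = 1" "\<And>z. norm z \<ge> 2 * r \<Longrightarrow> \<eta> z = 0"
    "\<And>z. \<exists>x. \<eta> z = of_real x \<and> 0 \<le> x \<and> x \<le> 1" using bump_exists[OF r] by blast
  from Stone_Weierstrass_polynomial_function[OF compact_cball Cc_continuous[OF f(1)] e, of 0 "2 * r"]
  obtain p where p: "polynomial_function p" "\<forall>z\<in>cball 0 (2 * r). norm (f z - p z) < e"
    by (elim exE conjE)
  have "cmod (f z - \<eta> z * p z) \<le> e" for z
  proof (cases "norm z \<le> 2 * r")
    case True
    have "f z = \<eta> z * f z" using f(2)[of z] \<eta>(2)[of z] by (cases "norm z \<le> r") auto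
    then have "f z - \<eta> z * p z = \<eta> z * (f z - p z)" by (metis right_diff_distrib)
    moreover have "cmod (\<eta> z) \<le> 1" using \<eta>(4)[of z] by auto
    ultimately have "cmod (f z - \<eta> z * p z) \<le> cmod (f z - p z)"
      by (simp add: norm_mult mult_left_le_one_le)
    then show ?thesis using bspec[OF p(2), of z] True by simp
  next
    case False
    then show ?thesis using \<eta>(3)[of z] f(2)[of z] r e by simp
  qed
  moreover have "(\<lambda>z. \<eta> z * p z) \<in> Cc_smooth"
    by (intro Cc_smooth_mult \<eta> smooth_polynomial_function p)
  ultimately show ?thesis using that[of "\<lambda>z. \<eta> z * p z"] \<eta>(3) by simp
qed

section \<open>The Riesz representation theorem\<close>

text \<open>Real-valued, because the Riesz argument uses the order; vanishing outside a ball amounts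
  to compact support in a Euclidean space.\<close>

definition CcR :: "('a::euclidean_space \<Rightarrow> real) set" where
  "CcR = {f. continuous_on UNIV f \<and> (\<exists>r. \<forall>x. norm x \<ge> r \<longrightarrow> f x = 0)}"

lemma CcRI: "continuous_on UNIV f \<Longrightarrow> (\<And>x. norm x \<ge> r \<Longrightarrow> f x = 0) \<Longrightarrow> f \<in> CcR"
  by (auto simp: CcR_def)

lemma CcR_continuous: "f \<in> CcR \<Longrightarrow> continuous_on S f"
  by (auto simp: CcR_def intro: continuous_on_subset)

lemma CcR_radius:
  assumes "f \<in> CcR" obtains r where "r > 0" "\<And>x. norm x \<ge> r \<Longrightarrow> f x = 0"
proof -
  obtain r where r: "\<forall>x. norm x \<ge> r \<longrightarrow> f x = 0" using assms by (auto simp: CcR_def)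
  show ?thesis by (rule that[of "max r 1"]) (use r in auto)
qed

lemma CcR_zero [simp]: "(\<lambda>x. 0) \<in> CcR" by (rule CcRI) auto

lemma CcR_add: assumes "f \<in> CcR" "g \<in> CcR" shows "(\<lambda>x. f x + g x) \<in> CcR"
proof -
  obtain r where r: "\<And>x. norm x \<ge> r \<Longrightarrow> f x = 0" using CcR_radius[OF assms(1)] by blast
  obtain s where s: "\<And>x. norm x \<ge> s \<Longrightarrow> g x = 0" using CcR_radius[OF assms(2)] by blast
  show ?thesis
    by (rule CcRI[where r="max r s"])
       (use assms r s in \<open>auto intro: continuous_on_add CcR_continuous\<close>)
qed

lemma CcR_mult: assumes "f \<in> CcR" "continuous_on UNIV g" shows "(\<lambda>x. f x * g x) \<in> CcR"
proof -
  obtain r where r: "\<And>x. norm x \<ge> r \<Longrightarrow> f x = 0" using CcR_radius[OF assms(1)] by blast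
  show ?thesis
    by (rule CcRI[where r=r]) (use assms r in \<open>auto intro: continuous_on_mult CcR_continuous\<close>)
qed

lemma CcR_cmult: "f \<in> CcR \<Longrightarrow> (\<lambda>x. c * f x) \<in> CcR"
  using CcR_mult[of f "\<lambda>x. c"] by (simp add: mult.commute)

lemma CcR_diff: "f \<in> CcR \<Longrightarrow> g \<in> CcR \<Longrightarrow> (\<lambda>x. f x - g x) \<in> CcR"
  using CcR_add[OF _ CcR_cmult[of g "-1"], of f] by simp

lemma CcR_sum: "(\<And>i. i \<in> I \<Longrightarrow> f i \<in> CcR) \<Longrightarrow> (\<lambda>x. \<Sum>i\<in>I. f i x) \<in> CcR"
  by (induction I rule: infinite_finite_induct) (auto intro!: CcR_add)

lemma CcR_compose: assumes "f \<in> CcR" "continuous_on UNIV p" "p 0 = 0" shows "(\<lambda>x. p (f x)) \<in> CcR"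
proof -
  obtain r where r: "\<And>x. norm x \<ge> r \<Longrightarrow> f x = 0" using CcR_radius[OF assms(1)] by blast
  have "continuous_on UNIV (\<lambda>x. p (f x))"
    by (rule continuous_on_compose2[OF assms(2) CcR_continuous[OF assms(1)]]) auto
  then show ?thesis by (rule CcRI[where r=r]) (use r assms in auto)
qed

lemma CcR_bounded:
  assumes "f \<in> CcR" obtains B where "\<And>x. \<bar>f x\<bar> \<le> B" "B > 0"
proof -
  obtain r where r: "\<And>x. norm x \<ge> r \<Longrightarrow> f x = 0" using CcR_radius[OF assms(1)] by blast
  have "compact (f ` cball 0 r)" by (intro compact_continuous_image CcR_continuous assms) auto
  then obtain b where b: "\<forall>y\<in>f ` cball 0 r. norm y \<le> b" using compact_imp_bounded bounded_iff by blast
  have "\<bar>f x\<bar> \<le> \<bar>b\<bar> + 1" for x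
  proof (cases "norm x \<le> r")
    case True
    then have "norm (f x) \<le> b" using b by auto
    then show ?thesis by simp
  qed (use r in auto)
  then show ?thesis using that[of "\<bar>b\<bar> + 1"] by simp
qed

lemma plateau: 
  obtains \<eta> :: "'a::euclidean_space \<Rightarrow> real" where "\<eta> \<in> CcR" "\<And>x. norm x \<le> r \<Longrightarrow> \<eta> x = 1" "\<And>x. 0 \<le> \<eta> x" "\<And>x. \<eta> x \<le> 1"
proof (rule that[of "\<lambda>x. max 0 (min 1 (r + 1 - norm x))"])
  show "(\<lambda>x::'a. max 0 (min 1 (r + 1 - norm x))) \<in> CcR"
    by (rule CcRI[where r="r+1"]) (auto intro!: continuous_intros)
qed auto

section \<open>The outer measure of a positive functional\<close>

locale positive_functional =
  fixes L :: "('a::euclidean_space \<Rightarrow> real) \<Rightarrow> real"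
  assumes L_add: "f \<in> CcR \<Longrightarrow> g \<in> CcR \<Longrightarrow> L (\<lambda>x. f x + g x) = L f + L g"
    and L_scale: "f \<in> CcR \<Longrightarrow> L (\<lambda>x. c * f x) = c * L f"
    and L_nonneg: "f \<in> CcR \<Longrightarrow> (\<And>x. 0 \<le> f x) \<Longrightarrow> 0 \<le> L f"
begin

lemma L_zero [simp]: "L (\<lambda>x. 0) = 0" using L_scale[of "\<lambda>x. 0" 0] by simp

lemma L_diff: "f \<in> CcR \<Longrightarrow> g \<in> CcR \<Longrightarrow> L (\<lambda>x. f x - g x) = L f - L g"
  using L_add[of f "\<lambda>x. -1 * g x"] L_scale[of g "-1"] CcR_cmult[of g "-1"] by simp

lemma L_mono: "f \<in> CcR \<Longrightarrow> g \<in> CcR \<Longrightarrow> (\<And>x. f x \<le> g x) \<Longrightarrow> L f \<le> L g"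
  using L_nonneg[OF CcR_diff, of g f] L_diff[of g f] by simp

lemma L_sum: "(\<And>i. i \<in> I \<Longrightarrow> f i \<in> CcR) \<Longrightarrow> L (\<lambda>x. \<Sum>i\<in>I. f i x) = (\<Sum>i\<in>I. L (f i))"
  by (induction I rule: infinite_finite_induct) (auto simp: L_add CcR_sum)

text \<open>An outer measure in the style of Daniell: countable families of test functions whose sum
  dominates the indicator of \<open>A\<close> take the place of open covers, so no preliminary
  definition on open sets is needed.\<close>

definition cover :: "'a set \<Rightarrow> (nat \<Rightarrow> 'a \<Rightarrow> real) \<Rightarrow> bool" where
  "cover A F \<longleftrightarrow> (\<forall>n. F n \<in> CcR \<and> (\<forall>x. 0 \<le> F n x)) \<and> (\<forall>x\<in>A. 1 \<le> (\<Sum>n. ennreal (F n x)))"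

definition out :: "'a set \<Rightarrow> ennreal" where
  "out A = (INF F\<in>{F. cover A F}. \<Sum>n. ennreal (L (F n)))"

lemma out_le: "cover A F \<Longrightarrow> out A \<le> (\<Sum>n. ennreal (L (F n)))"
  unfolding out_def by (rule INF_lower) simp

lemma suminf_single: "(\<Sum>n. ennreal (if n = 0 then a else 0)) = ennreal a"
  using suminf_finite[of "{0::nat}" "\<lambda>n. ennreal (if n = 0 then a else 0)"] by simp

lemma out_upper:
  assumes f: "f \<in> CcR" "\<And>x. 0 \<le> f x" "\<And>x. x \<in> A \<Longrightarrow> 1 \<le> f x"
  shows "out A \<le> ennreal (L f)"
proof -
  let ?F = "\<lambda>n x. if n = (0::nat) then f x else 0"
  have c: "cover A ?F"
    unfolding cover_def
  proof (intro conjI allI ballI)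
    show "?F n \<in> CcR" for n using f(1) by (cases "n = 0") auto
    show "1 \<le> (\<Sum>n. ennreal (?F n x))" if "x \<in> A" for x
      using f(3)[OF that] by (simp add: suminf_single)
  qed (use f in auto)
  have "(\<Sum>n. ennreal (L (?F n))) = (\<Sum>n. ennreal (if n = 0 then L f else 0))"
    by (intro suminf_cong) auto
  then show ?thesis using out_le[OF c] by (simp add: suminf_single)
qed

lemma out_empty: "out {} = 0"
  using out_upper[of "\<lambda>x. 0" "{}"] by simp

lemma out_mono: "A \<subseteq> B \<Longrightarrow> out A \<le> out B"
  unfolding out_def
proof (rule INF_superset_mono)
  assume "A \<subseteq> B"
  then show "{F. cover B F} \<subseteq> {F. cover A F}" unfolding cover_def by blast
qed simp

lemma out_approx:
  assumes "out A < \<infinity>" "e > 0"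
  obtains F where "cover A F" "(\<Sum>n. ennreal (L (F n))) \<le> out A + ennreal e"
proof -
  have "out A < out A + ennreal e"
    using assms by (simp add: ennreal_add_left_cancel_less[where b=0, simplified] less_top)
  then obtain F where "cover A F" "(\<Sum>n. ennreal (L (F n))) < out A + ennreal e"
    unfolding out_def[of A] by (auto simp: INF_less_iff)
  then show ?thesis using that by auto
qed

lemma suminf_half: "e > 0 \<Longrightarrow> (\<Sum>n. ennreal (e * (1/2) ^ Suc n)) = ennreal e"
proof -
  assume "e > 0"
  then have "(\<lambda>n. e * (1/2) ^ Suc n) sums (e * 1)" by (intro sums_mult power_half_series)
  then show ?thesis using \<open>e > 0\<close> by (intro suminf_ennreal_eq) auto
qed

text \<open>Covers of the single sets, with errors \<open>e * (1/2) ^ Suc i\<close>, are merged into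
  one sequence along \<open>prod_decode\<close>.\<close>

lemma out_subadditive: "out (\<Union>i. A i) \<le> (\<Sum>i. out (A i))" for A :: "nat \<Rightarrow> 'a set"
proof (cases "(\<Sum>i. out (A i)) = \<infinity>")
  case False
  then have fin: "out (A i) < \<infinity>" for i using ennreal_suminf_lessD[of "\<lambda>i. out (A i)" \<infinity> i] by (simp add: less_top)
  show ?thesis
  proof (rule ennreal_le_epsilon)
    fix e :: real assume e: "e > 0"
    have "\<exists>F. cover (A i) F \<and> (\<Sum>n. ennreal (L (F n))) \<le> out (A i) + ennreal (e * (1/2) ^ Suc i)" for i
      using out_approx[OF fin, of "e * (1/2) ^ Suc i" i] e by (metis mult_pos_pos zero_less_power zero_less_divide_1_iff zero_less_numeral)
    then obtain F where F: "\<And>i. cover (A i) (F i)"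
      "\<And>i. (\<Sum>n. ennreal (L (F i n))) \<le> out (A i) + ennreal (e * (1/2) ^ Suc i)" by metis
    let ?H = "\<lambda>k. case prod_decode k of (i, n) \<Rightarrow> F i n"
    have "cover (\<Union>i. A i) ?H"
      unfolding cover_def
    proof (intro conjI allI ballI)
      fix x assume "x \<in> (\<Union>i. A i)"
      then obtain i where i: "x \<in> A i" by blast
      have "1 \<le> (\<Sum>n. ennreal (F i n x))" using F(1)[of i] i by (simp add: cover_def)
      also have "\<dots> \<le> (\<Sum>i. \<Sum>n. ennreal (F i n x))"
        using sum_le_suminf[of "\<lambda>i. \<Sum>n. ennreal (F i n x)" "{i}"] by simp
      also have "\<dots> = (\<Sum>k. (\<lambda>(i, n). ennreal (F i n x)) (prod_decode k))"
        by (rule suminf_ennreal_2dimen[symmetric]) simp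
      finally show "1 \<le> (\<Sum>k. ennreal ((case prod_decode k of (i, n) \<Rightarrow> F i n) x))"
        by (simp add: case_prod_unfold)
    qed (use F(1) in \<open>auto simp: cover_def split: prod.split\<close>)
    from out_le[OF this]
    have "out (\<Union>i. A i) \<le> (\<Sum>k. (\<lambda>(i, n). ennreal (L (F i n))) (prod_decode k))"
      by (simp add: case_prod_unfold)
    also have "\<dots> = (\<Sum>i. \<Sum>n. ennreal (L (F i n)))"
      by (rule suminf_ennreal_2dimen) simp
    also have "\<dots> \<le> (\<Sum>i. out (A i) + ennreal (e * (1/2) ^ Suc i))"
      by (intro suminf_le F) auto
    also have "\<dots> = (\<Sum>i. out (A i)) + ennreal e"
      using e by (subst suminf_add[symmetric]) (simp_all add: suminf_half[OF e] del: power_Suc)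
    finally show "out (\<Union>i. A i) \<le> (\<Sum>i. out (A i)) + ennreal e" .
  qed
qed simp

lemma outer_measure_space_out: "outer_measure_space UNIV out"
  unfolding outer_measure_space_def positive_def increasing_def countably_subadditive_def
  using out_empty out_mono out_subadditive by auto

lemma open_approx:
  assumes "open U" "U \<noteq> (UNIV :: 'a set)"
  obtains g :: "nat \<Rightarrow> 'a \<Rightarrow> real" where "\<And>k. continuous_on UNIV (g k)" "\<And>x. g 0 x = 0"
    "\<And>k x. 0 \<le> g k x" "\<And>k x. g k x \<le> 1" "\<And>k x. g k x \<le> g (Suc k) x"
    "\<And>x. x \<in> U \<Longrightarrow> (\<lambda>k. g k x) \<longlonglongrightarrow> 1" "\<And>k x. x \<notin> U \<Longrightarrow> g k x = 0"
proof
  \<comment> \<open>Multiples of the distance to the complement, truncated at 1.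
    \<open>infdist\<close> to the empty set is 0 by convention, so the complement of
    \<open>U\<close> has to be nonempty.\<close>
  let ?g = "\<lambda>k x. min 1 (real k * infdist x (- U))"
  show "continuous_on UNIV (?g k)" for k by (intro continuous_intros)
  show "0 \<le> ?g k x" for k x by (simp add: infdist_nonneg)
  show "?g k x \<le> ?g (Suc k) x" for k x
    by (intro min.mono mult_right_mono infdist_nonneg) auto
  show "(\<lambda>k. ?g k x) \<longlonglongrightarrow> 1" if "x \<in> U" for x
  proof -
    have "infdist x (- U) > 0"
      using infdist_pos_not_in_closed[of "- U" x] assms that by auto
    then obtain N where N: "real N * infdist x (- U) > 1" using ex_less_of_nat_mult by blast
    have "?g k x = 1" if "k \<ge> N" for k
    proof -
      have "real N * infdist x (- U) \<le> real k * infdist x (- U)"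
        using that by (intro mult_right_mono infdist_nonneg) auto
      then show ?thesis using N by simp
    qed
    then show ?thesis by (intro tendsto_eventually eventually_sequentiallyI)
  qed
qed auto

text \<open>Caratheodory's criterion for open sets. A cover \<open>F\<close> of \<open>A\<close> is
  multiplied by the increments of functions rising to the indicator of \<open>U\<close>: the
  products cover \<open>A \<inter> U\<close>, while the remainder
  \<open>F n x - F n x * g (K n) x\<close> after finitely many increments still covers
  \<open>A - U\<close>, where every \<open>g k\<close> is 0. Together they cost little more than
  \<open>F\<close>.\<close>

lemma open_measurable:
  assumes "open U" shows "out (A \<inter> U) + out (A - U) \<le> out A"
proof (cases "U = UNIV \<or> out A = \<infinity>")
  case True
  then show ?thesis by (auto simp: out_empty)
next
  case False
  obtain g :: "nat \<Rightarrow> 'a \<Rightarrow> real" where g: "\<And>k. continuous_on UNIV (g k)" "\<And>x. g 0 x = 0"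
    "\<And>k x. 0 \<le> g k x" "\<And>k x. g k x \<le> 1" "\<And>k x. g k x \<le> g (Suc k) x"
    "\<And>x. x \<in> U \<Longrightarrow> (\<lambda>k. g k x) \<longlonglongrightarrow> 1" "\<And>k x. x \<notin> U \<Longrightarrow> g k x = 0"
    using open_approx[OF assms] False by blast
  have fin: "out A < \<infinity>" using False by (simp add: less_top)
  show ?thesis
  proof (rule ennreal_le_epsilon)
    fix e :: real assume e: "e > 0"
    obtain F where F: "cover A F" "(\<Sum>n. ennreal (L (F n))) \<le> out A + ennreal (e/2)"
      using out_approx[OF fin, of "e/2"] e by auto
    have FC: "F n \<in> CcR" "0 \<le> F n x" for n x using F(1) by (auto simp: cover_def)
    define P where "P n k x = F n x * (g (Suc k) x - g k x)" for n k x
    have PC: "P n k \<in> CcR" "0 \<le> P n k x" for n k x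
      unfolding P_def using FC g by (auto intro!: CcR_mult continuous_on_diff mult_nonneg_nonneg)
    have GC: "(\<lambda>x. F n x * g k x) \<in> CcR" for n k using FC g by (intro CcR_mult)
    have LP: "L (P n k) = L (\<lambda>x. F n x * g (Suc k) x) - L (\<lambda>x. F n x * g k x)" for n k
      using L_diff[OF GC[of n "Suc k"] GC[of n k]] by (simp add: P_def[abs_def] right_diff_distrib)
    have tel: "(\<Sum>k<K. L (P n k)) = L (\<lambda>x. F n x * g K x)" for n K
      unfolding LP by (subst sum_lessThan_telescope) (simp add: g(2))
    have bd: "(\<Sum>k<K. L (P n k)) \<le> L (F n)" for n K
      unfolding tel using GC FC g(4) by (intro L_mono) (auto simp: mult_left_le)
    have LPn: "0 \<le> L (P n k)" for n k using PC by (intro L_nonneg)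
    have summ: "summable (\<lambda>k. L (P n k))" for n
      by (rule summableI_nonneg_bounded[OF LPn bd])
    define s where "s n = (\<Sum>k. L (P n k))" for n
    have s: "(\<lambda>k. L (P n k)) sums s n" for n using summ by (simp add: s_def summable_sums)
    have s0: "0 \<le> s n" for n unfolding s_def using LPn summ by (intro suminf_nonneg)
    \<comment> \<open>The increments from \<open>K\<close> on are counted in both parts; their share
      is at most \<open>e/2 * (1/2) ^ Suc n\<close>, hence \<open>e/2\<close> in total. The other
      \<open>e/2\<close> is spent on the choice of \<open>F\<close>.\<close>
    have "\<exists>K. s n < (\<Sum>k<K. L (P n k)) + e/2 * (1/2) ^ Suc n" for n
    proof -
      have "(\<lambda>K. (\<Sum>k<K. L (P n k)) + e/2 * (1/2) ^ Suc n) \<longlonglongrightarrow> s n + e/2 * (1/2) ^ Suc n"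
        using s[of n] by (intro tendsto_add) (auto simp: sums_def)
      moreover have "s n < s n + e/2 * (1/2) ^ Suc n" using e by simp
      ultimately have "\<forall>\<^sub>F K in sequentially. s n < (\<Sum>k<K. L (P n k)) + e/2 * (1/2) ^ Suc n"
        by (rule order_tendstoD)
      then show ?thesis by (rule eventually_happens'[OF sequentially_bot])
    qed
    then obtain K where K: "\<And>n. s n < (\<Sum>k<K n. L (P n k)) + e/2 * (1/2) ^ Suc n" by metis
    let ?H = "\<lambda>m. case prod_decode m of (n, k) \<Rightarrow> P n k"
    have "cover (A \<inter> U) ?H"
      unfolding cover_def
    proof (intro conjI allI ballI)
      fix x assume x: "x \<in> A \<inter> U"
      have "(\<lambda>k. P n k x) sums F n x" for n
      proof -
        have "(\<lambda>k. g (Suc k) x - g k x) sums (1 - g 0 x)" using telescope_sums[OF g(6)] x by blast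
        from sums_mult[OF this, of "F n x"] show ?thesis by (simp add: P_def g(2))
      qed
      then have "(\<Sum>k. ennreal (P n k x)) = ennreal (F n x)" for n
        using PC FC by (intro suminf_ennreal_eq) auto
      then have "1 \<le> (\<Sum>n. \<Sum>k. ennreal (P n k x))"
        using F(1) x by (simp add: cover_def)
      also have "\<dots> = (\<Sum>m. (\<lambda>(n, k). ennreal (P n k x)) (prod_decode m))"
        by (rule suminf_ennreal_2dimen[symmetric]) simp
      finally show "1 \<le> (\<Sum>m. ennreal ((case prod_decode m of (n, k) \<Rightarrow> P n k) x))"
        by (simp add: case_prod_unfold)
    qed (use PC in \<open>auto split: prod.split\<close>)
    from out_le[OF this]
    have "out (A \<inter> U) \<le> (\<Sum>m. (\<lambda>(n, k). ennreal (L (P n k))) (prod_decode m))"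
      by (simp add: case_prod_unfold)
    also have "\<dots> = (\<Sum>n. \<Sum>k. ennreal (L (P n k)))"
      by (rule suminf_ennreal_2dimen) simp
    also have "\<dots> = (\<Sum>n. ennreal (s n))"
      using s LPn by (intro suminf_cong suminf_ennreal_eq) auto
    finally have 1: "out (A \<inter> U) \<le> (\<Sum>n. ennreal (s n))" .
    let ?Q = "\<lambda>n x. F n x - F n x * g (K n) x"
    have QC: "?Q n \<in> CcR" for n by (intro CcR_diff FC GC)
    have Q0: "0 \<le> ?Q n x" for n x using FC(2)[of n x] g(4)[of "K n" x] by (simp add: mult_left_le)
    have "cover (A - U) ?Q"
      unfolding cover_def
    proof (intro conjI allI ballI QC Q0)
      fix x assume x: "x \<in> A - U"
      then have "?Q n x = F n x" for n using g(7) by simp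
      moreover have "1 \<le> (\<Sum>n. ennreal (F n x))" using F(1) x by (auto simp: cover_def)
      ultimately show "1 \<le> (\<Sum>n. ennreal (?Q n x))" by (simp only:)
    qed
    from out_le[OF this]
    have 2: "out (A - U) \<le> (\<Sum>n. ennreal (L (?Q n)))" .
    have "out (A \<inter> U) + out (A - U) \<le> (\<Sum>n. ennreal (s n)) + (\<Sum>n. ennreal (L (?Q n)))"
      by (intro add_mono 1 2)
    also have "\<dots> = (\<Sum>n. ennreal (s n) + ennreal (L (?Q n)))" by (rule suminf_add) auto
    also have "\<dots> \<le> (\<Sum>n. ennreal (L (F n)) + ennreal (e/2 * (1/2) ^ Suc n))"
    proof (intro suminf_le)
      fix n
      have "s n + L (?Q n) \<le> L (F n) + e/2 * (1/2) ^ Suc n"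
        using K[of n] unfolding L_diff[OF FC(1) GC] tel by linarith
      moreover have "0 \<le> L (?Q n)" "0 \<le> L (F n)" using QC Q0 FC by (auto intro: L_nonneg)
      ultimately show "ennreal (s n) + ennreal (L (?Q n)) \<le> ennreal (L (F n)) + ennreal (e/2 * (1/2) ^ Suc n)"
        using s0[of n] e by (simp flip: ennreal_plus del: power_Suc add: ennreal_leI)
    qed auto
    also have "\<dots> = (\<Sum>n. ennreal (L (F n))) + (\<Sum>n. ennreal (e/2 * (1/2) ^ Suc n))"
      by (rule suminf_add[symmetric]) auto
    also have "\<dots> = (\<Sum>n. ennreal (L (F n))) + ennreal (e/2)"
      using suminf_half[of "e/2"] e by (simp only: half_gt_zero)
    also have "\<dots> \<le> out A + ennreal (e/2) + ennreal (e/2)" by (intro add_mono F order_refl)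
    also have "\<dots> = out A + ennreal e" using e by (simp add: add.assoc flip: ennreal_plus)
    finally show "out (A \<inter> U) + out (A - U) \<le> out A + ennreal e" .
  qed
qed

section \<open>The representing measure and its integral\<close>

definition \<mu> :: "'a measure" where "\<mu> = measure_of UNIV (sets borel) out"

lemma sets_\<mu> [simp]: "sets \<mu> = sets borel"
  by (simp add: \<mu>_def sets.sigma_sets_eq[of borel, simplified])

lemma space_\<mu> [simp]: "space \<mu> = UNIV"
  by (simp add: \<mu>_def)

text \<open>Caratheodory's construction gives a measure on the sets that split \<open>out\<close>
  additively; open sets are among them, hence so are all Borel sets.\<close>

lemma emeasure_\<mu>: assumes "A \<in> sets borel" shows "emeasure \<mu> A = out A"
proof -
  let ?S = "lambda_system UNIV UNIV out"
  interpret P: sigma_algebra UNIV "UNIV :: 'a set set" using sigma_algebra_Pow[of UNIV] by simp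
  have ms: "measure_space UNIV ?S out"
    by (rule P.caratheodory_lemma[OF outer_measure_space_out])
  interpret S: sigma_algebra UNIV ?S using ms by (simp add: measure_space_def)
  have "U \<in> ?S" if "open U" for U
  proof -
    have "out (A \<inter> U) + out (A - U) = out A" for A
    proof (rule antisym[OF open_measurable[OF that]])
      \<comment> \<open>A binary union written as a sequence padded with empty sets.\<close>
      have "out (\<Union>i. (if i = (0::nat) then A \<inter> U else if i = 1 then A - U else {}))
         \<le> (\<Sum>i. out (if i = (0::nat) then A \<inter> U else if i = 1 then A - U else {}))"
        by (rule out_subadditive)
      also have "\<dots> = (\<Sum>i\<in>{0,1}. out (if i = (0::nat) then A \<inter> U else if i = 1 then A - U else {}))"
        by (rule suminf_finite) (auto simp: out_empty)
      also have "(\<Union>i. (if i = (0::nat) then A \<inter> U else if i = 1 then A - U else {})) = A"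
        by (auto split: if_splits intro: exI[of _ "0::nat"] exI[of _ "1::nat"])
      finally show "out A \<le> out (A \<inter> U) + out (A - U)" by simp
    qed
    then show ?thesis by (simp add: P.lambda_system_eq)
  qed
  then have "sigma_sets UNIV {S. open S} \<subseteq> ?S"
    by (intro S.sigma_sets_subset) auto
  then have sub: "sets (borel :: 'a measure) \<subseteq> ?S"
    by (simp add: borel_def)
  have "countably_additive ?S out" "positive ?S out" using ms by (auto simp: measure_space_def)
  then have "countably_additive (sets borel) out" "positive (sets borel) out"
    using sub unfolding countably_additive_def positive_def by (blast, blast)
  then show ?thesis
    unfolding \<mu>_def using assms sets.sigma_algebra_axioms[of "borel :: 'a measure"]
    by (intro emeasure_measure_of_sigma) auto
qed

text \<open>A cover of \<open>A\<close> could conceivably be cheaper than \<open>f\<close>.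
  Compactness excludes this, as in Dini's theorem: on a ball containing the support finitely many
  members already exceed \<open>f - d\<close>, and the deficit is absorbed by \<open>d\<close> times
  a plateau function.\<close>

lemma out_lower:
  assumes f: "f \<in> CcR" "\<And>x. 0 \<le> f x" "\<And>x. f x \<le> 1" "\<And>x. x \<notin> A \<Longrightarrow> f x = 0"
  shows "ennreal (L f) \<le> out A"
  unfolding out_def
proof (rule INF_greatest)
  fix F assume "F \<in> {F. cover A F}"
  then have F: "\<And>n. F n \<in> CcR" "\<And>n x. 0 \<le> F n x" "\<And>x. x \<in> A \<Longrightarrow> 1 \<le> (\<Sum>n. ennreal (F n x))"
    by (auto simp: cover_def)
  obtain r where r: "r > 0" "\<And>x. norm x \<ge> r \<Longrightarrow> f x = 0" using CcR_radius[OF f(1)] by blast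
  obtain \<eta> :: "'a \<Rightarrow> real" where \<eta>: "\<eta> \<in> CcR" "\<And>x. norm x \<le> r \<Longrightarrow> \<eta> x = 1" "\<And>x. 0 \<le> \<eta> x" "\<And>x. \<eta> x \<le> 1"
    using plateau by blast
  have L\<eta>: "0 \<le> L \<eta>" using \<eta> by (intro L_nonneg)
  have LF: "0 \<le> L (F n)" for n using F by (intro L_nonneg)
  show "ennreal (L f) \<le> (\<Sum>n. ennreal (L (F n)))"
  proof (rule ennreal_le_epsilon)
    fix e :: real assume e: "e > 0"
    \<comment> \<open>The deficit then costs at most \<open>e\<close>; the summand 1 allows for
      \<open>L \<eta> = 0\<close>.\<close>
    define d where "d = e / (L \<eta> + 1)"
    have d: "d > 0" "d * L \<eta> \<le> e" using e L\<eta> by (auto simp: d_def field_simps)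
    define V where "V N = {x. f x < (\<Sum>n<N. F n x) + d}" for N
    have openV: "open (V N)" for N
      unfolding V_def by (intro open_Collect_less continuous_on_add continuous_on_sum CcR_continuous f F continuous_on_const)
    have "cball 0 r \<subseteq> (\<Union>N. V N)"
    proof
      fix x
      have "\<exists>N. f x < (\<Sum>n<N. F n x) + d"
      proof (cases "x \<in> A")
        case False
        then show ?thesis using f(4) d by (intro exI[of _ 0]) auto
      next
        case True
        have "ennreal (1 - d/2) < 1" using d(1) by (simp add: ennreal_less_one_iff)
        also have "1 \<le> (SUP N. \<Sum>n<N. ennreal (F n x))"
          using F(3)[OF True] by (simp add: suminf_eq_SUP)
        finally obtain N where "ennreal (1 - d/2) < (\<Sum>n<N. ennreal (F n x))"
          by (auto simp: less_SUP_iff)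
        then have "ennreal (1 - d/2) < ennreal (\<Sum>n<N. F n x)" using F(2) by (simp add: sum_ennreal)
        then have "1 - d/2 < (\<Sum>n<N. F n x)" by (meson ennreal_leI not_le)
        then have "f x < (\<Sum>n<N. F n x) + d" using f(3)[of x] d(1) by linarith
        then show ?thesis by blast
      qed
      then show "x \<in> (\<Union>N. V N)" by (auto simp: V_def)
    qed
    then obtain D where D: "finite D" "cball 0 r \<subseteq> (\<Union>N\<in>D. V N)"
      using compactE_image[OF compact_cball, of UNIV V 0 r] openV by auto
    \<comment> \<open>The sets \<open>V N\<close> increase, so the largest index suffices; 0 is
      inserted in case \<open>D\<close> is empty.\<close>
    define M where "M = Max (insert 0 D)"
    have Vmono: "V N \<subseteq> V M" if "N \<in> D" for N
    proof -
      have "N \<le> M" using that D(1) by (simp add: M_def)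
      then have "(\<Sum>n<N. F n x) \<le> (\<Sum>n<M. F n x)" for x using F(2) by (intro sum_mono2) auto
      then show ?thesis unfolding V_def by (auto intro: less_le_trans)
    qed
    have "f x \<le> (\<Sum>n<M. F n x) + d * \<eta> x" for x
    proof (cases "norm x \<le> r")
      case True
      then have "x \<in> \<Union> (V ` D)" using subsetD[OF D(2), of x] by simp
      then have "x \<in> V M" using Vmono by blast
      then show ?thesis using \<eta>(2)[OF True] by (simp add: V_def)
    next
      case False
      then show ?thesis using r(2)[of x] d \<eta>(3)[of x] F(2) by (auto intro!: add_nonneg_nonneg sum_nonneg)
    qed
    then have "L f \<le> L (\<lambda>x. (\<Sum>n<M. F n x) + d * \<eta> x)"
      by (intro L_mono f CcR_add CcR_sum F CcR_cmult \<eta>)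
    also have "\<dots> = (\<Sum>n<M. L (F n)) + d * L \<eta>"
      by (simp add: L_add L_sum L_scale CcR_sum F CcR_cmult \<eta>)
    also have "\<dots> \<le> (\<Sum>n<M. L (F n)) + e" using d by simp
    finally have "ennreal (L f) \<le> ennreal ((\<Sum>n<M. L (F n)) + e)" by (rule ennreal_leI)
    also have "\<dots> = (\<Sum>n<M. ennreal (L (F n))) + ennreal e"
      using LF e by (subst ennreal_plus) (auto intro: sum_nonneg simp: sum_ennreal)
    also have "\<dots> \<le> (\<Sum>n. ennreal (L (F n))) + ennreal e"
      by (intro add_mono sum_le_suminf) auto
    finally show "ennreal (L f) \<le> (\<Sum>n. ennreal (L (F n))) + ennreal e" .
  qed
qed

lemma finite_on_bounded:
  assumes "A \<in> sets borel" "\<And>x. x \<in> A \<Longrightarrow> norm x \<le> r"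
  shows "emeasure \<mu> A < \<infinity>"
proof -
  obtain \<eta> :: "'a \<Rightarrow> real" where \<eta>: "\<eta> \<in> CcR" "\<And>x. norm x \<le> r \<Longrightarrow> \<eta> x = 1" "\<And>x. 0 \<le> \<eta> x" "\<And>x. \<eta> x \<le> 1"
    using plateau by blast
  have "out A \<le> ennreal (L \<eta>)" using \<eta> assms(2) by (intro out_upper) auto
  then show ?thesis using emeasure_\<mu>[OF assms(1)] by (simp add: le_less_trans)
qed

lemma CcR_integrable: assumes "f \<in> CcR" shows "integrable \<mu> f"
proof -
  obtain r where r: "\<And>x. norm x \<ge> r \<Longrightarrow> f x = 0" using CcR_radius[OF assms(1)] by blast
  obtain B where B: "\<And>x. \<bar>f x\<bar> \<le> B" using CcR_bounded[OF assms(1)] by blast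
  show ?thesis
  proof (rule integrableI_bounded_set[where A="cball 0 r" and B=B])
    show "f \<in> borel_measurable \<mu>"
      using borel_measurable_continuous_onI[OF CcR_continuous[OF assms]]
      by (simp cong: measurable_cong_sets)
    show "emeasure \<mu> (cball 0 r) < \<infinity>" by (rule finite_on_bounded) auto
    show "AE x in \<mu>. x \<in> cball 0 r \<longrightarrow> norm (f x) \<le> B" using B by simp
    show "AE x in \<mu>. x \<notin> cball 0 r \<longrightarrow> f x = 0" using r by (intro AE_I2) auto
  qed simp
qed

text \<open>As \<open>f\<close> lies between \<open>h\<close> times the indicators of
  \<open>B\<close> and of \<open>A\<close>, both \<open>L f\<close> and the integral lie between
  \<open>h * measure \<mu> B\<close> and \<open>h * measure \<mu> A\<close>.\<close>

lemma slice_bounds: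
  assumes f: "f \<in> CcR" "\<And>x. 0 \<le> f x" "\<And>x. f x \<le> h" and h: "h > 0"
    and A: "A \<in> sets borel" "\<And>x. x \<notin> A \<Longrightarrow> f x = 0" "emeasure \<mu> A < \<infinity>"
    and B: "B \<in> sets borel" "\<And>x. x \<in> B \<Longrightarrow> f x = h" "emeasure \<mu> B < \<infinity>"
  shows "\<bar>L f - (LINT x|\<mu>. f x)\<bar> \<le> h * (measure \<mu> A - measure \<mu> B)"
proof -
  have out: "out A = ennreal (measure \<mu> A)" "out B = ennreal (measure \<mu> B)"
    using A(3) B(3) emeasure_\<mu>[OF A(1)] emeasure_\<mu>[OF B(1)]
    by (metis emeasure_eq_ennreal_measure infinity_ennreal_def less_irrefl)+
  have "ennreal (L (\<lambda>x. inverse h * f x)) \<le> out A"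
    using f h A(2) by (intro out_lower CcR_cmult) (auto simp: field_simps)
  then have "ennreal (inverse h * L f) \<le> ennreal (measure \<mu> A)"
    unfolding out by (simp only: L_scale[OF f(1)])
  then have 1: "L f \<le> h * measure \<mu> A" using h by (simp add: field_simps)
  have "out B \<le> ennreal (L (\<lambda>x. inverse h * f x))"
    using f h B(2) by (intro out_upper CcR_cmult) auto
  then have "ennreal (measure \<mu> B) \<le> ennreal (inverse h * L f)"
    unfolding out by (simp only: L_scale[OF f(1)])
  moreover have "0 \<le> inverse h * L f" using h L_nonneg[OF f(1,2)] by simp
  ultimately have 2: "h * measure \<mu> B \<le> L f" using h by (simp add: field_simps)
  have "(LINT x|\<mu>. f x) \<le> (LINT x|\<mu>. h * indicator A x)"
    using f A h
    by (intro integral_mono CcR_integrable[OF f(1)] integrable_mult_right integrable_real_indicator)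
       (auto simp: indicator_def)
  then have 3: "(LINT x|\<mu>. f x) \<le> h * measure \<mu> A" using A by simp
  have "(LINT x|\<mu>. h * indicator B x) \<le> (LINT x|\<mu>. f x)"
    using f B h
    by (intro integral_mono CcR_integrable[OF f(1)] integrable_mult_right integrable_real_indicator)
       (auto simp: indicator_def)
  then have 4: "h * measure \<mu> B \<le> (LINT x|\<mu>. f x)" using B by simp
  show ?thesis using 1 2 3 4 by (simp add: right_diff_distrib abs_le_iff)
qed

text \<open>Cut \<open>f\<close> horizontally into slices of height \<open>h\<close>. The two sets
  that \<open>slice_bounds\<close> attaches to a slice are consecutive superlevel sets, so the
  errors telescope to at most \<open>h * measure \<mu> (A 0)\<close>, which vanishes with
  \<open>h\<close>.\<close>

lemma L_eq_integral_nonneg: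
  assumes f: "f \<in> CcR" "\<And>x. 0 \<le> f x"
  shows "L f = (LINT x|\<mu>. f x)"
proof -
  obtain r where r: "\<And>x. norm x \<ge> r \<Longrightarrow> f x = 0" using CcR_radius[OF f(1)] by blast
  obtain C where C: "\<And>x. \<bar>f x\<bar> \<le> C" "C > 0" using CcR_bounded[OF f(1)] by blast
  define A where "A t = {x. f x > t}" for t
  have A_sets: "A t \<in> sets borel" for t
    unfolding A_def using CcR_continuous[OF f(1)] by (intro borel_open open_Collect_less) auto
  have fin: "emeasure \<mu> (A t) < \<infinity>" if "t \<ge> 0" for t
    using that r by (intro finite_on_bounded[OF A_sets, of _ r]) (auto simp: A_def not_less[symmetric] intro: less_imp_le)
  have main: "\<bar>L f - (LINT x|\<mu>. f x)\<bar> \<le> h * measure \<mu> (A 0)" if h: "h > 0" for h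
  proof -
    define g where "g i x = min (max (f x - real i * h) 0) h" for i x
    have gC: "g i \<in> CcR" for i
    proof -
      have "(\<lambda>x. (\<lambda>t. min (max (t - real i * h) 0) h) (f x)) \<in> CcR"
      proof (rule CcR_compose[OF f(1)])
        show "continuous_on UNIV (\<lambda>t. min (max (t - real i * h) 0) h)" by (intro continuous_intros)
        have "0 \<le> real i * h" using h by simp
        then show "min (max (0 - real i * h) 0) h = 0" using h by simp
      qed
      then show ?thesis by (simp add: g_def[abs_def])
    qed
    obtain M where M: "C < real M * h" using ex_less_of_nat_mult[OF h] by blast
    have sum_g: "(\<Sum>i<m. g i x) = min (f x) (real m * h)" for m x
      using h f(2)[of x] by (induction m) (auto simp: g_def min_def max_def algebra_simps)
    have f_eq: "f x = (\<Sum>i<M. g i x)" for x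
      unfolding sum_g using C(1)[of x] M by simp
    have "L f = (\<Sum>i<M. L (g i))" by (subst f_eq[abs_def]) (simp add: L_sum gC)
    moreover have "(LINT x|\<mu>. f x) = (\<Sum>i<M. LINT x|\<mu>. g i x)"
      by (subst f_eq) (simp add: CcR_integrable gC)
    ultimately have "\<bar>L f - (LINT x|\<mu>. f x)\<bar> \<le> (\<Sum>i<M. \<bar>L (g i) - (LINT x|\<mu>. g i x)\<bar>)"
      by (simp flip: sum_subtractf)
    also have "\<dots> \<le> (\<Sum>i<M. h * (measure \<mu> (A (real i * h)) - measure \<mu> (A (real (Suc i) * h))))"
    proof (rule sum_mono, rule slice_bounds[OF gC _ _ h A_sets _ fin A_sets _ fin])
      fix i x
      show "0 \<le> g i x" "g i x \<le> h" using h by (auto simp: g_def)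
      show "g i x = 0" if "x \<notin> A (real i * h)" using that h by (simp add: A_def g_def)
      show "g i x = h" if "x \<in> A (real (Suc i) * h)" using that h by (simp add: A_def g_def algebra_simps)
    qed (use h in auto)
    also have "\<dots> = h * (measure \<mu> (A (real 0 * h)) - measure \<mu> (A (real M * h)))"
      unfolding sum_distrib_left[symmetric]
      by (subst sum_lessThan_telescope'[of "\<lambda>i. measure \<mu> (A (real i * h))"]) simp
    also have "\<dots> \<le> h * measure \<mu> (A 0)" using h by simp
    finally show ?thesis .
  qed
  have "\<bar>L f - (LINT x|\<mu>. f x)\<bar> \<le> 0"
  proof (rule field_le_epsilon)
    fix e :: real assume e: "e > 0"
    have p: "measure \<mu> (A 0) + 1 > 0" using measure_nonneg[of \<mu> "A 0"] by linarith
    have "\<bar>L f - (LINT x|\<mu>. f x)\<bar> \<le> e / (measure \<mu> (A 0) + 1) * measure \<mu> (A 0)"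
      using e p by (intro main) simp
    also have "\<dots> \<le> e" using e p by (simp add: field_simps)
    finally show "\<bar>L f - (LINT x|\<mu>. f x)\<bar> \<le> 0 + e" by simp
  qed
  then show ?thesis by simp
qed

lemma L_eq_integral: assumes "f \<in> CcR" shows "L f = (LINT x|\<mu>. f x)"
proof -
  have p: "(\<lambda>x. max (f x) 0) \<in> CcR" "(\<lambda>x. max (- f x) 0) \<in> CcR"
    by (rule CcR_compose[OF assms]; (intro continuous_intros)?; simp)+
  have e: "f = (\<lambda>x. max (f x) 0 - max (- f x) 0)" by (auto simp: max_def)
  have "L f = L (\<lambda>x. max (f x) 0) - L (\<lambda>x. max (- f x) 0)"
    by (subst e) (rule L_diff[OF p])
  also have "\<dots> = (LINT x|\<mu>. max (f x) 0) - (LINT x|\<mu>. max (- f x) 0)"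
    by (simp add: L_eq_integral_nonneg p)
  also have "\<dots> = (LINT x|\<mu>. max (f x) 0 - max (- f x) 0)"
    by (intro Bochner_Integration.integral_diff[symmetric] CcR_integrable p)
  also have "\<dots> = (LINT x|\<mu>. f x)" using e by (metis (no_types, lifting))
  finally show ?thesis .
qed

end

section \<open>Uniqueness of Borel measures that are finite on compact sets\<close>

lemma borel_measure_eqI:
  fixes M N :: "'a::euclidean_space measure"
  assumes sets: "sets M = sets borel" "sets N = sets borel"
    and fin: "\<And>K. compact K \<Longrightarrow> emeasure M K < \<infinity>" "\<And>K. compact K \<Longrightarrow> emeasure N K < \<infinity>"
    and eq: "\<And>f. f \<in> CcR \<Longrightarrow> (LINT x|M. f x) = (LINT x|N. f x)"
  shows "M = N"
proof -
  \<comment> \<open>For nonempty compact \<open>K\<close> these decrease to the indicator of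
    \<open>K\<close>. At \<open>k = 0\<close> the function is constantly 1, so only the indices
    \<open>Suc k\<close> give compact support.\<close>
  define g where "g K k x = max 0 (1 - real k * infdist x K)" for K and k :: nat and x :: 'a
  have far: "\<exists>b. \<forall>k x. norm x \<ge> b \<longrightarrow> g K (Suc k) x = 0" if K: "compact K" "K \<noteq> {}" for K
  proof -
    obtain b where b: "\<And>x. x \<in> K \<Longrightarrow> norm x \<le> b"
      using compact_imp_bounded[OF K(1)] by (auto simp: bounded_iff)
    have "g K (Suc k) x = 0" if "norm x \<ge> b + 1" for k x
    proof -
      obtain y where y: "y \<in> K" "infdist x K = dist x y"
        using infdist_attains_inf[OF compact_imp_closed[OF K(1)] K(2)] by blast
      have "norm x - norm y \<le> dist x y" by (simp add: dist_norm norm_triangle_ineq2)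
      then have "1 \<le> infdist x K" using b[OF y(1)] y(2) that by linarith
      then have "1 * 1 \<le> real (Suc k) * infdist x K" by (intro mult_mono) auto
      then show ?thesis by (simp add: g_def)
    qed
    then show ?thesis by blast
  qed
  have lim: "(\<lambda>k. LINT x|Q. g K (Suc k) x) \<longlonglongrightarrow> measure Q K"
    if K: "compact K" "K \<noteq> {}" and Q: "sets Q = sets borel" "\<And>K. compact K \<Longrightarrow> emeasure Q K < \<infinity>"
    for K and Q :: "'a measure"
  proof -
    obtain b where g0: "\<And>k x. norm x \<ge> b \<Longrightarrow> g K (Suc k) x = 0" using far[OF K] by blast
    have gK: "(\<lambda>k. g K (Suc k) x) \<longlonglongrightarrow> indicator K x" for x
    proof (cases "x \<in> K")
      case True
      then show ?thesis by (simp add: g_def)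
    next
      case False
      then have "infdist x K > 0"
        using infdist_pos_not_in_closed[OF compact_imp_closed[OF K(1)] K(2)] by blast
      then obtain N where N: "real N * infdist x K > 1" using ex_less_of_nat_mult by blast
      have "g K (Suc k) x = 0" if "k \<ge> N" for k
      proof -
        have "real N * infdist x K \<le> real (Suc k) * infdist x K"
          using that by (intro mult_right_mono infdist_nonneg) auto
        then show ?thesis using N by (simp add: g_def)
      qed
      then show ?thesis using False by (auto intro!: tendsto_eventually eventually_sequentiallyI)
    qed
    have K_sets: "K \<in> sets Q" using K(1) Q(1) by (simp add: borel_compact)
    have "(\<lambda>k. LINT x|Q. g K (Suc k) x) \<longlonglongrightarrow> (LINT x|Q. indicator K x)"
    proof (rule integral_dominated_convergence[where w="indicator (cball 0 b)"])
      show "indicat_real K \<in> borel_measurable Q" using K_sets by simp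
      show "g K (Suc k) \<in> borel_measurable Q" for k
        unfolding g_def[abs_def] measurable_cong_sets[OF Q(1) refl]
        by (intro borel_measurable_continuous_onI continuous_intros)
      show "integrable Q (indicat_real (cball 0 b))"
        using Q by (intro integrable_real_indicator) (auto simp: Q(1))
      show "AE x in Q. norm (g K (Suc k) x) \<le> indicator (cball 0 b) x" for k
      proof (rule AE_I2)
        fix x
        show "norm (g K (Suc k) x) \<le> indicator (cball 0 b) x"
          using g0[of x k] infdist_nonneg[of x K] by (auto simp: indicator_def g_def not_le)
      qed
    qed (use gK in auto)
    then show ?thesis using K_sets by simp
  qed
  have gC: "g K (Suc k) \<in> CcR" if K: "compact K" "K \<noteq> {}" for K k
  proof -
    obtain b where g0: "\<And>k x. norm x \<ge> b \<Longrightarrow> g K (Suc k) x = 0" using far[OF K] by blast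
    have "continuous_on UNIV (g K (Suc k))" unfolding g_def[abs_def] by (intro continuous_intros)
    then show ?thesis using g0 by (rule CcRI)
  qed
  have E: "emeasure M K = emeasure N K" if "compact K" for K
  proof (cases "K = {}")
    case False
    have "measure M K = measure N K"
      using lim[OF that False sets(1) fin(1)] lim[OF that False sets(2) fin(2)] eq[OF gC[OF that False]]
      by (simp add: LIMSEQ_unique)
    then show ?thesis using fin[OF that] by (simp add: emeasure_eq_ennreal_measure)
  qed simp
  \<comment> \<open>Compact sets are stable under intersection and generate the Borel sets; the
    balls exhaust the space by sets of finite measure.\<close>
  show ?thesis
  proof (rule measure_eqI_generator_eq[where E="{K. compact K}" and \<Omega>=UNIV and A="\<lambda>i. cball 0 (real i)"])
    show "Int_stable {K::'a set. compact K}" by (auto simp: Int_stable_def)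
    have s: "sets borel = sigma_sets UNIV {K::'a set. compact K}"
    proof (rule antisym)
      have "closed F \<Longrightarrow> F \<in> sigma_sets UNIV {K::'a set. compact K}" for F :: "'a set"
      proof -
        assume F: "closed F"
        have "F = (\<Union>i. F \<inter> cball 0 (real i))" using real_arch_simple by auto
        also have "\<dots> \<in> sigma_sets UNIV {K::'a set. compact K}"
          using F by (intro sigma_sets.Union sigma_sets.Basic) (auto intro: closed_Int_compact)
        finally show ?thesis .
      qed
      then have "sigma_sets UNIV {F::'a set. closed F} \<subseteq> sigma_sets UNIV {K::'a set. compact K}"
        by (intro sigma_sets_mono) auto
      then show "sets borel \<subseteq> sigma_sets UNIV {K::'a set. compact K}"
        by (simp add: borel_eq_closed)
      show "sigma_sets UNIV {K::'a set. compact K} \<subseteq> sets borel"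
        by (rule sets.sigma_sets_subset[of "{K. compact K}" "borel :: 'a measure", unfolded space_borel])
           (auto simp: borel_compact)
    qed
    show "sets M = sigma_sets UNIV {K. compact K}" "sets N = sigma_sets UNIV {K. compact K}"
      using sets s by auto
    show "(\<Union>i. cball 0 (real i)) = (UNIV :: 'a set)" using real_arch_simple by auto
    show "emeasure M (cball 0 (real i)) \<noteq> \<infinity>" for i using fin(1)[of "cball 0 (real i)"] by auto
  qed (use E in auto)
qed

section \<open>Products of complex Hessians\<close>

text \<open>The constant coefficient of \<open>integration_current\<close> once the Lebesgue
  integral is split off.\<close>

definition sign_kernel :: "('n::finite \<times> 'n) list \<Rightarrow> complex" where
  "sign_kernel ab = (if length ab = CARD('n) \<and> distinct (map fst ab) \<and> distinct (map snd ab)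
      then of_int (sign (\<lambda>a. the (map_of ab a))) * (- 2 * \<i>) ^ CARD('n) else 0)"

lemma integration_current_eq: "integration_current ab f = sign_kernel ab * (LINT z|lborel. f z)"
  by (simp add: integration_current_def sign_kernel_def)

text \<open>The two-forms attached to the pairs commute, so their order cannot matter: for distinct
  keys \<open>map_of\<close> depends only on the set of pairs.\<close>

lemma sign_kernel_perm:
  assumes "mset ab = mset ab'" shows "sign_kernel ab = sign_kernel ab'"
proof -
  have 1: "length ab = length ab'" "set ab = set ab'"
    using assms by (metis size_mset, metis set_mset_mset)
  have m: "mset (map fst ab) = mset (map fst ab')" "mset (map snd ab) = mset (map snd ab')"
    using assms by simp_all
  then have 2: "distinct (map fst ab) = distinct (map fst ab')" "distinct (map snd ab) = distinct (map snd ab')"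
    using mset_eq_imp_distinct_iff[OF m(1)] mset_eq_imp_distinct_iff[OF m(2)] by auto
  have "map_of ab = map_of ab'" if "distinct (map fst ab)"
    by (rule iffD2[OF map_of_inject_set]) (use that 1(2) 2(1) in simp_all)
  then show ?thesis unfolding sign_kernel_def using 1 2 by auto
qed

lemma distinct_list_UNIV:
  fixes xs :: "'n::finite list"
  assumes "distinct xs" "length xs = CARD('n)" shows "set xs = UNIV"
  by (rule card_subset_eq[OF finite subset_UNIV]) (simp only: distinct_card[OF assms(1)] assms(2))

lemma zip_fst_snd: "zip (map fst ab) (map snd ab) = ab"
  by (induction ab) auto

lemma map_of_zip_permutation:
  fixes xs ys :: "'n::finite list"
  assumes "distinct xs" "distinct ys" "length xs = CARD('n)" "length ys = CARD('n)"
  shows "permutation (\<lambda>a. the (map_of (zip xs ys) a))"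
proof -
  have "surj (\<lambda>a. the (map_of (zip xs ys) a))"
  unfolding surj_def
  proof
    fix y
    have "y \<in> set ys" using distinct_list_UNIV[OF assms(2,4)] by simp
    then obtain i where i: "i < length ys" "ys ! i = y" by (auto simp: in_set_conv_nth)
    then have "map_of (zip xs ys) (xs ! i) = Some y" using assms by (simp add: map_of_zip_nth)
    then have "y = the (map_of (zip xs ys) (xs ! i))" by simp
    then show "\<exists>x. y = the (map_of (zip xs ys) x)" by blast
  qed
  then have "bij (\<lambda>a. the (map_of (zip xs ys) a))"
    using finite_UNIV_surj_inj[OF finite] by (auto simp: bij_def)
  then show ?thesis by (simp add: permutation)
qed

text \<open>Exchanging two holomorphic indices composes the permutation with a transposition. If
  \<open>a = a'\<close>, or if any other repetition occurs, both sides are 0.\<close>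

lemma sign_kernel_swap: "sign_kernel ((a, b) # (a', b') # ab) = - sign_kernel ((a', b) # (a, b') # ab)"
proof -
  let ?l = "(a, b) # (a', b') # ab" and ?l' = "(a', b) # (a, b') # ab"
  have cond: "(length ?l = CARD('a) \<and> distinct (map fst ?l) \<and> distinct (map snd ?l)) \<longleftrightarrow>
     (length ?l' = CARD('a) \<and> distinct (map fst ?l') \<and> distinct (map snd ?l'))" by auto
  show ?thesis
  proof (cases "length ?l = CARD('a) \<and> distinct (map fst ?l) \<and> distinct (map snd ?l)")
    case True
    then have ne: "a \<noteq> a'" by auto
    have p: "permutation (\<lambda>x. the (map_of ?l x))"
      using map_of_zip_permutation[of "map fst ?l" "map snd ?l"] True unfolding zip_fst_snd by simp
    have "(\<lambda>x. the (map_of ?l' x)) = (\<lambda>x. the (map_of ?l x)) \<circ> Transposition.transpose a a'"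
      using ne by (auto simp: fun_eq_iff Transposition.transpose_def)
    then have "sign (\<lambda>x. the (map_of ?l' x)) = sign (\<lambda>x. the (map_of ?l x)) * sign (Transposition.transpose a a')"
      using sign_compose[OF p permutation_swap_id] by metis
    then have "sign (\<lambda>x. the (map_of ?l' x)) = - sign (\<lambda>x. the (map_of ?l x))"
      using ne by (simp add: sign_swap_id)
    then show ?thesis unfolding sign_kernel_def using True cond by simp
  next
    case False
    then have "sign_kernel ?l = 0" unfolding sign_kernel_def by (rule if_not_P)
    moreover have "sign_kernel ?l' = 0" using False unfolding cond sign_kernel_def by (rule if_not_P)
    ultimately show ?thesis by simp
  qed
qed

text \<open>The permutation taking \<open>as\<close> to \<open>bs\<close> factors through a fixed
  enumeration \<open>es\<close>, and signs are multiplicative and their own inverses. So the kernel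
  is a constant times a function of \<open>as\<close> times the same function of \<open>bs\<close>:
  the positivity of the current of integration.\<close>

lemma sign_kernel_rank_one:
  obtains e :: "'n::finite list \<Rightarrow> real" where
    "\<And>as bs. length as = length bs \<Longrightarrow> sign_kernel (zip as bs) = (- 2 * \<i>) ^ CARD('n) * of_real (e as * e bs)"
proof -
  obtain es :: "'n list" where es: "distinct es" "set es = UNIV"
    using finite_distinct_list[OF finite[of "UNIV :: 'n set"]] by blast
  then have les: "length es = CARD('n)" using distinct_card by fastforce
  let ?p = "\<lambda>xs ys a. the (map_of (zip xs ys) a)"
  let ?ok = "\<lambda>as. length as = CARD('n) \<and> distinct as"
  define e where "e as = (if ?ok as then real_of_int (sign (?p es as)) else 0)" for as :: "'n list"
  have comp: "?p ys zs \<circ> ?p xs ys = ?p xs zs"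
    if "?ok xs" "?ok ys" "?ok zs" for xs ys zs :: "'n list"
  proof
    fix a
    have "a \<in> set xs" using distinct_list_UNIV that by blast
    then obtain i where i: "i < length xs" "a = xs ! i" by (auto simp: in_set_conv_nth)
    then show "(?p ys zs \<circ> ?p xs ys) a = ?p xs zs a" using that by (simp add: map_of_zip_nth)
  qed
  have "sign_kernel (zip as bs) = (- 2 * \<i>) ^ CARD('n) * of_real (e as * e bs)" if l: "length as = length bs" for as bs :: "'n list"
  proof (cases "?ok as \<and> ?ok bs")
    case True
    have ok: "?ok es" "?ok as" "?ok bs" using True es les by auto
    have "sign (?p es bs) = sign (?p as bs) * sign (?p es as)"
      using sign_compose[of "?p as bs" "?p es as"] comp[of es as bs] ok by (metis map_of_zip_permutation)
    then have "sign (?p as bs) = sign (?p es as) * sign (?p es bs)"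
      by (simp add: sign_def)
    then show ?thesis using True ok by (simp add: sign_kernel_def e_def mult.commute)
  next
    case False
    then show ?thesis using l by (auto simp: sign_kernel_def e_def)
  qed
  then show ?thesis using that by blast
qed

text \<open>For smooth factors this is the Lebesgue density of the coefficient at \<open>ab\<close>
  of their dd^c-product. Pushing one index pair per factor onto the list mirrors
  \<open>ddc_wedge\<close>.\<close>

primrec hessian_kernel :: "(complex ^ 'n \<Rightarrow> complex) list \<Rightarrow> ('n::finite \<times> 'n) list \<Rightarrow> complex ^ 'n \<Rightarrow> complex" where
  "hessian_kernel [] ab z = sign_kernel ab"
| "hessian_kernel (u # us) ab z = (\<Sum>a\<in>UNIV. \<Sum>b\<in>UNIV. 2 * \<i> * d_z a (d_zbar b u) z * hessian_kernel us ((a, b) # ab) z)"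

lemma hessian_kernel_perm: "mset ab = mset ab' \<Longrightarrow> hessian_kernel us ab z = hessian_kernel us ab' z"
proof (induction us arbitrary: ab ab')
  case Nil
  then show ?case using sign_kernel_perm[of ab ab'] by simp
next
  case (Cons u us)
  have "hessian_kernel us ((a, b) # ab) z = hessian_kernel us ((a, b) # ab') z" for a b
    by (rule Cons.IH) (simp add: Cons.prems)
  then show ?case by simp
qed

text \<open>The sign change is inherited from \<open>sign_kernel\<close>: the pair pushed by the
  next factor can be moved behind the two pairs in question.\<close>

lemma hessian_kernel_swap: "hessian_kernel us ((a, b) # (a', b') # ab) z = - hessian_kernel us ((a', b) # (a, b') # ab) z"
proof (induction us arbitrary: ab)
  case Nil
  then show ?case using sign_kernel_swap by simp
next
  case (Cons u us)
  have "hessian_kernel us ((c, d) # (a, b) # (a', b') # ab) z = - hessian_kernel us ((c, d) # (a', b) # (a, b') # ab) z" for c d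
  proof -
    have "hessian_kernel us ((c, d) # (a, b) # (a', b') # ab) z = hessian_kernel us ((a, b) # (a', b') # (c, d) # ab) z"
      by (rule hessian_kernel_perm) simp
    also have "\<dots> = - hessian_kernel us ((a', b) # (a, b') # (c, d) # ab) z" by (rule Cons.IH)
    also have "hessian_kernel us ((a', b) # (a, b') # (c, d) # ab) z = hessian_kernel us ((c, d) # (a', b) # (a, b') # ab) z"
      by (rule hessian_kernel_perm) simp
    finally show ?thesis .
  qed
  then show ?case by (simp add: sum_negf)
qed

lemma hessian_kernel_swap_snd: "hessian_kernel us ((a, b) # (a', b') # ab) z = - hessian_kernel us ((a, b') # (a', b) # ab) z"
proof -
  have "hessian_kernel us ((a, b) # (a', b') # ab) z = - hessian_kernel us ((a', b) # (a, b') # ab) z" by (rule hessian_kernel_swap)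
  also have "hessian_kernel us ((a', b) # (a, b') # ab) z = hessian_kernel us ((a, b') # (a', b) # ab) z"
    by (rule hessian_kernel_perm) simp
  finally show ?thesis .
qed

section \<open>Symmetry in the factors\<close>

lemma sum_swap_pairs:
  fixes f :: "'n::finite \<Rightarrow> 'n \<Rightarrow> 'n \<Rightarrow> 'n \<Rightarrow> complex"
  shows "(\<Sum>a\<in>UNIV. \<Sum>b\<in>UNIV. \<Sum>c\<in>UNIV. \<Sum>d\<in>UNIV. f a b c d) =
         (\<Sum>c\<in>UNIV. \<Sum>d\<in>UNIV. \<Sum>a\<in>UNIV. \<Sum>b\<in>UNIV. f a b c d)"
proof -
  have "(\<Sum>a\<in>UNIV. \<Sum>b\<in>UNIV. \<Sum>c\<in>UNIV. \<Sum>d\<in>UNIV. f a b c d) =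
        (\<Sum>a\<in>UNIV. \<Sum>c\<in>UNIV. \<Sum>b\<in>UNIV. \<Sum>d\<in>UNIV. f a b c d)"
    by (rule sum.cong[OF refl], rule sum.swap)
  also have "\<dots> = (\<Sum>a\<in>UNIV. \<Sum>c\<in>UNIV. \<Sum>d\<in>UNIV. \<Sum>b\<in>UNIV. f a b c d)"
    by (rule sum.cong[OF refl], rule sum.cong[OF refl], rule sum.swap)
  also have "\<dots> = (\<Sum>c\<in>UNIV. \<Sum>a\<in>UNIV. \<Sum>d\<in>UNIV. \<Sum>b\<in>UNIV. f a b c d)" by (rule sum.swap)
  also have "\<dots> = (\<Sum>c\<in>UNIV. \<Sum>d\<in>UNIV. \<Sum>a\<in>UNIV. \<Sum>b\<in>UNIV. f a b c d)"
    by (rule sum.cong[OF refl], rule sum.swap)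
  finally show ?thesis .
qed

lemma hessian_kernel_commute: "hessian_kernel (u # v # us) ab z = hessian_kernel (v # u # us) ab z"
proof -
  have p: "hessian_kernel us ((c, d) # (a, b) # ab) z = hessian_kernel us ((a, b) # (c, d) # ab) z" for a b c d
    by (rule hessian_kernel_perm) simp
  have "hessian_kernel (u # v # us) ab z = (\<Sum>a\<in>UNIV. \<Sum>b\<in>UNIV. \<Sum>c\<in>UNIV. \<Sum>d\<in>UNIV.
      2 * \<i> * d_z a (d_zbar b u) z * (2 * \<i> * d_z c (d_zbar d v) z * hessian_kernel us ((c, d) # (a, b) # ab) z))"
    by (simp add: sum_distrib_left)
  also have "\<dots> = (\<Sum>c\<in>UNIV. \<Sum>d\<in>UNIV. \<Sum>a\<in>UNIV. \<Sum>b\<in>UNIV. 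
      2 * \<i> * d_z a (d_zbar b u) z * (2 * \<i> * d_z c (d_zbar d v) z * hessian_kernel us ((c, d) # (a, b) # ab) z))"
    by (rule sum_swap_pairs)
  also have "\<dots> = (\<Sum>c\<in>UNIV. \<Sum>d\<in>UNIV. \<Sum>a\<in>UNIV. \<Sum>b\<in>UNIV. 
      2 * \<i> * d_z c (d_zbar d v) z * (2 * \<i> * d_z a (d_zbar b u) z * hessian_kernel us ((a, b) # (c, d) # ab) z))"
    by (intro sum.cong refl) (simp add: p mult_ac)
  also have "\<dots> = hessian_kernel (v # u # us) ab z" by (simp add: sum_distrib_left)
  finally show ?thesis .
qed

text \<open>Adjacent exchanges bring each factor to its place. The independence of the order for
  non-smooth factors, in \<open>ddc_product_mset\<close>, is a limit of this identity.\<close>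

lemma hessian_kernel_mset: "mset us = mset vs \<Longrightarrow> hessian_kernel us ab z = hessian_kernel vs ab z"
proof (induction us arbitrary: vs ab)
  case Nil
  then show ?case by simp
next
  case (Cons u us)
  obtain xs ys where vs: "vs = xs @ u # ys"
    using mset_eq_setD[OF Cons.prems] split_list[of u vs] by auto
  have front: "hessian_kernel (xs @ u # ys) ab z = hessian_kernel (u # xs @ ys) ab z" for xs ab
  proof (induction xs arbitrary: ab)
    case (Cons x xs)
    have "hessian_kernel ((x # xs) @ u # ys) ab z = hessian_kernel (x # u # xs @ ys) ab z" using Cons.IH by simp
    then show ?case using hessian_kernel_commute by simp
  qed simp
  have "hessian_kernel us ab z = hessian_kernel (xs @ ys) ab z" for ab
    using Cons.prems vs by (intro Cons.IH) simp
  then show ?case unfolding vs front by simp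
qed

lemma smooth_hessian_kernel: "(\<And>u. u \<in> set us \<Longrightarrow> smooth u) \<Longrightarrow> smooth (hessian_kernel us ab)"
proof (induction us arbitrary: ab)
  case Nil
  have "hessian_kernel [] ab = (\<lambda>z. sign_kernel ab)" by (rule ext) simp
  then show ?case by (simp add: smooth_const)
next
  case (Cons u us)
  have "smooth (\<lambda>z. \<Sum>a\<in>UNIV. \<Sum>b\<in>UNIV. 2 * \<i> * d_z a (d_zbar b u) z * hessian_kernel us ((a, b) # ab) z)"
    using Cons by (intro smooth_sum smooth_mult smooth_const smooth_d_z smooth_d_zbar Cons.IH) auto
  then show ?case by (simp add: hessian_kernel.simps(2)[abs_def])
qed

section \<open>Closedness of the coefficients and integration by parts\<close>

lemma sum_antisym_0:
  fixes f :: "'n::finite \<Rightarrow> 'n \<Rightarrow> complex"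
  assumes "\<And>a c. f a c = - f c a" shows "(\<Sum>a\<in>UNIV. \<Sum>c\<in>UNIV. f a c) = 0"
proof -
  have "(\<Sum>a\<in>UNIV. \<Sum>c\<in>UNIV. f a c) = (\<Sum>c\<in>UNIV. \<Sum>a\<in>UNIV. f a c)" by (rule sum.swap)
  also have "\<dots> = (\<Sum>c\<in>UNIV. \<Sum>a\<in>UNIV. - f c a)" by (intro sum.cong refl assms)
  also have "\<dots> = - (\<Sum>a\<in>UNIV. \<Sum>c\<in>UNIV. f a c)" by (simp add: sum_negf)
  finally show ?thesis by simp
qed

text \<open>Where the derivative falls on the Hessian, holomorphic derivatives commute while the
  kernel changes sign under the exchange of \<open>a\<close> and \<open>c\<close>, so the sum over
  both cancels. Where it falls on the kernel, induction applies.\<close>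

lemma hessian_kernel_closed:
  assumes "\<And>u. u \<in> set us \<Longrightarrow> smooth u"
  shows "(\<Sum>a\<in>UNIV. d_z a (hessian_kernel us ((a, b) # ab)) z) = 0"
  using assms
proof (induction us arbitrary: ab)
  case Nil
  have "hessian_kernel [] ab = (\<lambda>z. sign_kernel ab)" for ab by (rule ext) simp
  then show ?case by simp
next
  case (Cons u us)
  have s: "smooth u" "\<And>ab. smooth (hessian_kernel us ab)" using Cons.prems by (auto intro!: smooth_hessian_kernel)
  let ?H = "\<lambda>c d. d_z c (d_zbar d u)"
  have "d_z a (hessian_kernel (u # us) ((a, b) # ab)) z = (\<Sum>c\<in>UNIV. \<Sum>d\<in>UNIV.
      2 * \<i> * (?H c d z * d_z a (hessian_kernel us ((c, d) # (a, b) # ab)) z) +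
      2 * \<i> * (d_z a (?H c d) z * hessian_kernel us ((c, d) # (a, b) # ab) z))" for a
  proof -
    define P where "P c d z = 2 * \<i> * (?H c d z * hessian_kernel us ((c, d) # (a, b) # ab) z)" for c d z
    have "hessian_kernel (u # us) ((a, b) # ab) = (\<lambda>z. \<Sum>c\<in>UNIV. \<Sum>d\<in>UNIV. 2 * \<i> * (?H c d z * hessian_kernel us ((c, d) # (a, b) # ab) z))"
      by (rule ext) (simp add: mult.assoc)
    then have e: "hessian_kernel (u # us) ((a, b) # ab) = (\<lambda>z. \<Sum>c\<in>UNIV. \<Sum>d\<in>UNIV. P c d z)"
      by (simp only: P_def)
    have sm: "smooth (P c d)" for c d
      unfolding P_def[abs_def] by (intro smooth_mult smooth_const smooth_d_z smooth_d_zbar s)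
    have "d_z a (P c d) z = 2 * \<i> * (?H c d z * d_z a (hessian_kernel us ((c, d) # (a, b) # ab)) z) +
        2 * \<i> * (d_z a (?H c d) z * hessian_kernel us ((c, d) # (a, b) # ab) z)" for c d
      unfolding P_def[abs_def]
      by (subst d_z_cmult, intro smooth_mult smooth_d_z smooth_d_zbar s, subst d_z_mult,
          intro smooth_d_z smooth_d_zbar s, rule s, rule distrib_left)
    then show ?thesis unfolding e by (simp add: d_z_sum sm smooth_sum)
  qed
  then have "(\<Sum>a\<in>UNIV. d_z a (hessian_kernel (u # us) ((a, b) # ab)) z) =
     (\<Sum>a\<in>UNIV. \<Sum>c\<in>UNIV. \<Sum>d\<in>UNIV. 2 * \<i> * (?H c d z * d_z a (hessian_kernel us ((c, d) # (a, b) # ab)) z)) +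
     (\<Sum>a\<in>UNIV. \<Sum>c\<in>UNIV. \<Sum>d\<in>UNIV. 2 * \<i> * (d_z a (?H c d) z * hessian_kernel us ((c, d) # (a, b) # ab) z))"
    by (simp only: sum.distrib)
  also have "(\<Sum>a\<in>UNIV. \<Sum>c\<in>UNIV. \<Sum>d\<in>UNIV. 2 * \<i> * (d_z a (?H c d) z * hessian_kernel us ((c, d) # (a, b) # ab) z)) = 0"
  proof (rule sum_antisym_0)
    fix a c
    show "(\<Sum>d\<in>UNIV. 2 * \<i> * (d_z a (?H c d) z * hessian_kernel us ((c, d) # (a, b) # ab) z)) =
       - (\<Sum>d\<in>UNIV. 2 * \<i> * (d_z c (?H a d) z * hessian_kernel us ((a, d) # (c, b) # ab) z))"
      using s d_z_commute[OF smooth_d_zbar[OF s(1)], of a c] hessian_kernel_swap[of us c _ a b ab z]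
      by (simp flip: sum_negf)
  qed
  also have "(\<Sum>a\<in>UNIV. \<Sum>c\<in>UNIV. \<Sum>d\<in>UNIV. 2 * \<i> * (?H c d z * d_z a (hessian_kernel us ((c, d) # (a, b) # ab)) z))
     = (\<Sum>c\<in>UNIV. \<Sum>d\<in>UNIV. 2 * \<i> * (?H c d z * (\<Sum>a\<in>UNIV. d_z a (hessian_kernel us ((a, b) # (c, d) # ab)) z)))"
  proof -
    have p: "hessian_kernel us ((c, d) # (a, b) # ab) = hessian_kernel us ((a, b) # (c, d) # ab)" for a c d
      by (rule ext, rule hessian_kernel_perm) simp
    have "(\<Sum>a\<in>UNIV. \<Sum>c\<in>UNIV. \<Sum>d\<in>UNIV. 2 * \<i> * (?H c d z * d_z a (hessian_kernel us ((c, d) # (a, b) # ab)) z)) =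
       (\<Sum>c\<in>UNIV. \<Sum>d\<in>UNIV. \<Sum>a\<in>UNIV. 2 * \<i> * (?H c d z * d_z a (hessian_kernel us ((c, d) # (a, b) # ab)) z))"
      by (subst sum.swap) (intro sum.cong refl sum.swap)
    then show ?thesis by (simp add: p sum_distrib_left)
  qed
  also have "\<dots> = 0" using Cons by simp
  finally show ?case by simp
qed

text \<open>The conjugate relation. The Hessian carries its barred derivative inside, so
  \<open>d_zbar\<close> has to be moved past \<open>d_z\<close> before the barred indices
  \<open>b\<close> and \<open>d\<close> can be exchanged.\<close>

lemma hessian_kernel_closed_bar:
  assumes "\<And>u. u \<in> set us \<Longrightarrow> smooth u"
  shows "(\<Sum>b\<in>UNIV. d_zbar b (hessian_kernel us ((a, b) # ab)) z) = 0"
  using assms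
proof (induction us arbitrary: ab)
  case Nil
  have "hessian_kernel [] ab = (\<lambda>z. sign_kernel ab)" for ab by (rule ext) simp
  then show ?case by simp
next
  case (Cons u us)
  have s: "smooth u" "\<And>ab. smooth (hessian_kernel us ab)" using Cons.prems by (auto intro!: smooth_hessian_kernel)
  let ?H = "\<lambda>d c. d_z c (d_zbar d u)"
  have "d_zbar b (hessian_kernel (u # us) ((a, b) # ab)) z = (\<Sum>d\<in>UNIV. \<Sum>c\<in>UNIV.
      2 * \<i> * (?H d c z * d_zbar b (hessian_kernel us ((c, d) # (a, b) # ab)) z) +
      2 * \<i> * (d_zbar b (?H d c) z * hessian_kernel us ((c, d) # (a, b) # ab) z))" for b
  proof -
    define P where "P c d z = 2 * \<i> * (?H d c z * hessian_kernel us ((c, d) # (a, b) # ab) z)" for c d z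
    have "hessian_kernel (u # us) ((a, b) # ab) = (\<lambda>z. \<Sum>d\<in>UNIV. \<Sum>c\<in>UNIV. 2 * \<i> * (?H d c z * hessian_kernel us ((c, d) # (a, b) # ab) z))"
      by (rule ext) (simp only: hessian_kernel.simps mult.assoc, rule sum.swap)
    then have e: "hessian_kernel (u # us) ((a, b) # ab) = (\<lambda>z. \<Sum>d\<in>UNIV. \<Sum>c\<in>UNIV. P c d z)"
      by (simp only: P_def)
    have sm: "smooth (P c d)" for c d
      unfolding P_def[abs_def] by (intro smooth_mult smooth_const smooth_d_z smooth_d_zbar s)
    have "d_zbar b (P c d) z = 2 * \<i> * (?H d c z * d_zbar b (hessian_kernel us ((c, d) # (a, b) # ab)) z) +
        2 * \<i> * (d_zbar b (?H d c) z * hessian_kernel us ((c, d) # (a, b) # ab) z)" for c d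
      unfolding P_def[abs_def]
      by (subst d_zbar_cmult, intro smooth_mult smooth_d_z smooth_d_zbar s, subst d_zbar_mult,
          intro smooth_d_z smooth_d_zbar s, rule s, rule distrib_left)
    then show ?thesis unfolding e by (simp add: d_zbar_sum sm smooth_sum)
  qed
  then have "(\<Sum>b\<in>UNIV. d_zbar b (hessian_kernel (u # us) ((a, b) # ab)) z) =
     (\<Sum>b\<in>UNIV. \<Sum>d\<in>UNIV. \<Sum>c\<in>UNIV. 2 * \<i> * (?H d c z * d_zbar b (hessian_kernel us ((c, d) # (a, b) # ab)) z)) +
     (\<Sum>b\<in>UNIV. \<Sum>d\<in>UNIV. \<Sum>c\<in>UNIV. 2 * \<i> * (d_zbar b (?H d c) z * hessian_kernel us ((c, d) # (a, b) # ab) z))"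
    by (simp only: sum.distrib)
  also have "(\<Sum>b\<in>UNIV. \<Sum>d\<in>UNIV. \<Sum>c\<in>UNIV. 2 * \<i> * (d_zbar b (?H d c) z * hessian_kernel us ((c, d) # (a, b) # ab) z)) = 0"
  proof (rule sum_antisym_0)
    fix b d
    have "d_zbar b (?H d c) z = d_zbar d (?H b c) z" for c
    proof -
      have "d_zbar b (?H d c) z = d_z c (d_zbar b (d_zbar d u)) z"
        using s by (simp add: d_z_d_zbar_commute smooth_d_zbar)
      also have "d_zbar b (d_zbar d u) = d_zbar d (d_zbar b u)"
        using s by (intro ext d_zbar_commute)
      also have "d_z c (d_zbar d (d_zbar b u)) z = d_zbar d (?H b c) z"
        using s by (simp add: d_z_d_zbar_commute smooth_d_zbar)
      finally show ?thesis .
    qed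
    then show "(\<Sum>c\<in>UNIV. 2 * \<i> * (d_zbar b (?H d c) z * hessian_kernel us ((c, d) # (a, b) # ab) z)) =
       - (\<Sum>c\<in>UNIV. 2 * \<i> * (d_zbar d (?H b c) z * hessian_kernel us ((c, b) # (a, d) # ab) z))"
      using hessian_kernel_swap_snd[of us _ d a b ab z]
      by (simp flip: sum_negf)
  qed
  also have "(\<Sum>b\<in>UNIV. \<Sum>d\<in>UNIV. \<Sum>c\<in>UNIV. 2 * \<i> * (?H d c z * d_zbar b (hessian_kernel us ((c, d) # (a, b) # ab)) z))
     = (\<Sum>d\<in>UNIV. \<Sum>c\<in>UNIV. 2 * \<i> * (?H d c z * (\<Sum>b\<in>UNIV. d_zbar b (hessian_kernel us ((a, b) # (c, d) # ab)) z)))"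
  proof -
    have p: "hessian_kernel us ((c, d) # (a, b) # ab) = hessian_kernel us ((a, b) # (c, d) # ab)" for b c d
      by (rule ext, rule hessian_kernel_perm) simp
    have "(\<Sum>b\<in>UNIV. \<Sum>d\<in>UNIV. \<Sum>c\<in>UNIV. 2 * \<i> * (?H d c z * d_zbar b (hessian_kernel us ((c, d) # (a, b) # ab)) z)) =
       (\<Sum>d\<in>UNIV. \<Sum>c\<in>UNIV. \<Sum>b\<in>UNIV. 2 * \<i> * (?H d c z * d_zbar b (hessian_kernel us ((c, d) # (a, b) # ab)) z))"
      by (subst sum.swap) (intro sum.cong refl sum.swap)
    then show ?thesis by (simp add: p sum_distrib_left)
  qed
  also have "\<dots> = 0" using Cons by simp
  finally show ?case by simp
qed

text \<open>In the product rule the terms with a derivative of \<open>k a\<close> add up to the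
  divergence, which is 0; under the sum \<open>k\<close> behaves like a constant
  coefficient.\<close>

lemma divergence_free_by_parts:
  assumes F: "F \<in> Cc_smooth" and k: "\<And>a. smooth (k a)" and g: "smooth g"
    and div: "\<And>z. (\<Sum>a\<in>UNIV. wirtinger c a (k a) z) = 0"
  shows "(\<Sum>a\<in>UNIV. LINT z|lborel. F z * k a z * wirtinger c a g z) = - (\<Sum>a\<in>UNIV. LINT z|lborel. wirtinger c a F z * k a z * g z)"
proof -
  have Fs: "smooth F" "F \<in> Cc" "\<And>a. wirtinger c a F \<in> Cc"
    using F Cc_smooth_wirtinger[OF F] by (auto simp: Cc_smooth_iff)
  have i: "integrable lborel (\<lambda>z. F z * (wirtinger c a (k a) z * g z))" "integrable lborel (\<lambda>z. wirtinger c a F z * k a z * g z)" for a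
    using k g by (auto intro!: Cc_integrable Cc_mult_right Fs smooth_imp_continuous smooth_mult smooth_wirtinger)
  have "(LINT z|lborel. F z * k a z * wirtinger c a g z) =
      - (LINT z|lborel. F z * (wirtinger c a (k a) z * g z)) - (LINT z|lborel. wirtinger c a F z * k a z * g z)" for a
  proof -
    have "(LINT z|lborel. F z * k a z * wirtinger c a g z) = - (LINT z|lborel. wirtinger c a (\<lambda>z. F z * k a z) z * g z)"
      using integration_by_parts[OF Cc_smooth_mult[OF F k] g] by simp
    also have "(\<lambda>z. wirtinger c a (\<lambda>z. F z * k a z) z * g z) = (\<lambda>z. F z * (wirtinger c a (k a) z * g z) + wirtinger c a F z * k a z * g z)"
      by (simp add: wirtinger_mult Fs k algebra_simps)
    also have "(LINT z|lborel. F z * (wirtinger c a (k a) z * g z) + wirtinger c a F z * k a z * g z) =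
       (LINT z|lborel. F z * (wirtinger c a (k a) z * g z)) + (LINT z|lborel. wirtinger c a F z * k a z * g z)"
      by (rule Bochner_Integration.integral_add[OF i])
    finally show ?thesis by simp
  qed
  then have "(\<Sum>a\<in>UNIV. LINT z|lborel. F z * k a z * wirtinger c a g z) =
     - (\<Sum>a\<in>UNIV. LINT z|lborel. F z * (wirtinger c a (k a) z * g z)) - (\<Sum>a\<in>UNIV. LINT z|lborel. wirtinger c a F z * k a z * g z)"
    by (simp add: sum_subtractf sum_negf)
  also have "(\<Sum>a\<in>UNIV. LINT z|lborel. F z * (wirtinger c a (k a) z * g z)) = (LINT z|lborel. (\<Sum>a\<in>UNIV. F z * (wirtinger c a (k a) z * g z)))"
    by (rule Bochner_Integration.integral_sum[symmetric, OF i(1)])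
  also have "(\<lambda>z. \<Sum>a\<in>UNIV. F z * (wirtinger c a (k a) z * g z)) = (\<lambda>z. F z * ((\<Sum>a\<in>UNIV. wirtinger c a (k a) z) * g z))"
    by (simp add: sum_distrib_left sum_distrib_right)
  finally show ?thesis by (simp add: div)
qed

lemmas divergence_free_by_parts_d_z = divergence_free_by_parts[where c="- \<i>", folded d_z_wirtinger]
lemmas divergence_free_by_parts_d_zbar = divergence_free_by_parts[where c="\<i>", folded d_zbar_wirtinger]

text \<open>Two integrations by parts, one for each closedness relation, whose signs cancel. For
  smooth factors this is the defining equation of \<open>ddc_wedge\<close>: multiplying by dd^c u
  means applying dd^c after multiplication by u.\<close>

lemma hessian_kernel_by_parts:
  assumes f: "f \<in> Cc_smooth" and u: "smooth u" and us: "\<And>u. u \<in> set us \<Longrightarrow> smooth u"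
  shows "(LINT z|lborel. f z * hessian_kernel (u # us) ab z) =
    (\<Sum>a\<in>UNIV. \<Sum>b\<in>UNIV. 2 * \<i> * (LINT z|lborel. u z * d_z a (d_zbar b f) z * hessian_kernel us ((a, b) # ab) z))"
proof -
  let ?k = "\<lambda>a b. hessian_kernel us ((a, b) # ab)"
  have k: "smooth (?k a b)" for a b using us by (intro smooth_hessian_kernel)
  have fs: "smooth f" "f \<in> Cc" using f by (auto simp: Cc_smooth_iff)
  have i: "integrable lborel (\<lambda>z. f z * ?k a b z * d_z a (d_zbar b u) z)" for a b
    by (intro Cc_integrable Cc_mult_right fs smooth_imp_continuous smooth_d_z smooth_d_zbar k u)
  have "(LINT z|lborel. f z * hessian_kernel (u # us) ab z) =
     (LINT z|lborel. (\<Sum>a\<in>UNIV. \<Sum>b\<in>UNIV. 2 * \<i> * (f z * ?k a b z * d_z a (d_zbar b u) z)))"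
    by (simp add: sum_distrib_left mult_ac)
  also have "\<dots> = (\<Sum>a\<in>UNIV. \<Sum>b\<in>UNIV. 2 * \<i> * (LINT z|lborel. f z * ?k a b z * d_z a (d_zbar b u) z))"
    by (simp add: i)
  also have "\<dots> = 2 * \<i> * (\<Sum>b\<in>UNIV. \<Sum>a\<in>UNIV. LINT z|lborel. f z * ?k a b z * d_z a (d_zbar b u) z)"
    by (subst sum.swap) (simp add: sum_distrib_left)
  also have "(\<Sum>b\<in>UNIV. \<Sum>a\<in>UNIV. LINT z|lborel. f z * ?k a b z * d_z a (d_zbar b u) z) =
     (\<Sum>b\<in>UNIV. - (\<Sum>a\<in>UNIV. LINT z|lborel. d_z a f z * ?k a b z * d_zbar b u z))"
    by (intro sum.cong refl divergence_free_by_parts_d_z f k smooth_d_zbar u hessian_kernel_closed us)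
  also have "\<dots> = - (\<Sum>a\<in>UNIV. \<Sum>b\<in>UNIV. LINT z|lborel. d_z a f z * ?k a b z * d_zbar b u z)"
    by (subst sum.swap) (simp add: sum_negf)
  also have "(\<Sum>a\<in>UNIV. \<Sum>b\<in>UNIV. LINT z|lborel. d_z a f z * ?k a b z * d_zbar b u z) =
     (\<Sum>a\<in>UNIV. - (\<Sum>b\<in>UNIV. LINT z|lborel. d_zbar b (d_z a f) z * ?k a b z * u z))"
    by (intro sum.cong refl divergence_free_by_parts_d_zbar Cc_smooth_d_z f k u hessian_kernel_closed_bar us)
  also have "- \<dots> = (\<Sum>a\<in>UNIV. \<Sum>b\<in>UNIV. LINT z|lborel. u z * d_z a (d_zbar b f) z * ?k a b z)"
    using d_z_d_zbar_commute[OF fs(1)] by (simp add: sum_negf mult_ac)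
  finally show ?thesis by (simp add: sum_distrib_left)
qed

section \<open>Positivity and approximation\<close>

text \<open>Semidefiniteness as an explicit finite sum of rank-one squares, the form that survives
  contraction of indices.\<close>

definition psd_at :: "(complex ^ 'n \<Rightarrow> complex) \<Rightarrow> complex ^ 'n \<Rightarrow> bool" where
  "psd_at u z \<longleftrightarrow> (\<exists>X. \<forall>a b. d_z a (d_zbar b u) z = (\<Sum>x\<leftarrow>X. x a * cnj (x b)))"

lemma sum_list_product:
  "(\<Sum>p\<leftarrow>List.product xs ys. f (fst p) (snd p)) = (\<Sum>x\<leftarrow>xs. \<Sum>y\<leftarrow>ys. (f x y :: complex))"
  by (induction xs) (auto simp: o_def)

lemma sum_list_swap_sum:
  "(\<Sum>a\<in>A. \<Sum>x\<leftarrow>xs. f a x) = (\<Sum>x\<leftarrow>xs. \<Sum>a\<in>A. (f a x :: complex))"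
  by (induction xs) (auto simp: sum.distrib)

lemma sum_list_mult_distrib:
  "(\<Sum>x\<leftarrow>xs. f x) * (\<Sum>y\<leftarrow>ys. g y) = (\<Sum>x\<leftarrow>xs. \<Sum>y\<leftarrow>ys. (f x * g y :: complex))"
  by (induction xs) (auto simp: distrib_right sum_list_const_mult)

text \<open>Strong positivity: as a kernel in its holomorphic and antiholomorphic indices, the product of
  the complex Hessians is a sum of squares, because the sign kernel is and because contraction with
  a sum of squares preserves this.\<close>

lemma hessian_kernel_sum_of_squares:
  fixes us :: "(complex ^ 'n::finite \<Rightarrow> complex) list"
  assumes "\<And>u. u \<in> set us \<Longrightarrow> psd_at u z"
  shows "\<exists>Y::('n list \<Rightarrow> complex) list. \<forall>as bs. length as = length bs \<longrightarrow>
    hessian_kernel us (zip as bs) z = (2 * \<i>) ^ length us * (- 2 * \<i>) ^ CARD('n) * (\<Sum>y\<leftarrow>Y. y as * cnj (y bs))"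
  using assms
proof (induction us)
  case Nil
  obtain e :: "'n list \<Rightarrow> real" where
    e: "\<And>as bs. length as = length bs \<Longrightarrow> sign_kernel (zip as bs) = (- 2 * \<i>) ^ CARD('n) * of_real (e as * e bs)"
    using sign_kernel_rank_one by blast
  show ?case
    by (rule exI[of _ "[\<lambda>as. of_real (e as)]"]) (simp add: e)
next
  case (Cons u us)
  have "\<exists>Y::('n list \<Rightarrow> complex) list. \<forall>as bs. length as = length bs \<longrightarrow>
    hessian_kernel us (zip as bs) z = (2 * \<i>) ^ length us * (- 2 * \<i>) ^ CARD('n) * (\<Sum>y\<leftarrow>Y. y as * cnj (y bs))"
    by (rule Cons.IH) (simp add: Cons.prems)
  then obtain Y :: "('n list \<Rightarrow> complex) list" where Y: "\<And>as bs. length as = length bs \<Longrightarrow>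
    hessian_kernel us (zip as bs) z = (2 * \<i>) ^ length us * (- 2 * \<i>) ^ CARD('n) * (\<Sum>y\<leftarrow>Y. y as * cnj (y bs))"
    by blast
  obtain X where X: "\<And>a b. d_z a (d_zbar b u) z = (\<Sum>x\<leftarrow>X. x a * cnj (x b))"
    using Cons.prems[of u] unfolding psd_at_def by auto
  let ?C = "(2 * \<i>) ^ length us * (- 2 * \<i>) ^ CARD('n)"
  let ?W = "\<lambda>x y as. \<Sum>a\<in>UNIV. x a * y (a # as)"
  have "hessian_kernel (u # us) (zip as bs) z = (2 * \<i>) ^ length (u # us) * (- 2 * \<i>) ^ CARD('n) *
      (\<Sum>w\<leftarrow>map (\<lambda>p. ?W (fst p) (snd p)) (List.product X Y). w as * cnj (w bs))"
    if l: "length as = length bs" for as bs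
  proof -
    have k: "hessian_kernel us ((a, b) # zip as bs) z = ?C * (\<Sum>y\<leftarrow>Y. y (a # as) * cnj (y (b # bs)))" for a b
      using Y[of "a # as" "b # bs"] l by simp
    have "hessian_kernel (u # us) (zip as bs) z =
      (\<Sum>a\<in>UNIV. \<Sum>b\<in>UNIV. 2 * \<i> * (\<Sum>x\<leftarrow>X. x a * cnj (x b)) * (?C * (\<Sum>y\<leftarrow>Y. y (a # as) * cnj (y (b # bs)))))"
      by (simp add: k X)
    also have "\<dots> = 2 * \<i> * ?C * (\<Sum>a\<in>UNIV. \<Sum>b\<in>UNIV. (\<Sum>x\<leftarrow>X. x a * cnj (x b)) * (\<Sum>y\<leftarrow>Y. y (a # as) * cnj (y (b # bs))))"
      by (simp only: sum_distrib_left) (intro sum.cong refl, simp only: mult_ac)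
    also have "(\<Sum>a\<in>UNIV. \<Sum>b\<in>UNIV. (\<Sum>x\<leftarrow>X. x a * cnj (x b)) * (\<Sum>y\<leftarrow>Y. y (a # as) * cnj (y (b # bs)))) =
       (\<Sum>a\<in>UNIV. \<Sum>b\<in>UNIV. \<Sum>p\<leftarrow>List.product X Y. (fst p a * snd p (a # as)) * cnj (fst p b * snd p (b # bs)))"
    proof (intro sum.cong refl)
      fix a b
      have "(\<Sum>x\<leftarrow>X. x a * cnj (x b)) * (\<Sum>y\<leftarrow>Y. y (a # as) * cnj (y (b # bs))) =
        (\<Sum>x\<leftarrow>X. \<Sum>y\<leftarrow>Y. (x a * y (a # as)) * cnj (x b * y (b # bs)))"
        by (simp add: sum_list_mult_distrib mult_ac)
      also have "\<dots> = (\<Sum>p\<leftarrow>List.product X Y. (fst p a * snd p (a # as)) * cnj (fst p b * snd p (b # bs)))"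
        by (rule sum_list_product[symmetric])
      finally show "(\<Sum>x\<leftarrow>X. x a * cnj (x b)) * (\<Sum>y\<leftarrow>Y. y (a # as) * cnj (y (b # bs))) = \<dots>" .
    qed
    also have "\<dots> = (\<Sum>p\<leftarrow>List.product X Y. ?W (fst p) (snd p) as * cnj (?W (fst p) (snd p) bs))"
      unfolding sum_list_swap_sum by (simp add: sum_product)
    finally show ?thesis by (simp add: o_def mult_ac)
  qed
  then show ?case by blast
qed

text \<open>A sum of squares is dominated by its diagonal, since a product of two moduli is at most
  the sum of their squares. Mass bounds are thus needed for diagonal coefficients only, and these
  have a phase independent of the point.\<close>

lemma hessian_kernel_diagonal:
  assumes "\<And>u. u \<in> set us \<Longrightarrow> psd_at u z"
  obtains t :: "'n::finite list \<Rightarrow> real" where "\<And>as. 0 \<le> t as"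
    "\<And>as. hessian_kernel us (zip as as) z = (2 * \<i>) ^ length us * (- 2 * \<i>) ^ CARD('n) * of_real (t as)"
    "\<And>as bs. length as = length bs \<Longrightarrow> cmod (hessian_kernel us (zip as bs) z) \<le> 2 ^ length us * 2 ^ CARD('n) * (t as + t bs)"
proof -
  obtain Y :: "('n list \<Rightarrow> complex) list" where Y: "\<And>as bs. length as = length bs \<Longrightarrow>
    hessian_kernel us (zip as bs) z = (2 * \<i>) ^ length us * (- 2 * \<i>) ^ CARD('n) * (\<Sum>y\<leftarrow>Y. y as * cnj (y bs))"
    using hessian_kernel_sum_of_squares[OF assms] by blast
  define t where "t as = (\<Sum>y\<leftarrow>Y. (cmod (y as))\<^sup>2)" for as
  have 1: "0 \<le> t as" for as unfolding t_def by (intro sum_list_nonneg) auto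
  have 2: "(\<Sum>y\<leftarrow>Y. y as * cnj (y as)) = of_real (t as)" for as
    unfolding t_def by (induction Y) (auto simp: complex_norm_square simp del: of_real_power)
  have 3: "cmod (\<Sum>y\<leftarrow>Y. y as * cnj (y bs)) \<le> t as + t bs" for as bs
    unfolding t_def
  proof (induction Y)
    case (Cons y Y)
    have "cmod (y as * cnj (y bs)) \<le> (cmod (y as))\<^sup>2 + (cmod (y bs))\<^sup>2"
      unfolding norm_mult complex_mod_cnj
      using sum_squares_bound[of "cmod (y as)" "cmod (y bs)"] mult_nonneg_nonneg[OF norm_ge_zero[of "y as"] norm_ge_zero[of "y bs"]]
      by linarith
    then show ?case
      using Cons norm_triangle_ineq[of "y as * cnj (y bs)" "\<Sum>y\<leftarrow>Y. y as * cnj (y bs)"] by simp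
  qed simp
  have "cmod (hessian_kernel us (zip as bs) z) \<le> 2 ^ length us * 2 ^ CARD('n) * (t as + t bs)" if "length as = length bs" for as bs
    unfolding Y[OF that] norm_mult norm_power using 3[of as bs] by simp
  then show ?thesis using that[OF 1] Y 2 by simp
qed

text \<open>The weight \<open>1 + norm z\<close> fits support functions: replacing a body by a
  finite net changes them by a multiple of \<open>norm z\<close>, and the soft maximum adds a
  constant.\<close>

definition approximates :: "(nat \<Rightarrow> complex ^ 'n \<Rightarrow> complex) \<Rightarrow> (complex ^ 'n \<Rightarrow> real) \<Rightarrow> bool" where
  "approximates U u \<longleftrightarrow> (\<forall>j. smooth (U j)) \<and> (\<forall>j z. psd_at (U j) z) \<and>
     (\<forall>j z. cmod (U j z - of_real (u z)) \<le> (1 + norm z) / (real j + 1))"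

lemma approximates_norm_squared: "approximates (\<lambda>j z. of_real ((norm z)\<^sup>2)) (\<lambda>z. (norm z)\<^sup>2)"
proof -
  have e: "(\<lambda>z::complex^'n. complex_of_real ((norm z)\<^sup>2)) = (\<lambda>z. of_real ((\<lambda>x. 1 * x + 0) (1 * (z \<bullet> z) + 0)))"
    by (simp add: dot_square_norm)
  have d: "((\<lambda>x. 1 * x + 0) has_real_derivative (\<lambda>x. 0 * x + 1) x) (at x)"
    "((\<lambda>x. 0 * x + 1) has_real_derivative (\<lambda>x. 0) x) (at x)" for x :: real
    by (auto intro!: derivative_eq_intros)
  have s: "smooth (\<lambda>z::complex^'n. complex_of_real ((norm z)\<^sup>2))"
    unfolding e by (rule smooth_radial) (rule Cr_affine)
  have h: "d_z a (d_zbar b (\<lambda>z::complex^'n. complex_of_real ((norm z)\<^sup>2))) z = (if a = b then 1 else 0)" for a b z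
    unfolding e by (subst hessian_radial[OF d Cr_affine]) simp
  have "psd_at (\<lambda>z. complex_of_real ((norm z)\<^sup>2)) z" for z :: "complex ^ 'n"
  proof -
    obtain es :: "'n list" where es: "distinct es" "set es = UNIV"
      using finite_distinct_list[OF finite[of "UNIV :: 'n set"]] by blast
    \<comment> \<open>The identity matrix is the sum of the squares of the coordinate
      vectors.\<close>
    have "(\<Sum>x\<leftarrow>map (\<lambda>c a. if a = c then 1 else 0) es. x a * cnj (x b)) = (if a = b then 1 else (0::complex))" for a b
    proof -
      have "(\<Sum>x\<leftarrow>map (\<lambda>c a. if a = c then 1 else 0) es. x a * cnj (x b)) =
        (\<Sum>c\<in>UNIV. (if a = c then 1 else 0) * cnj (if b = c then 1 else 0) :: complex)"
        using es by (simp add: o_def sum_list_distinct_conv_sum_set)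
      also have "\<dots> = (\<Sum>c\<in>UNIV. if a = c then (if b = a then 1 else 0) else 0)"
        by (intro sum.cong) auto
      finally show ?thesis by auto
    qed
    then show ?thesis unfolding psd_at_def h
      by (intro exI[of _ "map (\<lambda>c a. if a = c then 1 else 0) es"] allI) (rule sym)
  qed
  then show ?thesis using s by (auto simp: approximates_def)
qed

lemma approximates_continuous:
  assumes "approximates U u" shows "continuous_on UNIV u"
proof -
  have "isCont u z" for z
  proof -
    have "uniform_limit (ball 0 (norm z + 1)) U (\<lambda>z. of_real (u z)) sequentially"
    proof (rule uniform_limitI)
      fix e :: real assume e: "e > 0"
      obtain N :: nat where N: "(norm z + 2) / e < real N" using reals_Archimedean2 by blast
      have "dist (U j w) (complex_of_real (u w)) < e" if "j \<ge> N" "w \<in> ball 0 (norm z + 1)" for j w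
      proof -
        have "dist (U j w) (complex_of_real (u w)) \<le> (1 + norm w) / (real j + 1)"
          using assms by (simp add: approximates_def dist_norm)
        also have "\<dots> \<le> (norm z + 2) / (real j + 1)"
          using that(2) by (intro divide_right_mono) auto
        also have "\<dots> < e"
        proof -
          have "norm z + 2 < e * real N" using N e by (simp add: field_simps)
          also have "\<dots> \<le> e * (real j + 1)" using that(1) e by (intro mult_left_mono) auto
          finally show ?thesis by (simp add: pos_divide_less_eq add_nonneg_pos mult.commute)
        qed
        finally show ?thesis .
      qed
      then show "\<forall>\<^sub>F n in sequentially. \<forall>x\<in>ball 0 (norm z + 1). dist (U n x) (complex_of_real (u x)) < e"
        by (intro eventually_sequentiallyI[of N]) blast
    qed
    then have "continuous_on (ball 0 (norm z + 1)) (\<lambda>z. complex_of_real (u z))"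
      by (rule uniform_limit_theorem[rotated])
         (use assms in \<open>auto simp: approximates_def intro!: always_eventually smooth_imp_continuous\<close>)
    then have "continuous_on (ball 0 (norm z + 1)) (\<lambda>z. Re (complex_of_real (u z)))"
      by (rule continuous_on_Re)
    then show ?thesis by (auto simp: continuous_on_eq_continuous_at)
  qed
  then show ?thesis by (simp add: continuous_at_imp_continuous_on)
qed

section \<open>Support functions as limits of soft maxima\<close>

lemma Re_hermitian: "Re (hermitian z w) = z \<bullet> w"
  by (simp add: hermitian_def inner_vec_def inner_complex_def)

lemma support_fun_inner: "support_fun A z = (SUP v\<in>A. z \<bullet> v)"
  by (simp add: support_fun_def Re_hermitian)

lemma support_fun_ball: "support_fun (cball 0 1) z = norm z"
proof -
  have "(SUP v\<in>cball 0 1. z \<bullet> v) = norm z"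
  proof (rule cSup_eq_maximum)
    have "z \<bullet> sgn z = norm z"
      by (cases "z = 0") (auto simp: sgn_div_norm dot_square_norm power2_eq_square)
    moreover have "sgn z \<in> cball 0 1" by (simp add: norm_sgn)
    ultimately show "norm z \<in> (\<lambda>v. z \<bullet> v) ` cball 0 1" by (metis image_eqI)
    fix x assume "x \<in> (\<lambda>v. z \<bullet> v) ` cball 0 1"
    then obtain v where v: "norm v \<le> 1" "x = z \<bullet> v" by auto
    have "z \<bullet> v \<le> norm z * norm v" by (rule norm_cauchy_schwarz)
    also have "\<dots> \<le> norm z" using v by (simp add: mult_left_le)
    finally show "x \<le> norm z" using v by simp
  qed
  then show ?thesis by (simp add: support_fun_inner)
qed

lemma d_z_inverse:
  assumes "smooth f" "\<And>z. f z \<noteq> 0"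
  shows "d_z a (\<lambda>z. inverse (f z)) z = - (inverse (f z) * d_z a f z * inverse (f z))"
proof -
  have "((\<lambda>z. inverse (f z)) has_derivative (\<lambda>v. - (inverse (f z) * frechet_derivative f (at z) v * inverse (f z)))) (at z)"
    by (rule Deriv.has_derivative_inverse[OF assms(2) smooth_imp_has_derivative[OF assms(1)]])
  note d = d_z_eqI[OF this]
  have "(- (I * x * I) - \<i> * - (I * y * I)) / 2 = - (I * ((x - \<i> * y) / 2) * I)" for I x y :: complex
    by (simp add: field_simps)
  then show ?thesis unfolding d d_z_def[of a f] by (simp only:)
qed

lemma axis_inner_complex:
  fixes v :: "complex ^ 'n"
  shows "axis a 1 \<bullet> v = Re (v $ a)" "axis a \<i> \<bullet> v = Im (v $ a)"
  unfolding inner_commute[of "axis a 1" v] inner_commute[of "axis a \<i>" v] by (rule inner_axis_complex)+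

context
  fixes F :: "(complex ^ 'n) set" and p :: real
  assumes F: "finite F" "F \<noteq> {}" and p: "p > 0"
begin

definition exp_inner :: "complex ^ 'n \<Rightarrow> complex ^ 'n \<Rightarrow> complex" where
  "exp_inner v z = exp (of_real (p * (z \<bullet> v)))"

text \<open>The soft maximum of the linear forms \<open>z \<bullet> v\<close>, of sharpness
  \<open>p\<close>. It is complex-valued to fit the calculus above; the argument of
  \<open>Ln\<close> is real and positive.\<close>

definition log_sum_exp :: "complex ^ 'n \<Rightarrow> complex" where
  "log_sum_exp z = of_real (1 / p) * Ln (\<Sum>v\<in>F. exp_inner v z)"

lemma bounded_linear_exponent: "bounded_linear (\<lambda>z. complex_of_real (p * (z \<bullet> v)))"
  by (intro bounded_linear_compose[OF bounded_linear_of_real]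
      bounded_linear_compose[OF bounded_linear_mult_right] bounded_linear_inner_left)

lemma exp_inner_eq: "exp_inner v z = of_real (exp (p * (z \<bullet> v)))"
  by (simp only: exp_inner_def exp_of_real)

lemma smooth_exp_inner: "smooth (exp_inner v)"
  unfolding exp_inner_def[abs_def] by (intro smooth_exp smooth_bounded_linear bounded_linear_exponent)

lemma exp_inner_has_derivative: "(exp_inner v has_derivative (\<lambda>w. of_real (p * (w \<bullet> v)) * exp_inner v z)) (at z)"
proof -
  have "(exp has_derivative (*) (exp (complex_of_real (p * (z \<bullet> v))))) (at (complex_of_real (p * (z \<bullet> v))))"
    using DERIV_exp unfolding has_field_derivative_def .
  from has_derivative_compose[OF bounded_linear_imp_has_derivative[OF bounded_linear_exponent] this]
  show ?thesis by (simp only: exp_inner_def[abs_def] mult.commute)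
qed

lemma d_z_exp_inner: "d_z a (exp_inner v) z = of_real (p / 2) * cnj (v $ a) * exp_inner v z"
  unfolding d_z_eqI[OF exp_inner_has_derivative] exp_inner_eq
  by (simp add: axis_inner_complex complex_eq_iff)

lemma d_zbar_exp_inner: "d_zbar a (exp_inner v) z = of_real (p / 2) * v $ a * exp_inner v z"
  unfolding d_zbar_eqI[OF exp_inner_has_derivative] exp_inner_eq
  by (simp add: axis_inner_complex complex_eq_iff)

definition exp_sum :: "complex ^ 'n \<Rightarrow> complex" where "exp_sum z = (\<Sum>v\<in>F. exp_inner v z)"

lemma exp_sum_eq: "exp_sum z = of_real (\<Sum>v\<in>F. exp (p * (z \<bullet> v)))" by (simp add: exp_sum_def exp_inner_eq)

lemma exp_sum_pos: "(\<Sum>v\<in>F. exp (p * (z \<bullet> v))) > 0"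
  using F by (intro sum_pos) auto

lemma Re_exp_sum: "Re (exp_sum z) > 0" using exp_sum_pos by (simp add: exp_sum_eq)

lemma exp_sum_nz: "exp_sum z \<noteq> 0" using Re_exp_sum[of z] by auto

lemma smooth_exp_sum: "smooth exp_sum" unfolding exp_sum_def[abs_def] by (intro smooth_sum smooth_exp_inner)

lemma smooth_log_sum_exp: "smooth log_sum_exp"
  unfolding log_sum_exp_def[abs_def] exp_sum_def[symmetric]
  by (rule smooth_mult[OF smooth_const smooth_Ln[OF smooth_exp_sum Re_exp_sum]])

lemma d_zbar_log_sum_exp:
  "d_zbar b log_sum_exp z = (\<Sum>v\<in>F. (1/2 * v $ b) * exp_inner v z) * inverse (exp_sum z)"
proof -
  have Ln: "((\<lambda>z. Ln (exp_sum z)) has_derivative (\<lambda>w. frechet_derivative exp_sum (at z) w * inverse (exp_sum z))) (at z)"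
    by (rule has_derivative_Ln[OF smooth_imp_has_derivative[OF smooth_exp_sum] Re_exp_sum])
  have "d_zbar b log_sum_exp z = of_real (1 / p) * d_zbar b (\<lambda>z. Ln (exp_sum z)) z"
    unfolding log_sum_exp_def[abs_def] exp_sum_def[symmetric]
    by (rule d_zbar_cmult[OF smooth_Ln[OF smooth_exp_sum Re_exp_sum]])
  also have "d_zbar b (\<lambda>z. Ln (exp_sum z)) z = d_zbar b exp_sum z * inverse (exp_sum z)"
    by (simp only: d_zbar_eqI[OF Ln] d_zbar_def[of b exp_sum] times_divide_eq_left distrib_right mult.assoc)
  also have "d_zbar b exp_sum z = (\<Sum>v\<in>F. of_real (p / 2) * v $ b * exp_inner v z)"
    unfolding exp_sum_def[abs_def] by (simp add: d_zbar_sum smooth_exp_inner d_zbar_exp_inner)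
  also have "of_real (1 / p) * ((\<Sum>v\<in>F. of_real (p / 2) * v $ b * exp_inner v z) * inverse (exp_sum z)) =
     (\<Sum>v\<in>F. (1/2 * v $ b) * exp_inner v z) * inverse (exp_sum z)"
  proof -
    have "(\<Sum>v\<in>F. of_real (p / 2) * v $ b * exp_inner v z) = of_real p * (\<Sum>v\<in>F. (1/2 * v $ b) * exp_inner v z)"
      by (simp only: sum_distrib_left) (rule sum.cong[OF refl], simp)
    then show ?thesis using p by simp
  qed
  finally show ?thesis .
qed

text \<open>A covariance matrix for the Gibbs weights \<open>w\<close> with mean \<open>m\<close>.
  Each Wirtinger derivative of \<open>p * (z \<bullet> v)\<close> contributes a factor
  \<open>p / 2\<close>, and the prefactor \<open>1 / p\<close> leaves \<open>p / 4\<close>.\<close>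

lemma hessian_log_sum_exp:
  fixes z
  defines "w \<equiv> \<lambda>v. exp_inner v z * inverse (exp_sum z)"
  defines "m \<equiv> \<lambda>a. \<Sum>v\<in>F. w v * v $ a"
  shows "d_z a (d_zbar b log_sum_exp) z = (\<Sum>v\<in>F. of_real (p / 4) * w v * cnj (v $ a - m a) * (v $ b - m b))"
proof -
  have m: "m a = (\<Sum>v\<in>F. w v * v $ a)" for a by (simp add: m_def)
  have w1: "(\<Sum>v\<in>F. w v) = 1"
    unfolding w_def sum_distrib_right[symmetric] exp_sum_def[symmetric] using exp_sum_nz by simp
  have wr: "cnj (w v) = w v" for v by (simp add: w_def exp_inner_eq exp_sum_eq)
  have cm: "cnj (m a) = (\<Sum>v\<in>F. w v * cnj (v $ a))" by (simp add: m_def wr)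
  have s: "smooth (\<lambda>z. (1/2 * v $ b) * exp_inner v z)" for v by (intro smooth_mult smooth_const smooth_exp_inner)
  have dt: "d_z a exp_sum z = (\<Sum>v\<in>F. of_real (p / 2) * cnj (v $ a) * exp_inner v z)"
    unfolding exp_sum_def[abs_def] by (simp add: d_z_sum smooth_exp_inner d_z_exp_inner)
  have i: "d_z a (\<lambda>z. inverse (exp_sum z)) z = - (of_real (p / 2) * cnj (m a)) * inverse (exp_sum z)"
    unfolding d_z_inverse[OF smooth_exp_sum exp_sum_nz] dt cm w_def
    by (simp add: sum_distrib_left sum_distrib_right mult_ac)
  have "d_zbar b log_sum_exp = (\<lambda>z. (\<Sum>v\<in>F. (1/2 * v $ b) * exp_inner v z) * inverse (exp_sum z))"
    by (rule ext) (rule d_zbar_log_sum_exp)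
  then have "d_z a (d_zbar b log_sum_exp) z =
      (\<Sum>v\<in>F. (1/2 * v $ b) * exp_inner v z) * (- (of_real (p / 2) * cnj (m a)) * inverse (exp_sum z)) +
      (\<Sum>v\<in>F. (1/2 * v $ b) * (of_real (p / 2) * cnj (v $ a) * exp_inner v z)) * inverse (exp_sum z)"
    by (simp only: d_z_mult[OF smooth_sum smooth_inverse, OF s smooth_exp_sum exp_sum_nz] i
        d_z_sum[OF s] d_z_cmult[OF smooth_exp_inner] d_z_exp_inner)
  also have "(\<Sum>v\<in>F. (1/2 * v $ b) * exp_inner v z) * (- (of_real (p / 2) * cnj (m a)) * inverse (exp_sum z)) =
      - of_real (p / 4) * cnj (m a) * m b"
    unfolding m[of b] w_def
    by (simp only: sum_distrib_left sum_distrib_right) (rule sum.cong[OF refl], simp add: mult_ac)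
  also have "(\<Sum>v\<in>F. (1/2 * v $ b) * (of_real (p / 2) * cnj (v $ a) * exp_inner v z)) * inverse (exp_sum z) =
      of_real (p / 4) * (\<Sum>v\<in>F. w v * cnj (v $ a) * v $ b)"
    unfolding w_def
    by (simp only: sum_distrib_left sum_distrib_right) (rule sum.cong[OF refl], simp add: mult_ac)
  also have "- of_real (p / 4) * cnj (m a) * m b + of_real (p / 4) * (\<Sum>v\<in>F. w v * cnj (v $ a) * v $ b) =
     of_real (p / 4) * (\<Sum>v\<in>F. w v * cnj (v $ a - m a) * (v $ b - m b))"
  proof -
    have "(\<Sum>v\<in>F. w v * cnj (v $ a - m a) * (v $ b - m b)) =
       (\<Sum>v\<in>F. w v * cnj (v $ a) * v $ b - w v * cnj (v $ a) * m b - cnj (m a) * (w v * v $ b) + cnj (m a) * m b * w v)"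
      by (rule sum.cong[OF refl]) (simp add: algebra_simps)
    also have "\<dots> = (\<Sum>v\<in>F. w v * cnj (v $ a) * v $ b) - (\<Sum>v\<in>F. w v * cnj (v $ a)) * m b
        - cnj (m a) * (\<Sum>v\<in>F. w v * v $ b) + cnj (m a) * m b * (\<Sum>v\<in>F. w v)"
      by (simp only: sum.distrib sum_subtractf sum_distrib_left sum_distrib_right)
    also have "\<dots> = (\<Sum>v\<in>F. w v * cnj (v $ a) * v $ b) - cnj (m a) * m b"
      unfolding w1 cm[symmetric] m[of b, symmetric] by simp
    finally have e: "(\<Sum>v\<in>F. w v * cnj (v $ a - m a) * (v $ b - m b)) =
       (\<Sum>v\<in>F. w v * cnj (v $ a) * v $ b) - cnj (m a) * m b" .
    show ?thesis unfolding e by (simp add: algebra_simps)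
  qed
  finally show ?thesis by (simp add: sum_distrib_left mult.assoc)
qed

lemma psd_log_sum_exp: "psd_at log_sum_exp z"
proof -
  define w where "w v = exp (p * (z \<bullet> v)) / (\<Sum>v\<in>F. exp (p * (z \<bullet> v)))" for v
  have w: "exp_inner v z * inverse (exp_sum z) = of_real (w v)" for v
    by (simp add: w_def exp_inner_eq exp_sum_eq divide_inverse)
  have w0: "w v \<ge> 0" for v using exp_sum_pos[of z] by (simp add: w_def)
  define m where "m a = (\<Sum>v\<in>F. exp_inner v z * inverse (exp_sum z) * v $ a)" for a
  obtain vs where vs: "distinct vs" "set vs = F" using finite_distinct_list[OF F(1)] by blast
  \<comment> \<open>The square root of \<open>p * w v / 4\<close> times the centred point; it is
    conjugated because in the Hessian the holomorphic index \<open>a\<close> carries the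
    conjugate.\<close>
  define x where "x v a = of_real (sqrt (p * w v) / 2) * cnj (v $ a - m a)" for v a
  have "d_z a (d_zbar b log_sum_exp) z = (\<Sum>y\<leftarrow>map x vs. y a * cnj (y b))" for a b
  proof -
    have "(\<Sum>y\<leftarrow>map x vs. y a * cnj (y b)) = (\<Sum>v\<in>F. x v a * cnj (x v b))"
      using vs by (simp add: o_def sum_list_distinct_conv_sum_set)
    also have "\<dots> = (\<Sum>v\<in>F. of_real (p / 4) * (exp_inner v z * inverse (exp_sum z)) * cnj (v $ a - m a) * (v $ b - m b))"
    proof (intro sum.cong refl)
      fix v
      have "of_real (sqrt (p * w v) / 2) * of_real (sqrt (p * w v) / 2) = complex_of_real (p / 4) * of_real (w v)"
        unfolding of_real_mult[symmetric] using p w0[of v] by (simp add: real_sqrt_mult_self)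
      then show "x v a * cnj (x v b) = of_real (p / 4) * (exp_inner v z * inverse (exp_sum z)) * cnj (v $ a - m a) * (v $ b - m b)"
        unfolding x_def w by (simp add: mult_ac)
    qed
    also have "\<dots> = d_z a (d_zbar b log_sum_exp) z"
      unfolding m_def by (rule hessian_log_sum_exp[symmetric])
    finally show ?thesis by simp
  qed
  then show ?thesis unfolding psd_at_def by blast
qed

text \<open>The exponential sum is at least each of its terms and at most \<open>card F\<close>
  times a bound for the largest one.\<close>

lemma log_sum_exp_bounds:
  obtains x where "log_sum_exp z = of_real x" "\<And>v. v \<in> F \<Longrightarrow> z \<bullet> v \<le> x"
    "\<And>M. (\<And>v. v \<in> F \<Longrightarrow> z \<bullet> v \<le> M) \<Longrightarrow> x \<le> M + ln (card F) / p"
proof -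
  let ?S = "\<Sum>v\<in>F. exp (p * (z \<bullet> v))"
  define x where "x = ln ?S / p"
  have 1: "log_sum_exp z = of_real x"
    unfolding log_sum_exp_def exp_sum_def[symmetric] exp_sum_eq Ln_of_real[OF exp_sum_pos] x_def by simp
  have 2: "z \<bullet> v \<le> x" if "v \<in> F" for v
  proof -
    have "exp (p * (z \<bullet> v)) \<le> ?S" using that F by (intro member_le_sum) auto
    then have "p * (z \<bullet> v) \<le> ln ?S" using exp_sum_pos[of z] by (simp add: ln_ge_iff)
    then show ?thesis using p by (simp add: x_def field_simps)
  qed
  have 3: "x \<le> M + ln (card F) / p" if M: "\<And>v. v \<in> F \<Longrightarrow> z \<bullet> v \<le> M" for M
  proof -
    have c: "real (card F) > 0" using F by (simp add: card_gt_0_iff)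
    have "?S \<le> (\<Sum>v\<in>F. exp (p * M))" using M p by (intro sum_mono) simp
    then have "ln ?S \<le> ln (card F * exp (p * M))" using exp_sum_pos[of z] by (intro ln_mono) (auto simp: c)
    also have "\<dots> = ln (card F) + p * M" using c by (simp add: ln_mult)
    finally show ?thesis using p by (simp add: x_def field_simps)
  qed
  show ?thesis using that 1 2 3 by blast
qed

end

text \<open>Two errors occur: a net of mesh \<open>d\<close> costs \<open>norm z * d\<close>, and
  the soft maximum over the net costs \<open>ln (card F) / p\<close>. The sharpness is chosen after
  the net, so that the second error is at most \<open>d\<close> as well.\<close>

lemma approximates_support_fun:
  fixes A :: "(complex ^ 'n) set"
  assumes A: "compact A" "A \<noteq> {}"
  shows "\<exists>U. approximates U (support_fun A)"
proof -
  obtain R where R: "\<And>v. v \<in> A \<Longrightarrow> norm v \<le> R"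
    using compact_imp_bounded[OF A(1)] by (auto simp: bounded_iff)
  have bdd: "bdd_above ((\<lambda>v. z \<bullet> v) ` A)" for z
  proof (rule bdd_aboveI2)
    fix v assume "v \<in> A"
    then show "z \<bullet> v \<le> norm z * R"
      using norm_cauchy_schwarz[of z v] mult_left_mono[OF R norm_ge_zero[of z]] by fastforce
  qed
  have "\<exists>V. smooth V \<and> (\<forall>z. psd_at V z) \<and> (\<forall>z. cmod (V z - of_real (support_fun A z)) \<le> (1 + norm z) / (real j + 1))" for j
  proof -
    define d where "d = 1 / (real j + 1)"
    have d: "d > 0" by (simp add: d_def)
    obtain F where F: "finite F" "F \<subseteq> A" "A \<subseteq> (\<Union>v\<in>F. ball v d)"
      using seq_compact_imp_totally_bounded[OF compact_imp_seq_compact[OF A(1)], rule_format, OF d] by blast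
    have Fne: "F \<noteq> {}" using F(3) A(2) by auto
    \<comment> \<open>The summand 1 keeps \<open>p\<close> positive for a net with a single point,
      whose logarithm is 0.\<close>
    define p where "p = (1 + ln (card F)) * (real j + 1)"
    have c: "real (card F) \<ge> 1" using F(1) Fne by (simp add: Suc_le_eq card_gt_0_iff)
    have p: "p > 0" using ln_ge_zero[OF c] by (simp add: p_def add_pos_nonneg)
    have cp: "ln (card F) / p \<le> d"
    proof -
      have "ln (card F) / p = ln (card F) / (1 + ln (card F)) * d" by (simp add: p_def d_def)
      also have "\<dots> \<le> 1 * d" using d ln_ge_zero[OF c] by (intro mult_right_mono) auto
      finally show ?thesis by simp
    qed
    let ?V = "log_sum_exp F p"
    have "cmod (?V z - of_real (support_fun A z)) \<le> (1 + norm z) / (real j + 1)" for z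
    proof -
      obtain x where x: "?V z = of_real x" "\<And>v. v \<in> F \<Longrightarrow> z \<bullet> v \<le> x"
        "\<And>M. (\<And>v. v \<in> F \<Longrightarrow> z \<bullet> v \<le> M) \<Longrightarrow> x \<le> M + ln (card F) / p"
        using log_sum_exp_bounds[OF F(1) Fne p] by blast
      have up: "z \<bullet> v \<le> support_fun A z" if "v \<in> F" for v
        unfolding support_fun_inner using that F(2) by (intro cSUP_upper bdd) auto
      have 1: "x \<le> support_fun A z + d" using x(3)[OF up] cp by linarith
      have 2: "support_fun A z \<le> x + norm z * d"
        unfolding support_fun_inner
      proof (rule cSUP_least[OF A(2)])
        fix v assume "v \<in> A"
        then obtain w where w: "w \<in> F" "dist w v < d" using F(3) by auto
        have "z \<bullet> v = z \<bullet> w + z \<bullet> (v - w)" by (simp add: inner_diff_right)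
        also have "z \<bullet> (v - w) \<le> norm z * norm (v - w)" by (rule norm_cauchy_schwarz)
        also have "\<dots> \<le> norm z * d" using w(2) by (intro mult_left_mono) (auto simp: dist_norm norm_minus_commute)
        finally show "z \<bullet> v \<le> x + norm z * d" using x(2)[OF w(1)] by linarith
      qed
      have "\<bar>x - support_fun A z\<bar> \<le> (1 + norm z) * d"
        unfolding distrib_right
        using 1 2 d mult_nonneg_nonneg[OF norm_ge_zero[of z] less_imp_le[OF d]]
        by linarith
      then show ?thesis
        unfolding x(1) of_real_diff[symmetric] norm_of_real by (simp add: d_def)
    qed
    then show ?thesis
      using smooth_log_sum_exp[OF F(1) Fne p] psd_log_sum_exp[OF F(1) Fne p] by blast
  qed
  then have "\<exists>U. \<forall>j. smooth (U j) \<and> (\<forall>z. psd_at (U j) z) \<and>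
      (\<forall>z. cmod (U j z - of_real (support_fun A z)) \<le> (1 + norm z) / (real j + 1))"
    by (intro choice allI)
  then show ?thesis unfolding approximates_def by blast
qed

section \<open>Bedford--Taylor products as limits of smooth products\<close>

definition approximable :: "(complex ^ 'n \<Rightarrow> real) \<Rightarrow> bool" where
  "approximable u \<longleftrightarrow> (\<exists>U. approximates U u)"

text \<open>The choice depends on \<open>u\<close> alone, so a function is regularised alike
  wherever it stands in a list; permuting the factors relies on this.\<close>

definition approximant :: "(complex ^ 'n \<Rightarrow> real) \<Rightarrow> nat \<Rightarrow> complex ^ 'n \<Rightarrow> complex" where
  "approximant u = (SOME U. approximates U u)"

lemma approximates_approximant: "approximable u \<Longrightarrow> approximates (approximant u) u"
  unfolding approximable_def approximant_def by (rule someI_ex[of "\<lambda>U. approximates U u"])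

lemma smooth_approximant: "approximable u \<Longrightarrow> smooth (approximant u j)"
  using approximates_approximant[of u] by (simp add: approximates_def)

lemma psd_approximant: "approximable u \<Longrightarrow> psd_at (approximant u j) z"
  using approximates_approximant[of u] by (simp add: approximates_def)

lemma approximant_error:
  "approximable u \<Longrightarrow> cmod (approximant u j z - of_real (u z)) \<le> (1 + norm z) / (real j + 1)"
  using approximates_approximant[of u] by (simp add: approximates_def)

lemma approximable_continuous: "approximable u \<Longrightarrow> continuous_on UNIV u"
  unfolding approximable_def using approximates_continuous[of _ u] by blast

text \<open>All factors share the index \<open>j\<close>: a single limit replaces iterated ones, and
  the symmetry in the factors holds already before the limit.\<close>

definition smooth_current :: "nat \<Rightarrow> (complex ^ 'n \<Rightarrow> real) list \<Rightarrow> 'n::finite current" where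
  "smooth_current j us ab f = (LINT z|lborel. f z * hessian_kernel (map (\<lambda>u. approximant u j) us) ab z)"

lemma smooth_hessian_kernel_approximant:
  "\<forall>u\<in>set us. approximable u \<Longrightarrow> smooth (hessian_kernel (map (\<lambda>u. approximant u j) us) ab)"
  by (intro smooth_hessian_kernel) (auto intro: smooth_approximant)

lemma smooth_current_integrable:
  assumes "\<forall>u\<in>set us. approximable u" "f \<in> Cc"
  shows "integrable lborel (\<lambda>z. f z * hessian_kernel (map (\<lambda>u. approximant u j) us) ab z)"
  by (intro Cc_integrable Cc_mult_right assms smooth_imp_continuous smooth_hessian_kernel_approximant)

lemma smooth_current_add:
  assumes "\<forall>u\<in>set us. approximable u" "f \<in> Cc" "g \<in> Cc"
  shows "smooth_current j us ab (\<lambda>z. f z + g z) = smooth_current j us ab f + smooth_current j us ab g"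
  unfolding smooth_current_def distrib_right
  by (intro Bochner_Integration.integral_add smooth_current_integrable assms)

lemma smooth_current_cmult:
  "smooth_current j us ab (\<lambda>z. c * f z) = c * smooth_current j us ab f"
  unfolding smooth_current_def mult.assoc by simp

lemma smooth_current_diff:
  assumes "\<forall>u\<in>set us. approximable u" "f \<in> Cc" "g \<in> Cc"
  shows "smooth_current j us ab (\<lambda>z. f z - g z) = smooth_current j us ab f - smooth_current j us ab g"
  unfolding smooth_current_def left_diff_distrib
  by (intro Bochner_Integration.integral_diff smooth_current_integrable assms)

lemma smooth_current_Cons:
  assumes "\<forall>v\<in>set (u # us). approximable v" "f \<in> Cc_smooth"
  shows "smooth_current j (u # us) ab f =
    (\<Sum>a\<in>UNIV. \<Sum>b\<in>UNIV. 2 * \<i> * smooth_current j us ((a, b) # ab) (\<lambda>z. approximant u j z * d_z a (d_zbar b f) z))"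
proof -
  have "smooth_current j (u # us) ab f = (LINT z|lborel. f z * hessian_kernel (approximant u j # map (\<lambda>u. approximant u j) us) ab z)"
    by (simp only: smooth_current_def list.map)
  also have "\<dots> = (\<Sum>a\<in>UNIV. \<Sum>b\<in>UNIV. 2 * \<i> * (LINT z|lborel. approximant u j z * d_z a (d_zbar b f) z *
      hessian_kernel (map (\<lambda>u. approximant u j) us) ((a, b) # ab) z))"
    using assms by (intro hessian_kernel_by_parts) (auto intro: smooth_approximant)
  finally show ?thesis by (simp only: smooth_current_def)
qed

lemma real_bump_norm: "(\<exists>x. w = complex_of_real x \<and> 0 \<le> x \<and> x \<le> 1) \<Longrightarrow> cmod w = Re w \<and> 0 \<le> Re w \<and> w = of_real (Re w)"
  by auto

text \<open>On the support of \<open>f\<close> the cutoff \<open>e\<close> is 1, and the diagonal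
  kernels are nonnegative up to the common phase of \<open>\<kappa>\<close>; hence the integral of
  the dominating diagonal is the modulus of the current at \<open>e\<close>. An arbitrary continuous
  \<open>f\<close> is thereby replaced by one cutoff, which can be taken smooth.\<close>

lemma smooth_current_diagonal:
  fixes ab :: "('n::finite \<times> 'n) list"
  assumes us: "\<forall>u\<in>set us. approximable u"
    and f: "f \<in> Cc" "\<And>z. norm z \<ge> r \<Longrightarrow> f z = 0"
    and e: "e \<in> Cc" "\<And>z. norm z \<le> r \<Longrightarrow> e z = 1" "\<And>z. \<exists>x. e z = of_real x \<and> 0 \<le> x \<and> x \<le> 1"
  shows "cmod (smooth_current j us ab f) \<le> sup_norm f *
    (cmod (smooth_current j us (zip (map fst ab) (map fst ab)) e) + cmod (smooth_current j us (zip (map snd ab) (map snd ab)) e))"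
proof -
  let ?k = "hessian_kernel (map (\<lambda>u. approximant u j) us)"
  let ?as = "map fst ab" and ?bs = "map snd ab"
  define \<kappa> where "\<kappa> = (2 * \<i>) ^ length us * (- 2 * \<i>) ^ CARD('n)"
  define c where "c = 2 ^ length us * (2::real) ^ CARD('n)"
  have \<kappa>: "cmod \<kappa> = c" "c > 0" by (simp_all add: \<kappa>_def c_def norm_mult norm_power)
  have "\<exists>t. \<forall>z. (\<forall>as. 0 \<le> t z as) \<and> (\<forall>as. ?k (zip as as) z = \<kappa> * of_real (t z as)) \<and>
     (\<forall>as bs. length as = length bs \<longrightarrow> cmod (?k (zip as bs) z) \<le> c * (t z as + t z bs))"
  proof (rule choice, rule allI)
    fix z
    have "psd_at u z" if "u \<in> set (map (\<lambda>u. approximant u j) us)" for u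
      using that us by (auto intro: psd_approximant)
    from hessian_kernel_diagonal[OF this] obtain t :: "'n list \<Rightarrow> real" where "\<And>as. 0 \<le> t as"
      "\<And>as. ?k (zip as as) z = (2 * \<i>) ^ length us * (- 2 * \<i>) ^ CARD('n) * of_real (t as)"
      "\<And>as bs. length as = length bs \<Longrightarrow> cmod (?k (zip as bs) z) \<le> 2 ^ length us * 2 ^ CARD('n) * (t as + t bs)"
      by (metis (no_types, lifting) length_map)
    then show "\<exists>t. (\<forall>as. 0 \<le> t as) \<and> (\<forall>as. ?k (zip as as) z = \<kappa> * of_real (t as)) \<and>
      (\<forall>as bs. length as = length bs \<longrightarrow> cmod (?k (zip as bs) z) \<le> c * (t as + t bs))"
      unfolding \<kappa>_def c_def by blast
  qed
  then obtain t where t: "\<And>z as. 0 \<le> t z as" "\<And>z as. ?k (zip as as) z = \<kappa> * of_real (t z as)"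
    "\<And>z as bs. length as = length bs \<Longrightarrow> cmod (?k (zip as bs) z) \<le> c * (t z as + t z bs)" by blast
  have sc: "smooth_current j us (zip as as) e = \<kappa> * of_real (LINT z|lborel. Re (e z) * t z as)" for as
  proof -
    have "smooth_current j us (zip as as) e = (LINT z|lborel. \<kappa> * of_real (Re (e z) * t z as))"
      unfolding smooth_current_def t(2)
      using real_bump_norm[OF e(3)] by (intro Bochner_Integration.integral_cong) (auto simp: mult_ac)
    then show ?thesis by (simp only: integral_mult_right_zero integral_complex_of_real)
  qed
  have int: "integrable lborel (\<lambda>z. Re (e z) * t z as)" for as
  proof -
    have "integrable lborel (\<lambda>z. inverse \<kappa> * (e z * ?k (zip as as) z))"
      by (intro integrable_mult_right smooth_current_integrable us e)
    moreover have "inverse \<kappa> * (e z * ?k (zip as as) z) = of_real (Re (e z) * t z as)" for z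
    proof -
      have "\<kappa> \<noteq> 0" using \<kappa> by auto
      moreover have "e z = of_real (Re (e z))" using real_bump_norm[OF e(3)[of z]] by blast
      ultimately show ?thesis unfolding t(2) by (metis (no_types, lifting) mult.left_commute mult.assoc left_inverse mult_1 of_real_mult)
    qed
    ultimately have "integrable lborel (\<lambda>z. complex_of_real (Re (e z) * t z as))" by simp
    then show ?thesis by (simp only: complex_of_real_integrable_eq)
  qed
  have nn: "0 \<le> (LINT z|lborel. Re (e z) * t z as)" for as
    using t(1) real_bump_norm[OF e(3)] by (intro Bochner_Integration.integral_nonneg mult_nonneg_nonneg) auto
  have "cmod (smooth_current j us ab f) \<le> (LINT z|lborel. cmod (f z * ?k ab z))"
    unfolding smooth_current_def by (rule integral_norm_bound)
  also have "\<dots> \<le> (LINT z|lborel. sup_norm f * c * (Re (e z) * t z ?as + Re (e z) * t z ?bs))"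
  proof (rule integral_mono)
    show "integrable lborel (\<lambda>z. cmod (f z * ?k ab z))"
      by (intro integrable_norm smooth_current_integrable us f)
    show "integrable lborel (\<lambda>z. sup_norm f * c * (Re (e z) * t z ?as + Re (e z) * t z ?bs))"
      by (intro integrable_mult_right Bochner_Integration.integrable_add int)
    fix z
    show "cmod (f z * ?k ab z) \<le> sup_norm f * c * (Re (e z) * t z ?as + Re (e z) * t z ?bs)"
    proof (cases "norm z \<le> r")
      case True
      have "cmod (?k ab z) \<le> c * (t z ?as + t z ?bs)"
        using t(3)[of ?as ?bs z] by (simp add: zip_fst_snd)
      then have "cmod (f z) * cmod (?k ab z) \<le> sup_norm f * (c * (t z ?as + t z ?bs))"
        by (intro mult_mono sup_norm_upper f sup_norm_nonneg) auto
      then show ?thesis using e(2)[OF True] by (simp add: norm_mult)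
    next
      case False
      have "0 \<le> Re (e z)" using real_bump_norm[OF e(3)[of z]] by blast
      then show ?thesis using f(2)[of z] False sup_norm_nonneg[OF f(1)] \<kappa> t(1)
        by (auto intro!: mult_nonneg_nonneg add_nonneg_nonneg)
    qed
  qed
  also have "\<dots> = sup_norm f * (c * (LINT z|lborel. Re (e z) * t z ?as) + c * (LINT z|lborel. Re (e z) * t z ?bs))"
    using int by (simp add: algebra_simps)
  also have "\<dots> = sup_norm f * (cmod (smooth_current j us (zip ?as ?as) e) + cmod (smooth_current j us (zip ?bs ?bs) e))"
    unfolding sc norm_mult \<kappa> using nn by simp
  finally show ?thesis .
qed

section \<open>Mass bounds uniform in the regularisation\<close>

lemma sup_norm_mult_le:
  assumes "g \<in> Cc" "\<And>z. g z \<noteq> 0 \<Longrightarrow> cmod (h z) \<le> B" "0 \<le> B"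
  shows "sup_norm (\<lambda>z. h z * g z) \<le> B * sup_norm g"
proof (rule sup_norm_least)
  fix z
  show "cmod (h z * g z) \<le> B * sup_norm g"
  proof (cases "g z = 0")
    case True
    then show ?thesis using assms sup_norm_nonneg[OF assms(1)] by simp
  next
    case False
    then show ?thesis unfolding norm_mult using assms by (intro mult_mono sup_norm_upper) auto
  qed
qed

text \<open>The Chern-Levine-Nirenberg estimate. Positivity replaces \<open>f\<close> by a smooth
  cutoff; integration by parts then moves the dd^c of the first factor onto the cutoff, where only a
  local bound of that factor and the shorter product enter. The radius varies in the induction
  because the cutoff has a larger support than \<open>f\<close>.\<close>

lemma smooth_current_bounded:
  fixes us :: "(complex ^ 'n::finite \<Rightarrow> real) list"
  assumes "\<forall>u\<in>set us. approximable u"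
  shows "\<exists>C\<ge>0. \<forall>j. \<forall>f\<in>Cc. (\<forall>z. norm z \<ge> r \<longrightarrow> f z = 0) \<longrightarrow> cmod (smooth_current j us ab f) \<le> C * sup_norm f"
  using assms
proof (induction us arbitrary: ab r)
  case Nil
  let ?V = "measure lborel (cball 0 r :: (complex ^ 'n) set)"
  have "cmod (smooth_current j [] ab f) \<le> (cmod (sign_kernel ab) * ?V) * sup_norm f"
    if f: "f \<in> Cc" "\<And>z. norm z \<ge> r \<Longrightarrow> f z = 0" for j and f :: "complex ^ 'n \<Rightarrow> complex"
  proof -
    have "cmod (LINT z|lborel. f z) \<le> (LINT z|lborel. cmod (f z))" by (rule integral_norm_bound)
    also have "\<dots> \<le> (LINT z::complex^'n|lborel. indicator (cball 0 r) z *\<^sub>R sup_norm f)"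
    proof (rule integral_mono)
      show "integrable lborel (\<lambda>z. cmod (f z))" using f by (intro integrable_norm Cc_integrable)
      show "integrable lborel (\<lambda>z::complex^'n. indicator (cball 0 r) z *\<^sub>R sup_norm f)"
        by (rule borel_integrable_compact) auto
      show "cmod (f z) \<le> indicator (cball 0 r) z *\<^sub>R sup_norm f" for z
        using f(2)[of z] sup_norm_upper[OF f(1), of z] by (cases "norm z \<le> r") auto
    qed
    also have "\<dots> = ?V * sup_norm f" by simp
    finally have "cmod (LINT z|lborel. f z) * cmod (sign_kernel ab) \<le> ?V * sup_norm f * cmod (sign_kernel ab)"
      by (rule mult_right_mono) simp
    then show ?thesis by (simp add: smooth_current_def norm_mult mult_ac)
  qed
  then show ?case by (intro exI[of _ "cmod (sign_kernel ab) * ?V"]) auto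
next
  case (Cons u us)
  have ap: "\<forall>v\<in>set (u # us). approximable v" "approximable u" "\<forall>v\<in>set us. approximable v" using Cons.prems by auto
  define R where "R = max r 1"
  have R: "R > 0" "r \<le> R" by (auto simp: R_def)
  obtain e :: "complex ^ 'n \<Rightarrow> complex" where e: "e \<in> Cc_smooth"
    "\<And>z. norm z \<le> R \<Longrightarrow> e z = 1" "\<And>z. norm z \<ge> 2 * R \<Longrightarrow> e z = 0"
    "\<And>z. \<exists>x. e z = of_real x \<and> 0 \<le> x \<and> x \<le> 1" using bump_exists[OF R(1)] by blast
  have eC: "e \<in> Cc" using e by (simp add: Cc_smooth_iff)
  have ed: "d_z a (d_zbar b e) \<in> Cc" for a b
    using Cc_smooth_d_z[OF Cc_smooth_d_zbar[OF e(1)]] by (simp add: Cc_smooth_iff)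
  have "\<exists>R'>0. \<forall>a b z. norm z \<ge> R' \<longrightarrow> d_z a (d_zbar b e) z = 0"
  proof -
    have "\<exists>s>0. \<forall>z. norm z \<ge> s \<longrightarrow> d_z (fst p) (d_zbar (snd p) e) z = 0" for p
      using Cc_radius[OF ed[of "fst p" "snd p"]] by blast
    then obtain s where s: "\<And>p. s p > 0" "\<And>p z. norm z \<ge> s p \<Longrightarrow> d_z (fst p) (d_zbar (snd p) e) z = 0" by metis
    \<comment> \<open>One radius for the second derivatives of the cutoff in all of the finitely
      many index pairs.\<close>
    define R' where "R' = Max (range s)"
    have le: "s p \<le> R'" for p unfolding R'_def by (intro Max_ge) auto
    have "d_z a (d_zbar b e) z = 0" if "norm z \<ge> R'" for a b z
      using s(2)[of "(a, b)" z] le[of "(a, b)"] that by simp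
    moreover have "R' > 0" using s(1) le by (meson less_le_trans)
    ultimately show ?thesis by blast
  qed
  then obtain R' where R': "R' > 0" "\<And>a b z. norm z \<ge> R' \<Longrightarrow> d_z a (d_zbar b e) z = 0" by blast
  have "compact (u ` cball 0 R')"
    by (intro compact_continuous_image continuous_on_subset[OF approximable_continuous[OF ap(2)]]) auto
  then obtain b where b: "\<forall>y\<in>u ` cball 0 R'. norm y \<le> b" using compact_imp_bounded bounded_iff by blast
  \<comment> \<open>\<open>b\<close> bounds \<open>u\<close> on the ball of radius
    \<open>R'\<close>, and \<open>1 + R'\<close> bounds the approximation error there for every
    \<open>j\<close>.\<close>
  define B where "B = \<bar>b\<bar> + 1 + R'"
  have B: "0 \<le> B" using R' by (simp add: B_def)
  have ub: "cmod (approximant u j z) \<le> B" if "norm z < R'" for j z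
  proof -
    have "norm (u z) \<le> b" using b that by auto
    moreover have "(1 + norm z) / (real j + 1) \<le> (1 + norm z) / 1" by (intro divide_left_mono) auto
    moreover have "cmod (approximant u j z) \<le> cmod (approximant u j z - of_real (u z)) + cmod (of_real (u z))"
      using norm_triangle_ineq[of "approximant u j z - of_real (u z)" "of_real (u z)"] by simp
    ultimately show ?thesis using approximant_error[OF ap(2), of j z] that by (simp add: B_def)
  qed
  have "\<exists>C\<ge>0. \<forall>j. \<forall>f\<in>Cc. (\<forall>z. norm z \<ge> R' \<longrightarrow> f z = 0) \<longrightarrow> cmod (smooth_current j us ab' f) \<le> C * sup_norm f" for ab'
    by (rule Cons.IH[OF ap(3)])
  then obtain C where C: "\<And>ab'. C ab' \<ge> 0" "\<And>ab' j f. f \<in> Cc \<Longrightarrow> (\<And>z. norm z \<ge> R' \<Longrightarrow> f z = 0) \<Longrightarrow>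
      cmod (smooth_current j us ab' f) \<le> C ab' * sup_norm f" by metis
  define D where "D ab' = (\<Sum>a\<in>UNIV. \<Sum>b\<in>UNIV. 2 * (C ((a, b) # ab') * (B * sup_norm (d_z a (d_zbar b e)))))" for ab'
  have D0: "0 \<le> D ab'" for ab'
    unfolding D_def using C(1) B sup_norm_nonneg[OF ed] by (intro sum_nonneg mult_nonneg_nonneg) auto
  have De: "cmod (smooth_current j (u # us) ab' e) \<le> D ab'" for j ab'
    unfolding smooth_current_Cons[OF ap(1) e(1)] D_def
  proof (intro sum_norm_le)
    fix a b
    have "cmod (smooth_current j us ((a, b) # ab') (\<lambda>z. approximant u j z * d_z a (d_zbar b e) z))
       \<le> C ((a, b) # ab') * sup_norm (\<lambda>z. approximant u j z * d_z a (d_zbar b e) z)"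
      using R'(2) by (intro C Cc_mult_left ed smooth_imp_continuous smooth_approximant ap) simp
    also have "\<dots> \<le> C ((a, b) # ab') * (B * sup_norm (d_z a (d_zbar b e)))"
    proof (intro mult_left_mono C sup_norm_mult_le ed B)
      show "cmod (approximant u j z) \<le> B" if "d_z a (d_zbar b e) z \<noteq> 0" for z
        using ub[of z] R'(2)[of z a b] that by (cases "norm z < R'") auto
    qed
    finally show "cmod (2 * \<i> * smooth_current j us ((a, b) # ab') (\<lambda>z. approximant u j z * d_z a (d_zbar b e) z))
       \<le> 2 * (C ((a, b) # ab') * (B * sup_norm (d_z a (d_zbar b e))))"
      by (simp add: norm_mult)
  qed
  let ?as = "map fst ab" and ?bs = "map snd ab"
  have "cmod (smooth_current j (u # us) ab f) \<le> (D (zip ?as ?as) + D (zip ?bs ?bs)) * sup_norm f"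
    if f: "f \<in> Cc" "\<And>z. norm z \<ge> r \<Longrightarrow> f z = 0" for j f
  proof -
    have "cmod (smooth_current j (u # us) ab f) \<le> sup_norm f *
      (cmod (smooth_current j (u # us) (zip ?as ?as) e) + cmod (smooth_current j (u # us) (zip ?bs ?bs) e))"
      using f R(2) by (intro smooth_current_diagonal[OF ap(1) f(1) _ eC e(2) e(4), of R]) auto
    also have "\<dots> \<le> sup_norm f * (D (zip ?as ?as) + D (zip ?bs ?bs))"
      by (intro mult_left_mono add_mono De sup_norm_nonneg f)
    finally show ?thesis by (simp add: mult.commute)
  qed
  then show ?case using D0 by (intro exI[of _ "D (zip ?as ?as) + D (zip ?bs ?bs)"]) auto
qed

section \<open>Radon functionals and the convergence of the regularised products\<close>

lemma Cc_cball_radius: "compact K \<Longrightarrow> \<exists>r>0. \<forall>z. norm z \<ge> r \<longrightarrow> z \<notin> (K :: (complex ^ 'n) set)"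
proof -
  assume "compact K"
  then obtain b where "\<forall>x\<in>K. norm x \<le> b" using compact_imp_bounded bounded_iff by blast
  then have "\<forall>z. norm z \<ge> \<bar>b\<bar> + 1 \<longrightarrow> z \<notin> K" by fastforce
  then show ?thesis by (intro exI[of _ "\<bar>b\<bar> + 1"]) simp
qed

lemma radon_functional_add:
  "radon_functional S \<Longrightarrow> f \<in> Cc \<Longrightarrow> g \<in> Cc \<Longrightarrow> S (\<lambda>z. f z + g z) = S f + S g"
  by (simp add: radon_functional_def)

lemma radon_functional_cmult:
  "radon_functional S \<Longrightarrow> f \<in> Cc \<Longrightarrow> S (\<lambda>z. c * f z) = c * S f"
  by (simp add: radon_functional_def)

lemma radon_functional_bounded:
  assumes "radon_functional S"
  obtains C where "\<And>g. g \<in> Cc \<Longrightarrow> (\<And>z. norm z \<ge> r \<Longrightarrow> g z = 0) \<Longrightarrow> cmod (S g) \<le> C * sup_norm g"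
proof -
  have "\<forall>K. compact K \<longrightarrow> (\<exists>C. \<forall>f\<in>Cc. (\<forall>z. z \<notin> K \<longrightarrow> f z = 0) \<longrightarrow> cmod (S f) \<le> C * (SUP z. cmod (f z)))"
    using assms by (simp add: radon_functional_def)
  from this[rule_format, OF compact_cball, of 0 r]
  obtain C where C: "\<forall>f\<in>Cc. (\<forall>z. z \<notin> cball 0 r \<longrightarrow> f z = 0) \<longrightarrow> cmod (S f) \<le> C * (SUP z. cmod (f z))"
    by blast
  show ?thesis by (rule that[of C]) (use C in \<open>auto simp: sup_norm_def\<close>)
qed

text \<open>The uniqueness behind the definite description of \<open>ddc_wedge\<close>. The smooth
  approximations of \<open>f\<close> stay in one ball, so one constant controls each functional on
  all of them.\<close>

lemma radon_functional_unique:
  assumes S: "radon_functional S" and S': "radon_functional S'"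
    and eq: "\<And>f. f \<in> Cc_smooth \<Longrightarrow> S f = S' f"
  shows "S = S'"
proof
  fix f
  show "S f = S' f"
  proof (cases "f \<in> Cc")
    case False
    then show ?thesis using S S' by (simp add: radon_functional_def)
  next
    case f: True
    obtain r where r: "r > 0" "\<And>z. norm z \<ge> r \<Longrightarrow> f z = 0" using Cc_radius[OF f] by blast
    have add: "T (\<lambda>z. f z - g z) = T f - T g" if T: "radon_functional T" and g: "g \<in> Cc" for T g
    proof -
      have "T (\<lambda>z. f z + (-1) * g z) = T f + (-1) * T g"
        using radon_functional_add[OF T f Cc_cmult[OF g, of "-1"]] radon_functional_cmult[OF T g, of "-1"] by (simp only:)
      then show ?thesis by simp
    qed
    obtain C where C: "\<And>g. g \<in> Cc \<Longrightarrow> (\<And>z. norm z \<ge> 2 * r \<Longrightarrow> g z = 0) \<Longrightarrow> cmod (S g) \<le> C * sup_norm g"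
      using radon_functional_bounded[OF S, where r="2 * r"] by blast
    obtain C' where C': "\<And>g. g \<in> Cc \<Longrightarrow> (\<And>z. norm z \<ge> 2 * r \<Longrightarrow> g z = 0) \<Longrightarrow> cmod (S' g) \<le> C' * sup_norm g"
      using radon_functional_bounded[OF S', where r="2 * r"] by blast
    have "cmod (S f - S' f) \<le> 0 + e" if e: "e > 0" for e
    proof -
      define d where "d = e / (\<bar>C\<bar> + \<bar>C'\<bar> + 1)"
      have d: "d > 0" "(\<bar>C\<bar> + \<bar>C'\<bar>) * d \<le> e" using e by (auto simp: d_def field_simps)
      obtain g where g: "g \<in> Cc_smooth" "\<And>z. cmod (f z - g z) \<le> d" "\<And>z. norm z \<ge> 2 * r \<Longrightarrow> g z = 0"
        using Cc_smooth_dense[OF f r(2) r(1) d(1)] by blast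
      have gC: "g \<in> Cc" using g by (simp add: Cc_smooth_iff)
      have h: "(\<lambda>z. f z - g z) \<in> Cc" by (rule Cc_diff[OF f gC])
      have hz: "f z - g z = 0" if "norm z \<ge> 2 * r" for z using that r(1) r(2)[of z] g(3)[of z] by simp
      have n: "sup_norm (\<lambda>z. f z - g z) \<le> d" by (rule sup_norm_least[OF g(2)])
      have "cmod w \<le> \<bar>B\<bar> * d" if "cmod w \<le> B * sup_norm (\<lambda>z. f z - g z)" for w B
        using that mult_mono[OF abs_ge_self[of B] n _ sup_norm_nonneg[OF h]] by simp
      from this[OF C[OF h]] this[OF C'[OF h]] hz
      have "cmod (S f - S g) \<le> \<bar>C\<bar> * d" "cmod (S' f - S' g) \<le> \<bar>C'\<bar> * d"
        using add[OF S gC] add[OF S' gC] by auto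
      moreover have "S f - S' f = (S f - S g) - (S' f - S' g)" using eq[OF g(1)] by simp
      ultimately have "cmod (S f - S' f) \<le> \<bar>C\<bar> * d + \<bar>C'\<bar> * d"
        using norm_triangle_ineq4[of "S f - S g" "S' f - S' g"] by simp
      then show ?thesis using d(2) by (simp add: distrib_right)
    qed
    then have "cmod (S f - S' f) \<le> 0" by (rule field_le_epsilon)
    then show ?thesis by simp
  qed
qed

text \<open>Write the approximant of \<open>u\<close> as \<open>u\<close> plus an error. The part
  with \<open>u\<close> is a fixed continuous test function, covered by \<open>lim\<close>; the
  error tends to 0 uniformly on the support, and the masses are bounded uniformly in
  \<open>j\<close>.\<close>

lemma smooth_current_Cons_tendsto:
  fixes us :: "(complex ^ 'n::finite \<Rightarrow> real) list"
  assumes ap: "\<forall>v\<in>set (u # us). approximable v" "approximable u" "\<forall>v\<in>set us. approximable v"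
    and lim: "\<And>ab f. f \<in> Cc \<Longrightarrow> (\<lambda>j. smooth_current j us ab f) \<longlonglongrightarrow> ddc_product us ab f"
    and f: "f \<in> Cc_smooth"
  shows "(\<lambda>j. smooth_current j (u # us) ab f) \<longlonglongrightarrow>
    (\<Sum>a\<in>UNIV. \<Sum>b\<in>UNIV. 2 * \<i> * ddc_product us ((a, b) # ab) (\<lambda>z. of_real (u z) * d_z a (d_zbar b f) z))"
  unfolding smooth_current_Cons[OF ap(1) f]
  proof (intro tendsto_sum tendsto_mult tendsto_const)
  fix a b
  have uC: "continuous_on UNIV (\<lambda>z. complex_of_real (u z))"
    using approximable_continuous[OF ap(2)] by (rule continuous_on_of_real)
  let ?g = "d_z a (d_zbar b f)" and ?ab = "(a, b) # ab"
  have g: "?g \<in> Cc" using Cc_smooth_d_z[OF Cc_smooth_d_zbar[OF f]] by (simp add: Cc_smooth_iff)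
  have ug: "(\<lambda>z. of_real (u z) * ?g z) \<in> Cc" by (rule Cc_mult_left[OF g uC])
  have diff_cont: "continuous_on UNIV (\<lambda>z. approximant u j z - of_real (u z))" for j
    by (intro continuous_on_diff uC smooth_imp_continuous smooth_approximant ap)
  have dg: "(\<lambda>z. (approximant u j z - of_real (u z)) * ?g z) \<in> Cc" for j
    by (rule Cc_mult_left[OF g diff_cont])
  obtain r where r: "r > 0" "\<And>z. norm z \<ge> r \<Longrightarrow> ?g z = 0" using Cc_radius[OF g] by blast
  obtain C where C: "C \<ge> 0" "\<And>j f. f \<in> Cc \<Longrightarrow> (\<And>z. norm z \<ge> r \<Longrightarrow> f z = 0) \<Longrightarrow> cmod (smooth_current j us ?ab f) \<le> C * sup_norm f"
    using smooth_current_bounded[OF ap(3), of r ?ab] by blast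
  have bd: "cmod (smooth_current j us ?ab (\<lambda>z. (approximant u j z - of_real (u z)) * ?g z)) \<le> C * ((1 + r) * sup_norm ?g) / (real j + 1)" for j
  proof -
    have "sup_norm (\<lambda>z. (approximant u j z - of_real (u z)) * ?g z) \<le> ((1 + r) / (real j + 1)) * sup_norm ?g"
    proof (rule sup_norm_mult_le[OF g])
      fix z assume "?g z \<noteq> 0"
      then have "norm z \<le> r" using r(2)[of z] by (cases "norm z \<le> r") auto
      then have "(1 + norm z) / (real j + 1) \<le> (1 + r) / (real j + 1)" by (intro divide_right_mono) auto
      then show "cmod (approximant u j z - of_real (u z)) \<le> (1 + r) / (real j + 1)"
        using approximant_error[OF ap(2), of j z] by linarith
    qed (use r in auto)
    then have "C * sup_norm (\<lambda>z. (approximant u j z - of_real (u z)) * ?g z) \<le> C * (((1 + r) / (real j + 1)) * sup_norm ?g)"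
      using C(1) by (rule mult_left_mono)
    moreover have "cmod (smooth_current j us ?ab (\<lambda>z. (approximant u j z - of_real (u z)) * ?g z)) \<le>
        C * sup_norm (\<lambda>z. (approximant u j z - of_real (u z)) * ?g z)"
      using r(2) by (intro C(2) dg) simp
    ultimately show ?thesis by simp
  qed
  have 0: "(\<lambda>j. smooth_current j us ?ab (\<lambda>z. (approximant u j z - of_real (u z)) * ?g z)) \<longlonglongrightarrow> 0"
  proof (rule Lim_null_comparison[OF always_eventually[OF allI[OF bd]]])
    have "(\<lambda>j. (C * ((1 + r) * sup_norm ?g)) * inverse (real (Suc j))) \<longlonglongrightarrow> (C * ((1 + r) * sup_norm ?g)) * 0"
      by (intro tendsto_mult tendsto_const LIMSEQ_inverse_real_of_nat)
    then show "(\<lambda>j. C * ((1 + r) * sup_norm ?g) / (real j + 1)) \<longlonglongrightarrow> 0"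
      by (simp add: divide_inverse add.commute)
  qed
  have "smooth_current j us ?ab (\<lambda>z. approximant u j z * ?g z) =
      smooth_current j us ?ab (\<lambda>z. of_real (u z) * ?g z) +
      smooth_current j us ?ab (\<lambda>z. (approximant u j z - of_real (u z)) * ?g z)" for j
    by (subst smooth_current_add[OF ap(3) ug dg, symmetric]) (simp add: algebra_simps)
  moreover have "(\<lambda>j. smooth_current j us ?ab (\<lambda>z. of_real (u z) * ?g z) +
      smooth_current j us ?ab (\<lambda>z. (approximant u j z - of_real (u z)) * ?g z)) \<longlonglongrightarrow>
      ddc_product us ?ab (\<lambda>z. of_real (u z) * ?g z) + 0"
    by (intro tendsto_add lim ug 0)
  ultimately show "(\<lambda>j. smooth_current j us ?ab (\<lambda>z. approximant u j z * ?g z)) \<longlonglongrightarrow>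
      ddc_product us ?ab (\<lambda>z. of_real (u z) * ?g z)" by simp
  qed

text \<open>Convergence on smooth test functions extends to \<open>Cc\<close> by density and the
  uniform mass bounds. The limit functional meets the description in \<open>ddc_wedge\<close>, and
  uniqueness identifies the two; existence of the Bedford-Taylor product is obtained on the
  way.\<close>

lemma smooth_current_tendsto:
  fixes us :: "(complex ^ 'n::finite \<Rightarrow> real) list"
  assumes "\<forall>u\<in>set us. approximable u"
  shows "f \<in> Cc \<Longrightarrow> (\<lambda>j. smooth_current j us ab f) \<longlonglongrightarrow> ddc_product us ab f"
  using assms
proof (induction us arbitrary: ab f)
  case Nil
  have "smooth_current j [] ab f = ddc_product [] ab f" for j
    by (simp add: smooth_current_def ddc_product_def integration_current_eq)
  then show ?case by simp
next
  case (Cons u us)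
  have ap: "\<forall>v\<in>set (u # us). approximable v" "approximable u" "\<forall>v\<in>set us. approximable v" using Cons.prems by auto
  let ?A = "\<lambda>j. smooth_current j (u # us) ab"
  let ?R = "\<lambda>f. \<Sum>a\<in>UNIV. \<Sum>b\<in>UNIV. 2 * \<i> * ddc_product us ((a, b) # ab) (\<lambda>z. of_real (u z) * d_z a (d_zbar b f) z)"
  have smooth_lim: "(\<lambda>j. ?A j f) \<longlonglongrightarrow> ?R f" if f: "f \<in> Cc_smooth" for f
    by (rule smooth_current_Cons_tendsto[OF ap Cons.IH[OF _ ap(3)] f])
  have conv: "convergent (\<lambda>j. ?A j f)" if f: "f \<in> Cc" for f
  proof -
    obtain r where r: "r > 0" "\<And>z. norm z \<ge> r \<Longrightarrow> f z = 0" using Cc_radius[OF f] by blast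
    obtain C where C: "C \<ge> 0" "\<And>j f. f \<in> Cc \<Longrightarrow> (\<And>z. norm z \<ge> 2 * r \<Longrightarrow> f z = 0) \<Longrightarrow> cmod (?A j f) \<le> C * sup_norm f"
      using smooth_current_bounded[OF ap(1), of "2 * r" ab] by blast
    have "Cauchy (\<lambda>j. ?A j f)"
    proof (rule CauchyI)
      fix e :: real assume e: "e > 0"
      \<comment> \<open>Three differences of size at most \<open>e / 4\<close> stay below
        \<open>e\<close>; the summand 1 covers \<open>C = 0\<close>.\<close>
      define d where "d = e / (4 * (C + 1))"
      have d: "d > 0" "C * d \<le> e / 4" using e C(1) by (auto simp: d_def field_simps)
      obtain g where g: "g \<in> Cc_smooth" "\<And>z. cmod (f z - g z) \<le> d" "\<And>z. norm z \<ge> 2 * r \<Longrightarrow> g z = 0"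
        using Cc_smooth_dense[OF f r(2) r(1) d(1)] by blast
      have gC: "g \<in> Cc" using g by (simp add: Cc_smooth_iff)
      have fg: "cmod (?A j f - ?A j g) \<le> e / 4" for j
      proof -
        have "cmod (?A j (\<lambda>z. f z - g z)) \<le> C * sup_norm (\<lambda>z. f z - g z)"
          using r g(3) by (intro C(2) Cc_diff f gC) simp
        also have "\<dots> \<le> C * d" by (intro mult_left_mono sup_norm_least g C)
        finally show ?thesis using d(2) smooth_current_diff[OF ap(1) f gC] by simp
      qed
      have "Cauchy (\<lambda>j. ?A j g)" by (rule LIMSEQ_imp_Cauchy[OF smooth_lim[OF g(1)]])
      then obtain M where M: "\<And>m n. m \<ge> M \<Longrightarrow> n \<ge> M \<Longrightarrow> cmod (?A m g - ?A n g) < e / 4"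
        using CauchyD[of "\<lambda>j. ?A j g" "e/4"] e by auto
      have "cmod (?A m f - ?A n f) < e" if "m \<ge> M" "n \<ge> M" for m n
      proof -
        have "?A m f - ?A n f = (?A m f - ?A m g) + (?A m g - ?A n g) - (?A n f - ?A n g)" by simp
        also have "cmod \<dots> \<le> cmod (?A m f - ?A m g) + cmod (?A m g - ?A n g) + cmod (?A n f - ?A n g)"
          by (meson norm_triangle_ineq4 norm_triangle_ineq order_trans add_right_mono)
        also have "\<dots> < e" using fg[of m] fg[of n] M[OF that] e by linarith
        finally show ?thesis .
      qed
      then show "\<exists>M. \<forall>m\<ge>M. \<forall>n\<ge>M. cmod (?A m f - ?A n f) < e" by blast
    qed
    then show ?thesis by (rule Cauchy_convergent)
  qed
  \<comment> \<open>\<open>radon_functional\<close> prescribes the value 0 outside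
    \<open>Cc\<close>; without it the description would not determine the functional.\<close>
  define S where "S f = (if f \<in> Cc then lim (\<lambda>j. ?A j f) else 0)" for f
  have S: "(\<lambda>j. ?A j f) \<longlonglongrightarrow> S f" if "f \<in> Cc" for f
    using convergent_LIMSEQ_iff[THEN iffD1, OF conv[OF that]] that by (simp add: S_def)
  have radon: "radon_functional S"
    unfolding radon_functional_def
  proof (intro conjI ballI allI impI)
    fix f g :: "complex ^ 'n \<Rightarrow> complex" assume fg: "f \<in> Cc" "g \<in> Cc"
    have "(\<lambda>j. ?A j (\<lambda>z. f z + g z)) \<longlonglongrightarrow> S f + S g"
      unfolding smooth_current_add[OF ap(1) fg] by (intro tendsto_add S fg)
    then show "S (\<lambda>z. f z + g z) = S f + S g"
      using S[OF Cc_add[OF fg]] LIMSEQ_unique by blast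
  next
    fix c and f :: "complex ^ 'n \<Rightarrow> complex" assume f: "f \<in> Cc"
    have "(\<lambda>j. ?A j (\<lambda>z. c * f z)) \<longlonglongrightarrow> c * S f"
      unfolding smooth_current_cmult by (intro tendsto_mult tendsto_const S f)
    then show "S (\<lambda>z. c * f z) = c * S f"
      using S[OF Cc_cmult[OF f]] LIMSEQ_unique by blast
  next
    fix K :: "(complex ^ 'n) set" assume K: "compact K"
    obtain r where r: "\<forall>z. norm z \<ge> r \<longrightarrow> z \<notin> K" using Cc_cball_radius[OF K] by blast
    obtain C where C: "\<And>j f. f \<in> Cc \<Longrightarrow> (\<And>z. norm z \<ge> r \<Longrightarrow> f z = 0) \<Longrightarrow> cmod (?A j f) \<le> C * sup_norm f"
      using smooth_current_bounded[OF ap(1), of r ab] by blast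
    have "cmod (S f) \<le> C * (SUP z. cmod (f z))" if f: "f \<in> Cc" "\<forall>z. z \<notin> K \<longrightarrow> f z = 0" for f
    proof (rule LIMSEQ_le_const2[OF tendsto_norm[OF S[OF f(1)]]])
      show "\<exists>N. \<forall>n\<ge>N. cmod (?A n f) \<le> C * (SUP z. cmod (f z))"
        using C[OF f(1)] r f(2) by (auto simp: sup_norm_def)
    qed
    then show "\<exists>C. \<forall>f\<in>Cc. (\<forall>z. z \<notin> K \<longrightarrow> f z = 0) \<longrightarrow> cmod (S f) \<le> C * (SUP z. cmod (f z))" by blast
  next
    fix f :: "complex ^ 'n \<Rightarrow> complex" assume "f \<notin> Cc"
    then show "S f = 0" by (simp add: S_def)
  qed
  have SR: "S f = ?R f" if f: "f \<in> Cc_smooth" for f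
    using LIMSEQ_unique[OF S smooth_lim[OF f]] f by (simp add: Cc_smooth_iff)
  have "ddc_product (u # us) ab = ddc_wedge u (ddc_product us) ab" by (simp add: ddc_product_def)
  also have "\<dots> = S"
    unfolding ddc_wedge_def
  proof (rule the_equality)
    show "radon_functional S \<and> (\<forall>f\<in>Cc_smooth. S f = ?R f)" using radon SR by blast
    fix S' assume S': "radon_functional S' \<and> (\<forall>f\<in>Cc_smooth. S' f = ?R f)"
    show "S' = S"
    proof (rule radon_functional_unique[OF _ radon])
      show "radon_functional S'" using S' by blast
      show "S' f = S f" if "f \<in> Cc_smooth" for f using S' SR[OF that] that by simp
    qed
  qed
  finally show ?case using S[OF Cons.prems(1)] by simp
qed

section \<open>Rules for the limit products\<close>

lemma ddc_product_Cons:
  assumes "\<forall>v\<in>set (u # us). approximable v" "f \<in> Cc_smooth"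
  shows "ddc_product (u # us) ab f =
    (\<Sum>a\<in>UNIV. \<Sum>b\<in>UNIV. 2 * \<i> * ddc_product us ((a, b) # ab) (\<lambda>z. of_real (u z) * d_z a (d_zbar b f) z))"
proof (rule LIMSEQ_unique)
  show "(\<lambda>j. smooth_current j (u # us) ab f) \<longlonglongrightarrow> ddc_product (u # us) ab f"
    using assms by (intro smooth_current_tendsto) (auto simp: Cc_smooth_iff)
  show "(\<lambda>j. smooth_current j (u # us) ab f) \<longlonglongrightarrow>
    (\<Sum>a\<in>UNIV. \<Sum>b\<in>UNIV. 2 * \<i> * ddc_product us ((a, b) # ab) (\<lambda>z. of_real (u z) * d_z a (d_zbar b f) z))"
    using assms by (intro smooth_current_Cons_tendsto smooth_current_tendsto) auto
qed

text \<open>Before the limit this is integration by parts with one additional factor, the constant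
  1, whose Hessian vanishes.\<close>

lemma ddc_product_closed:
  fixes us :: "(complex ^ 'n::finite \<Rightarrow> real) list"
  assumes us: "\<forall>v\<in>set us. approximable v" and f: "f \<in> Cc_smooth"
  shows "(\<Sum>a\<in>UNIV. \<Sum>b\<in>UNIV. 2 * \<i> * ddc_product us ((a, b) # ab) (d_z a (d_zbar b f))) = 0"
proof (rule LIMSEQ_unique)
  have g: "d_z a (d_zbar b f) \<in> Cc" for a b
    using Cc_smooth_d_z[OF Cc_smooth_d_zbar[OF f]] by (simp add: Cc_smooth_iff)
  show "(\<lambda>j. \<Sum>a\<in>UNIV. \<Sum>b\<in>UNIV. 2 * \<i> * smooth_current j us ((a, b) # ab) (d_z a (d_zbar b f))) \<longlonglongrightarrow>
     (\<Sum>a\<in>UNIV. \<Sum>b\<in>UNIV. 2 * \<i> * ddc_product us ((a, b) # ab) (d_z a (d_zbar b f)))"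
    by (intro tendsto_sum tendsto_mult tendsto_const smooth_current_tendsto g us)
  have "(\<Sum>a\<in>UNIV. \<Sum>b\<in>UNIV. 2 * \<i> * smooth_current j us ((a, b) # ab) (d_z a (d_zbar b f))) = 0" for j
  proof -
    let ?us = "map (\<lambda>u. approximant u j) us"
    have z: "d_z a (d_zbar b (\<lambda>z::complex^'n. 1)) z = 0" for a b z
    proof -
      have "d_zbar b (\<lambda>z::complex^'n. 1) = (\<lambda>z. 0)" by (rule ext) simp
      then show ?thesis by simp
    qed
    have "(LINT z|lborel. f z * hessian_kernel ((\<lambda>z. 1) # ?us) ab z) =
      (\<Sum>a\<in>UNIV. \<Sum>b\<in>UNIV. 2 * \<i> * (LINT z|lborel. 1 * d_z a (d_zbar b f) z * hessian_kernel ?us ((a, b) # ab) z))"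
      using us by (intro hessian_kernel_by_parts f) (auto intro: smooth_approximant)
    then show ?thesis by (simp add: smooth_current_def z)
  qed
  then show "(\<lambda>j. \<Sum>a\<in>UNIV. \<Sum>b\<in>UNIV. 2 * \<i> * smooth_current j us ((a, b) # ab) (d_z a (d_zbar b f))) \<longlonglongrightarrow> 0"
    by simp
qed

lemma ddc_product_mset:
  assumes "\<forall>u\<in>set us. approximable u" "mset us = mset vs" "f \<in> Cc"
  shows "ddc_product us ab f = ddc_product vs ab f"
proof -
  have "hessian_kernel (map (\<lambda>u. approximant u j) us) ab z = hessian_kernel (map (\<lambda>u. approximant u j) vs) ab z" for j z
    using assms(2) by (intro hessian_kernel_mset) simp
  then have "smooth_current j us ab f = smooth_current j vs ab f" for j by (simp add: smooth_current_def)
  moreover have "\<forall>u\<in>set vs. approximable u" using assms(1) mset_eq_setD[OF assms(2)] by simp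
  ultimately show ?thesis
    using smooth_current_tendsto[OF assms(1,3), of ab] smooth_current_tendsto[of vs f ab] assms(3)
    by (simp add: LIMSEQ_unique)
qed

lemma ddc_product_bounded:
  assumes "\<forall>u\<in>set us. approximable u"
  shows "\<exists>C\<ge>0. \<forall>f\<in>Cc. (\<forall>z. norm z \<ge> r \<longrightarrow> f z = 0) \<longrightarrow> cmod (ddc_product us ab f) \<le> C * sup_norm f"
proof -
  obtain C where C: "C \<ge> 0" "\<And>j f. f \<in> Cc \<Longrightarrow> (\<And>z. norm z \<ge> r \<Longrightarrow> f z = 0) \<Longrightarrow> cmod (smooth_current j us ab f) \<le> C * sup_norm f"
    using smooth_current_bounded[OF assms, of r ab] by blast
  have "cmod (ddc_product us ab f) \<le> C * sup_norm f" if f: "f \<in> Cc" "\<forall>z. norm z \<ge> r \<longrightarrow> f z = 0" for f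
    by (rule LIMSEQ_le_const2[OF tendsto_norm[OF smooth_current_tendsto[OF assms f(1)]]])
       (use C(2)[OF f(1)] f(2) in auto)
  then show ?thesis using C(1) by blast
qed

lemma ddc_product_add:
  assumes "\<forall>u\<in>set us. approximable u" "f \<in> Cc" "g \<in> Cc"
  shows "ddc_product us ab (\<lambda>z. f z + g z) = ddc_product us ab f + ddc_product us ab g"
proof (rule LIMSEQ_unique[OF smooth_current_tendsto[OF assms(1) Cc_add[OF assms(2,3)]]])
  show "(\<lambda>j. smooth_current j us ab (\<lambda>z. f z + g z)) \<longlonglongrightarrow> ddc_product us ab f + ddc_product us ab g"
    unfolding smooth_current_add[OF assms] by (intro tendsto_add smooth_current_tendsto assms)
qed

lemma ddc_product_cmult:
  assumes "\<forall>u\<in>set us. approximable u" "f \<in> Cc"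
  shows "ddc_product us ab (\<lambda>z. c * f z) = c * ddc_product us ab f"
proof (rule LIMSEQ_unique[OF smooth_current_tendsto[OF assms(1) Cc_cmult[OF assms(2)]]])
  show "(\<lambda>j. smooth_current j us ab (\<lambda>z. c * f z)) \<longlonglongrightarrow> c * ddc_product us ab f"
    unfolding smooth_current_cmult by (intro tendsto_mult tendsto_const smooth_current_tendsto assms)
qed

section \<open>The measure of the closed unit ball\<close>

lemma of_real_CcR: "f \<in> CcR \<Longrightarrow> (\<lambda>z. complex_of_real (f z)) \<in> Cc"
proof -
  assume f: "f \<in> CcR"
  obtain r where "\<And>x. norm x \<ge> r \<Longrightarrow> f x = 0" using CcR_radius[OF f] by blast
  then show ?thesis by (intro CcI_radius[where r=r] continuous_on_of_real CcR_continuous f) simp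
qed

lemma Re_Cc: assumes "f \<in> Cc" shows "(\<lambda>z. Re (f z)) \<in> CcR" "(\<lambda>z. Im (f z)) \<in> CcR"
proof -
  obtain r where r: "\<And>x. norm x \<ge> r \<Longrightarrow> f x = 0" using Cc_radius[OF assms] by blast
  show "(\<lambda>z. Re (f z)) \<in> CcR" "(\<lambda>z. Im (f z)) \<in> CcR"
    by (rule CcRI[where r=r], intro continuous_on_Re continuous_on_Im Cc_continuous assms, simp add: r)+
qed

text \<open>In top degree the phases cancel,
  \<open>(2 * \<i>) ^ CARD('n) * (- 2 * \<i>) ^ CARD('n)\<close> being \<open>4 ^ CARD('n)\<close>;
  so the regularised densities are nonnegative, and signs pass to the limit.\<close>

lemma ddc_product_real_nonneg:
  fixes us :: "(complex ^ 'n::finite \<Rightarrow> real) list"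
  assumes us: "\<forall>u\<in>set us. approximable u" "length us = CARD('n)" and f: "f \<in> CcR"
  shows "Im (ddc_product us [] (\<lambda>z. of_real (f z))) = 0"
    "(\<And>z. 0 \<le> f z) \<Longrightarrow> 0 \<le> Re (ddc_product us [] (\<lambda>z. of_real (f z)))"
proof -
  let ?f = "\<lambda>z. complex_of_real (f z)"
  have t: "\<exists>t\<ge>0. hessian_kernel (map (\<lambda>u. approximant u j) us) [] z = of_real t" for j z
  proof -
    have "psd_at u z" if "u \<in> set (map (\<lambda>u. approximant u j) us)" for u
      using that us(1) by (auto intro: psd_approximant)
    then show ?thesis
    proof (rule hessian_kernel_diagonal)
      fix t :: "'n list \<Rightarrow> real" assume t: "\<And>as. 0 \<le> t as"
        "\<And>as. hessian_kernel (map (\<lambda>u. approximant u j) us) (zip as as) z =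
          (2 * \<i>) ^ length (map (\<lambda>u. approximant u j) us) * (- 2 * \<i>) ^ CARD('n) * of_real (t as)"
      have "(2 * \<i>) ^ CARD('n) * (- 2 * \<i>) ^ CARD('n) = ((2 * \<i>) * (- 2 * \<i>)) ^ CARD('n)"
        by (rule power_mult_distrib[symmetric])
      also have "(2 * \<i>) * (- 2 * \<i>) = complex_of_real 4" by simp
      finally have "(2 * \<i>) ^ CARD('n) * (- 2 * \<i>) ^ CARD('n) = complex_of_real (4 ^ CARD('n))"
        by (simp only: of_real_power)
      then have "hessian_kernel (map (\<lambda>u. approximant u j) us) [] z = of_real (4 ^ CARD('n) * t [])"
        using t(2)[of "[]"] by (simp only: zip.simps length_map us(2) of_real_mult)
      then show ?thesis using t(1) by (intro exI[of _ "4 ^ CARD('n) * t []"]) simp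
    qed
  qed
  have "\<exists>t. \<forall>j z. 0 \<le> t j z \<and> hessian_kernel (map (\<lambda>u. approximant u j) us) [] z = of_real (t j z)"
    using t by metis
  then obtain t where t: "\<And>j z. 0 \<le> t j z" "\<And>j z. hessian_kernel (map (\<lambda>u. approximant u j) us) [] z = of_real (t j z)" by blast
  have s: "smooth_current j us [] ?f = of_real (LINT z|lborel. f z * t j z)" for j
    unfolding smooth_current_def t(2) of_real_mult[symmetric] by (rule integral_complex_of_real)
  have lim: "(\<lambda>j. smooth_current j us [] ?f) \<longlonglongrightarrow> ddc_product us [] ?f"
    by (intro smooth_current_tendsto us of_real_CcR f)
  have "(\<lambda>j. Im (smooth_current j us [] ?f)) \<longlonglongrightarrow> Im (ddc_product us [] ?f)" by (rule tendsto_Im[OF lim])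
  then show "Im (ddc_product us [] ?f) = 0" unfolding s by (simp add: LIMSEQ_const_iff)
  assume nn: "\<And>z. 0 \<le> f z"
  have re: "(\<lambda>j. Re (smooth_current j us [] ?f)) \<longlonglongrightarrow> Re (ddc_product us [] ?f)" by (rule tendsto_Re[OF lim])
  have nonneg: "0 \<le> Re (smooth_current j us [] ?f)" for j
    unfolding s Re_complex_of_real by (intro Bochner_Integration.integral_nonneg mult_nonneg_nonneg nn t)
  show "0 \<le> Re (ddc_product us [] ?f)" by (rule LIMSEQ_le_const[OF re]) (use nonneg in blast)
qed

text \<open>The definite description is met: the Riesz theorem for the positive functional gives
  existence, and a Borel measure finite on compact sets is determined by its integrals of test
  functions.\<close>

lemma ddc_measure_properties:
  fixes us :: "(complex ^ 'n::finite \<Rightarrow> real) list"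
  assumes us: "\<forall>u\<in>set us. approximable u" "length us = CARD('n)"
  shows "sets (ddc_measure us) = sets borel \<and> (\<forall>K. compact K \<longrightarrow> emeasure (ddc_measure us) K < \<infinity>) \<and>
     (\<forall>f\<in>Cc. ddc_product us [] f = (LINT z|ddc_measure us. f z))"
proof -
  let ?P = "\<lambda>M. sets M = sets borel \<and> (\<forall>K. compact K \<longrightarrow> emeasure M K < \<infinity>) \<and>
     (\<forall>f\<in>Cc. ddc_product us [] f = (LINT z|M. f z))"
  define L where "L f = Re (ddc_product us [] (\<lambda>z. complex_of_real (f z)))" for f
  interpret positive_functional L
  proof
    fix f g :: "complex ^ 'n \<Rightarrow> real" and c :: real assume f: "f \<in> CcR"
    show "L (\<lambda>x. f x + g x) = L f + L g" if "g \<in> CcR"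
      using ddc_product_add[OF us(1) of_real_CcR[OF f] of_real_CcR[OF that], of "[]"] by (simp add: L_def)
    show "L (\<lambda>x. c * f x) = c * L f"
      using ddc_product_cmult[OF us(1) of_real_CcR[OF f], of "[]" "of_real c"] by (simp add: L_def)
    show "0 \<le> L f" if "\<And>x. 0 \<le> f x"
      unfolding L_def by (rule ddc_product_real_nonneg(2)[OF us f that])
  qed
  have L: "ddc_product us [] (\<lambda>z. complex_of_real (f z)) = of_real (LINT z|\<mu>. f z)" if "f \<in> CcR" for f
    using ddc_product_real_nonneg(1)[OF us that] L_eq_integral[OF that] by (simp add: L_def complex_eq_iff)
  have P: "?P \<mu>"
  proof (intro conjI allI impI ballI)
    fix K :: "(complex ^ 'n) set" assume K: "compact K"
    obtain b where "\<forall>x\<in>K. norm x \<le> b" using compact_imp_bounded[OF K] bounded_iff by blast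
    then show "emeasure \<mu> K < \<infinity>" using K by (intro finite_on_bounded[of K b] borel_compact) auto
  next
    fix f :: "complex ^ 'n \<Rightarrow> complex" assume f: "f \<in> Cc"
    let ?R = "\<lambda>z. complex_of_real (Re (f z))" and ?I = "\<lambda>z. complex_of_real (Im (f z))"
    have C: "?R \<in> Cc" "?I \<in> Cc" using Re_Cc[OF f] of_real_CcR by blast+
    have e: "f = (\<lambda>z. ?R z + \<i> * ?I z)" by (simp add: complex_eq[symmetric])
    have "ddc_product us [] f = ddc_product us [] ?R + \<i> * ddc_product us [] ?I"
      by (subst e) (simp only: ddc_product_add[OF us(1) C(1) Cc_cmult[OF C(2)]] ddc_product_cmult[OF us(1) C(2)])
    also have "\<dots> = (LINT z|\<mu>. ?R z) + (LINT z|\<mu>. \<i> * ?I z)"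
      by (simp only: L[OF Re_Cc(1)[OF f]] L[OF Re_Cc(2)[OF f]] integral_mult_right_zero integral_complex_of_real)
    also have "\<dots> = (LINT z|\<mu>. ?R z + \<i> * ?I z)"
      using CcR_integrable[OF Re_Cc(1)[OF f]] CcR_integrable[OF Re_Cc(2)[OF f]]
      by (intro Bochner_Integration.integral_add[symmetric] integrable_mult_right integrable_of_real)
    also have "\<dots> = (LINT z|\<mu>. f z)" using e by simp
    finally show "ddc_product us [] f = (LINT z|\<mu>. f z)" .
  qed simp
  have unique: "M = \<mu>" if M: "?P M" for M
  proof (rule borel_measure_eqI)
    show "sets M = sets borel" "sets \<mu> = sets borel" using M P by blast+
    show "emeasure M K < \<infinity>" "emeasure \<mu> K < \<infinity>" if "compact K" for K using M P that by blast+
    fix f :: "complex ^ 'n \<Rightarrow> real" assume f: "f \<in> CcR"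
    have "complex_of_real (LINT z|M. f z) = (LINT z|M. complex_of_real (f z))" by simp
    also have "\<dots> = ddc_product us [] (\<lambda>z. complex_of_real (f z))" using M of_real_CcR[OF f] by simp
    also have "\<dots> = of_real (LINT z|\<mu>. f z)" by (rule L[OF f])
    finally show "(LINT z|M. f z) = (LINT z|\<mu>. f z)" by (simp only: of_real_eq_iff)
  qed
  have "\<exists>!M. ?P M" by (rule ex1I[of ?P, OF P unique])
  from theI'[OF this] show ?thesis unfolding ddc_measure_def .
qed

lemma ddc_ball_integral_mset:
  fixes us :: "(complex ^ 'n::finite \<Rightarrow> real) list"
  assumes us: "\<forall>u\<in>set us. approximable u" "mset us = mset vs"
  shows "ddc_ball_integral us = ddc_ball_integral vs"
proof -
  have "ddc_product us [] f = ddc_product vs [] f" if "f \<in> Cc" for f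
    by (rule ddc_product_mset[OF us that])
  then have "ddc_measure us = ddc_measure vs" unfolding ddc_measure_def by (simp cong: ball_cong)
  then show ?thesis by (simp add: ddc_ball_integral_def)
qed

text \<open>Multiply each \<open>h i\<close> by a constant of modulus at most 1 that makes its value
  nonnegative. By disjointness all finite sums remain bounded by \<open>B\<close>, so boundedness of
  the functional makes the moduli of the values summable.\<close>

lemma bounded_functional_disjoint_supports:
  fixes h :: "nat \<Rightarrow> complex ^ 'n \<Rightarrow> complex"
  assumes us: "\<forall>u\<in>set us. approximable u"
    and h: "\<And>i. h i \<in> Cc" "\<And>i z. norm z \<ge> r \<Longrightarrow> h i z = 0" "\<And>i z. cmod (h i z) \<le> B"
    and disj: "\<And>i j z. h i z \<noteq> 0 \<Longrightarrow> h j z \<noteq> 0 \<Longrightarrow> i = j"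
  shows "(\<lambda>i. ddc_product us ab (h i)) \<longlonglongrightarrow> 0"
proof -
  let ?T = "ddc_product us ab"
  obtain C where C: "C \<ge> 0" "\<And>f. f \<in> Cc \<Longrightarrow> (\<And>z. norm z \<ge> r \<Longrightarrow> f z = 0) \<Longrightarrow> cmod (?T f) \<le> C * sup_norm f"
    using ddc_product_bounded[OF us, of r ab] by blast
  define c where "c i = cnj (sgn (?T (h i)))" for i
  have c: "c i * ?T (h i) = of_real (cmod (?T (h i)))" "cmod (c i) \<le> 1" for i
  proof -
    show "cmod (c i) \<le> 1" by (simp add: c_def norm_sgn)
    have "cnj (?T (h i)) * ?T (h i) = (of_real (cmod (?T (h i))))\<^sup>2"
      using complex_norm_square[of "?T (h i)"] by (simp add: mult.commute)
    then show "c i * ?T (h i) = of_real (cmod (?T (h i)))"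
      by (cases "?T (h i) = 0") (simp_all add: c_def sgn_eq power2_eq_square)
  qed
  have sumT: "?T (\<lambda>z. \<Sum>i<n. c i * h i z) = (\<Sum>i<n. c i * ?T (h i))" for n
  proof (induction n)
    case 0
    show ?case using ddc_product_cmult[OF us Cc_zero, of ab 0] by simp
  next
    case (Suc n)
    have "?T (\<lambda>z. (\<Sum>i<n. c i * h i z) + c n * h n z) = ?T (\<lambda>z. \<Sum>i<n. c i * h i z) + ?T (\<lambda>z. c n * h n z)"
      by (intro ddc_product_add us Cc_sum Cc_cmult h)
    then show ?case using Suc ddc_product_cmult[OF us h(1)] by simp
  qed
  have B: "0 \<le> B" using h(3)[of 0 0] norm_ge_zero order_trans by blast
  have bound: "(\<Sum>i<n. cmod (?T (h i))) \<le> C * B" for n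
  proof -
    have "cmod (\<Sum>i<n. c i * h i z) \<le> B" for z
    proof (cases "\<exists>i<n. h i z \<noteq> 0")
      case True
      then obtain i where i: "i < n" "h i z \<noteq> 0" by blast
      have "(\<Sum>k<n. c k * h k z) = (\<Sum>k<n. if k = i then c i * h i z else 0)"
        using disj[OF i(2)] by (intro sum.cong) auto
      also have "\<dots> = c i * h i z" using i by simp
      finally have "cmod (\<Sum>k<n. c k * h k z) = cmod (c i) * cmod (h i z)" by (simp add: norm_mult)
      also have "\<dots> \<le> 1 * B" using c h B by (intro mult_mono) auto
      finally show ?thesis by simp
    next
      case False
      then show ?thesis using B by simp
    qed
    then have "sup_norm (\<lambda>z. \<Sum>i<n. c i * h i z) \<le> B" by (rule sup_norm_least)
    moreover have "cmod (?T (\<lambda>z. \<Sum>i<n. c i * h i z)) \<le> C * sup_norm (\<lambda>z. \<Sum>i<n. c i * h i z)"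
      using h by (intro C Cc_sum Cc_cmult) auto
    ultimately have "cmod (?T (\<lambda>z. \<Sum>i<n. c i * h i z)) \<le> C * B"
      using mult_left_mono[OF _ C(1)] order_trans by blast
    moreover have "?T (\<lambda>z. \<Sum>i<n. c i * h i z) = of_real (\<Sum>i<n. cmod (?T (h i)))"
      unfolding sumT c(1) by simp
    ultimately have "\<bar>\<Sum>i<n. cmod (?T (h i))\<bar> \<le> C * B" by (simp only: norm_of_real)
    then show ?thesis by linarith
  qed
  have "summable (\<lambda>i. cmod (?T (h i)))" by (rule summableI_nonneg_bounded[OF norm_ge_zero bound])
  then have "(\<lambda>i. cmod (?T (h i))) \<longlonglongrightarrow> 0" by (rule summable_LIMSEQ_zero)
  then show ?thesis by (rule tendsto_norm_zero_cancel)
qed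

text \<open>Cutoffs of the unit ball whose Hessians live on disjoint shells shrinking to the sphere; there
  \<open>(norm z - 1)\<^sup>2\<close> compensates the size of the Hessian.\<close>

lemma ball_cutoffs:
  obtains \<psi> :: "nat \<Rightarrow> complex ^ 'n \<Rightarrow> complex" and B where
    "\<And>i. \<psi> i \<in> Cc_smooth" "\<And>i z. norm z \<ge> 2 \<Longrightarrow> \<psi> i z = 0"
    "\<And>i z. cmod (\<psi> i z) \<le> 1" "\<And>z. (\<lambda>i. \<psi> i z) \<longlonglongrightarrow> indicator (cball 0 1) z"
    "\<And>i a b z. cmod (of_real ((norm z - 1)\<^sup>2) * d_z a (d_zbar b (\<psi> i)) z) \<le> B"
    "\<And>i j a b z. d_z a (d_zbar b (\<psi> i)) z \<noteq> 0 \<Longrightarrow> d_z a (d_zbar b (\<psi> j)) z \<noteq> 0 \<Longrightarrow> i = j"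
proof -
  obtain G G' G'' :: "real \<Rightarrow> real" and M where
    G: "\<And>r. Cr r G" "\<And>r. Cr r G'" "\<And>x. (G has_real_derivative G' x) (at x)" "\<And>x. (G' has_real_derivative G'' x) (at x)"
    "\<And>x. x \<le> 1/2 \<Longrightarrow> G x = 1" "\<And>x. x \<ge> 1 \<Longrightarrow> G x = 0" "\<And>x. 0 \<le> G x" "\<And>x. G x \<le> 1"
    "\<And>x. x < 1/2 \<or> x > 1 \<Longrightarrow> G' x = 0" "\<And>x. x < 1/2 \<or> x > 1 \<Longrightarrow> G'' x = 0"
    "\<And>x. \<bar>G' x\<bar> \<le> M" "\<And>x. \<bar>G'' x\<bar> \<le> M"
    by (rule smooth_transition) blast
  \<comment> \<open>\<open>x i\<close> vanishes on the unit sphere. Where it lies between 1/2 and 1,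
    \<open>x (Suc i)\<close> lies between 2 and 4, beyond the interval on which the derivatives of
    \<open>G\<close> live; this is why the scale is 4.\<close>
  define x where "x i z = 4 ^ i * (z \<bullet> z) + - (4 ^ i)" for i :: nat and z :: "complex ^ 'n"
  have x: "x i z = 4 ^ i * ((norm z)\<^sup>2 - 1)" for i z by (simp add: x_def dot_square_norm algebra_simps)
  define \<psi> where "\<psi> i z = complex_of_real (G (x i z))" for i z
  have sm: "smooth (\<psi> i)" for i unfolding \<psi>_def[abs_def] x_def by (rule smooth_radial[OF G(1)])
  have z2: "\<psi> i z = 0" if "norm z \<ge> 2" for i z
  proof -
    have "2\<^sup>2 \<le> (norm z)\<^sup>2" using that by (intro power_mono) auto
    then have "1 * 1 \<le> 4 ^ i * ((norm z)\<^sup>2 - 1)" by (intro mult_mono) auto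
    then show ?thesis by (simp add: \<psi>_def x G(6))
  qed
  have C: "\<psi> i \<in> Cc_smooth" for i
    unfolding Cc_smooth_iff using sm by (auto intro!: CcI_radius[OF _ z2] smooth_imp_continuous)
  have le1: "cmod (\<psi> i z) \<le> 1" for i z using G(7,8)[of "x i z"] by (simp add: \<psi>_def)
  have lim: "(\<lambda>i. \<psi> i z) \<longlonglongrightarrow> indicator (cball 0 1) z" for z
  proof (cases "norm z \<le> 1")
    case True
    then have "(norm z)\<^sup>2 \<le> 1" by (simp add: power_le_one_iff)
    then have "x i z \<le> 0" for i unfolding x by (intro mult_nonneg_nonpos) auto
    then have "x i z \<le> 1/2" for i using order_trans[of "x i z" 0 "1/2"] by simp
    then have "\<psi> i z = 1" for i by (simp add: \<psi>_def G(5))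
    then show ?thesis using True by simp
  next
    case False
    then have "1 < (norm z)\<^sup>2" by (simp add: one_less_power)
    then obtain N :: nat where N: "1 / ((norm z)\<^sup>2 - 1) < 4 ^ N" using real_arch_pow[of 4] by auto
    have "\<psi> i z = 0" if "i \<ge> N" for i
    proof -
      have "1 \<le> 4 ^ N * ((norm z)\<^sup>2 - 1)" using N \<open>1 < (norm z)\<^sup>2\<close> by (simp add: field_simps)
      also have "\<dots> \<le> x i z" unfolding x using that \<open>1 < (norm z)\<^sup>2\<close> by (intro mult_right_mono power_increasing) auto
      finally show ?thesis by (simp add: \<psi>_def G(6))
    qed
    then show ?thesis using False by (auto intro!: tendsto_eventually eventually_sequentiallyI[of N])
  qed
  have H: "d_z a (d_zbar b (\<psi> i)) z = of_real (G'' (x i z) * (4 ^ i)\<^sup>2) * cnj (z $ a) * z $ b +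
     (if a = b then of_real (G' (x i z) * 4 ^ i) else 0)" for a b i z
    unfolding \<psi>_def[abs_def] x_def by (rule hessian_radial[OF G(3,4,2)])
  have supp: "1/2 \<le> x i z \<and> x i z \<le> 1" if "d_z a (d_zbar b (\<psi> i)) z \<noteq> 0" for a b i z
    using that G(9,10)[of "x i z"] unfolding H by (cases "x i z < 1/2 \<or> x i z > 1") (auto split: if_splits)
  have M: "0 \<le> M" using G(11)[of 0] by linarith
  \<comment> \<open>The rank-one part of the Hessian contributes \<open>4 * M\<close>, both
    coordinates being at most 2 in modulus, and the diagonal part \<open>M\<close>. On the shell
    \<open>4 ^ i * (norm z - 1)\<close> is at most 1, which absorbs the powers of
    \<open>4 ^ i\<close>.\<close>
  have bd: "cmod (of_real ((norm z - 1)\<^sup>2) * d_z a (d_zbar b (\<psi> i)) z) \<le> 5 * M" for i a b z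
  proof (cases "d_z a (d_zbar b (\<psi> i)) z = 0")
    case True
    then show ?thesis using M by simp
  next
    case False
    define q where "q = (4::real) ^ i"
    have q: "q \<ge> 1" by (simp add: q_def)
    have s: "1/2 \<le> q * ((norm z)\<^sup>2 - 1)" "q * ((norm z)\<^sup>2 - 1) \<le> 1" using supp[OF False] by (simp_all add: x q_def)
    have "0 < q * ((norm z)\<^sup>2 - 1)" using s(1) by linarith
    then have n1: "1 < (norm z)\<^sup>2" using q by (simp add: zero_less_mult_iff)
    then have n1': "1 < norm z" by (metis norm_ge_zero not_less power_le_one)
    have "q * (norm z - 1) * 1 \<le> q * (norm z - 1) * (norm z + 1)"
      using q n1' by (intro mult_left_mono) auto
    also have "\<dots> = q * ((norm z)\<^sup>2 - 1)" by (simp add: power2_eq_square algebra_simps)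
    finally have m: "q * (norm z - 1) \<le> 1" using s(2) by (simp only: mult_1_right)
    have "1 * (norm z - 1) \<le> q * (norm z - 1)" using q n1' by (intro mult_right_mono) auto
    from order_trans[OF this m] have n2: "norm z \<le> 2" by simp
    have m0: "0 \<le> q * (norm z - 1)" using q n1' by simp
    have k: "q\<^sup>2 * (norm z - 1)\<^sup>2 \<le> 1" "q * (norm z - 1)\<^sup>2 \<le> 1"
    proof -
      show 1: "q\<^sup>2 * (norm z - 1)\<^sup>2 \<le> 1"
        using power_le_one[OF m0 m, of 2] by (simp add: power_mult_distrib)
      have "q * (norm z - 1)\<^sup>2 \<le> q\<^sup>2 * (norm z - 1)\<^sup>2"
        using q by (intro mult_right_mono) (auto simp: power2_eq_square)
      then show "q * (norm z - 1)\<^sup>2 \<le> 1" using 1 by linarith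
    qed
    have za: "cmod (z $ c) \<le> 2" for c using Finite_Cartesian_Product.norm_nth_le[of z c] n2 by linarith
    have "cmod (d_z a (d_zbar b (\<psi> i)) z) \<le> \<bar>G'' (x i z)\<bar> * q\<^sup>2 * cmod (z $ a) * cmod (z $ b) + \<bar>G' (x i z)\<bar> * q"
      unfolding H q_def[symmetric]
      by (rule order_trans[OF norm_triangle_ineq]) (use q in \<open>auto simp: norm_mult norm_power abs_mult\<close>)
    also have "\<dots> \<le> M * q\<^sup>2 * 2 * 2 + M * q"
      using q M G(11,12) za by (intro add_mono mult_mono) auto
    finally have "cmod (d_z a (d_zbar b (\<psi> i)) z) \<le> M * q\<^sup>2 * 2 * 2 + M * q" .
    then have "(norm z - 1)\<^sup>2 * cmod (d_z a (d_zbar b (\<psi> i)) z) \<le> (norm z - 1)\<^sup>2 * (M * q\<^sup>2 * 2 * 2 + M * q)"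
      by (rule mult_left_mono) simp
    also have "\<dots> = 4 * M * (q\<^sup>2 * (norm z - 1)\<^sup>2) + M * (q * (norm z - 1)\<^sup>2)" by (simp add: algebra_simps)
    also have "\<dots> \<le> 4 * M * 1 + M * 1" using M k by (intro add_mono mult_left_mono) auto
    finally show ?thesis unfolding norm_mult norm_of_real abs_power2 by simp
  qed
  have lt: "False" if ij: "i < j" and i: "1/2 \<le> x i z" "x i z \<le> 1" and j: "1/2 \<le> x j z" "x j z \<le> 1" for i j z
  proof -
    have "(4::real) ^ Suc i \<le> 4 ^ j" using ij by (intro power_increasing) auto
    moreover have "0 < 4 ^ i * ((norm z)\<^sup>2 - 1)" using i(1) unfolding x by linarith
    then have "0 < (norm z)\<^sup>2 - 1" by (simp add: zero_less_mult_iff)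
    ultimately have "4 ^ Suc i * ((norm z)\<^sup>2 - 1) \<le> x j z" unfolding x by (intro mult_right_mono) auto
    moreover have "4 ^ Suc i * ((norm z)\<^sup>2 - 1) = 4 * x i z" by (simp add: x)
    ultimately show False using i(1) j(2) by linarith
  qed
  have disj: "i = j" if "d_z a (d_zbar b (\<psi> i)) z \<noteq> 0" "d_z a (d_zbar b (\<psi> j)) z \<noteq> 0" for i j a b z
    using supp[OF that(1)] supp[OF that(2)] lt[of i j z] lt[of j i z] by (cases i j rule: linorder_cases) auto
  show ?thesis by (rule that[OF C z2 le1 lim bd disj])
qed

text \<open>Dominated convergence for a measure finite on compact sets. The limit is the indicator
  of the closed ball, so that mass on the sphere is counted.\<close>

lemma ddc_ball_integral_limit:
  fixes us :: "(complex ^ 'n::finite \<Rightarrow> real) list" and \<psi> :: "nat \<Rightarrow> complex ^ 'n \<Rightarrow> complex"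
  assumes us: "\<forall>u\<in>set us. approximable u" "length us = CARD('n)"
    and \<psi>: "\<And>i. \<psi> i \<in> Cc" "\<And>i z. norm z \<ge> 2 \<Longrightarrow> \<psi> i z = 0" "\<And>i z. cmod (\<psi> i z) \<le> 1"
      "\<And>z. (\<lambda>i. \<psi> i z) \<longlonglongrightarrow> indicator (cball 0 1) z"
  shows "(\<lambda>i. ddc_product us [] (\<psi> i)) \<longlonglongrightarrow> of_real (ddc_ball_integral us)"
proof -
  let ?\<mu> = "ddc_measure us"
  have \<mu>: "sets ?\<mu> = sets borel" "\<And>K. compact K \<Longrightarrow> emeasure ?\<mu> K < \<infinity>"
    "\<And>f. f \<in> Cc \<Longrightarrow> ddc_product us [] f = (LINT z|?\<mu>. f z)"
    using ddc_measure_properties[OF us] by blast+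
  have "(\<lambda>i. LINT z|?\<mu>. \<psi> i z) \<longlonglongrightarrow> (LINT z|?\<mu>. indicator (cball 0 1) z)"
  proof (rule integral_dominated_convergence[where w="indicator (cball 0 2)"])
    show "\<psi> i \<in> borel_measurable ?\<mu>" for i
      unfolding measurable_cong_sets[OF \<mu>(1) refl]
      by (intro borel_measurable_continuous_onI Cc_continuous \<psi>)
    show "integrable ?\<mu> (indicat_real (cball 0 2))"
      using \<mu> by (intro integrable_real_indicator) (auto simp: \<mu>(1))
    show "AE z in ?\<mu>. norm (\<psi> i z) \<le> indicator (cball 0 2) z" for i
    proof (rule AE_I2)
      fix z show "norm (\<psi> i z) \<le> indicator (cball 0 2) z"
        using \<psi>(2)[of z i] \<psi>(3)[of i z] by (cases "norm z \<le> 2") auto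
    qed
    show "(indicator (cball 0 1) :: complex ^ 'n \<Rightarrow> complex) \<in> borel_measurable ?\<mu>"
      unfolding measurable_cong_sets[OF \<mu>(1) refl] by (rule borel_measurable_indicator) simp
  qed (use \<psi> in auto)
  also have "(indicator (cball 0 1) :: complex ^ 'n \<Rightarrow> complex) = (\<lambda>z. of_real (indicator (cball 0 1) z))"
    by (auto simp: indicator_def fun_eq_iff)
  also have "(LINT z|?\<mu>. complex_of_real (indicator (cball 0 1) z)) = of_real (LINT z|?\<mu>. indicator (cball 0 1) z)"
    by (rule integral_complex_of_real)
  also have "(LINT z|?\<mu>. indicat_real (cball 0 1) z) = ddc_ball_integral us"
    using \<mu>(1) by (simp add: ddc_ball_integral_def sets_eq_imp_space_eq[OF \<mu>(1)])
  finally show ?thesis using \<mu>(3)[OF \<psi>(1)] by simp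
qed

lemma d_z_d_zbar_support:
  assumes "f \<in> Cc_smooth" "d_z a (d_zbar b f) z \<noteq> 0" shows "z \<in> closure {z. f z \<noteq> 0}"
proof (rule ccontr)
  let ?U = "- closure {z. f z \<noteq> 0}"
  assume z: "z \<notin> closure {z. f z \<noteq> 0}"
  have U: "open ?U" by (rule open_Compl[OF closed_closure])
  have f0: "f w = 0" if "w \<in> ?U" for w using that closure_subset[of "{z. f z \<noteq> 0}"] by auto
  have 1: "d_zbar b f w = 0" if "w \<in> ?U" for w
  proof -
    have "(f has_derivative (\<lambda>v. 0)) (at w)"
      by (rule has_derivative_transform_within_open[OF has_derivative_const[of 0] U that]) (simp only: f0)
    from d_zbar_eqI[OF this] show ?thesis by simp
  qed
  have "(d_zbar b f has_derivative (\<lambda>v. 0)) (at z)"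
    by (rule has_derivative_transform_within_open[OF has_derivative_const[of 0] U]) (use z in \<open>simp_all only: Compl_iff not_False_eq_True 1\<close>)
  then have "d_z a (d_zbar b f) z = (0 - \<i> * 0) / 2" by (rule d_z_eqI)
  also have "\<dots> = 0" by simp
  finally show False using assms(2) by blast
qed

text \<open>On the unit sphere \<open>(norm z)\<^sup>2\<close> and \<open>2 * norm z - 1\<close> agree to first order, and constants do not
  contribute; integrating the cutoffs by parts moves both derivatives away from the difference
  \<open>(norm z - 1)\<^sup>2\<close>.\<close>

lemma ddc_ball_integral_norm_squared:
  fixes us :: "(complex ^ 'n::finite \<Rightarrow> real) list"
  assumes us: "\<forall>u\<in>set us. approximable u" "Suc (length us) = CARD('n)"
    and ap: "approximable (\<lambda>z::complex^'n. norm z)" "approximable (\<lambda>z::complex^'n. (norm z)\<^sup>2)"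
  shows "ddc_ball_integral ((\<lambda>z. (norm z)\<^sup>2) # us) = 2 * ddc_ball_integral ((\<lambda>z. norm z) # us)"
proof -
  obtain \<psi> :: "nat \<Rightarrow> complex ^ 'n \<Rightarrow> complex" and B where \<psi>:
    "\<And>i. \<psi> i \<in> Cc_smooth" "\<And>i z. norm z \<ge> 2 \<Longrightarrow> \<psi> i z = 0"
    "\<And>i z. cmod (\<psi> i z) \<le> 1" "\<And>z. (\<lambda>i. \<psi> i z) \<longlonglongrightarrow> indicator (cball 0 1) z"
    "\<And>i a b z. cmod (of_real ((norm z - 1)\<^sup>2) * d_z a (d_zbar b (\<psi> i)) z) \<le> B"
    "\<And>i j a b z. d_z a (d_zbar b (\<psi> i)) z \<noteq> 0 \<Longrightarrow> d_z a (d_zbar b (\<psi> j)) z \<noteq> 0 \<Longrightarrow> i = j"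
    using ball_cutoffs by blast
  have \<psi>C: "\<psi> i \<in> Cc" for i using \<psi>(1) by (simp add: Cc_smooth_iff)
  let ?S = "\<lambda>z::complex^'n. (norm z)\<^sup>2" and ?N = "\<lambda>z::complex^'n. norm z"
  let ?h = "\<lambda>i a b z. d_z a (d_zbar b (\<psi> i)) z"
  let ?T = "\<lambda>a b. ddc_product us [(a, b)]"
  let ?q = "\<lambda>i a b z. of_real ((norm z - 1)\<^sup>2) * ?h i a b z"
  have h: "?h i a b \<in> Cc" for i a b
    using Cc_smooth_d_z[OF Cc_smooth_d_zbar[OF \<psi>(1)]] by (simp add: Cc_smooth_iff)
  have hm: "(\<lambda>z. of_real (u z) * ?h i a b z) \<in> Cc" if "continuous_on UNIV u" for i a b and u :: "complex ^ 'n \<Rightarrow> real"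
    by (intro Cc_mult_left h continuous_on_of_real that)
  have cN: "continuous_on UNIV ?N" and cS: "continuous_on UNIV ?S" and cq: "continuous_on UNIV (\<lambda>z::complex^'n. (norm z - 1)\<^sup>2)"
    by (intro continuous_intros)+
  have h2: "?h i a b z = 0" if z: "norm z > 2" for i a b z
  proof (rule ccontr)
    assume "?h i a b z \<noteq> 0"
    moreover have "z \<notin> closure {z. \<psi> i z \<noteq> 0}"
    proof -
      have "closure {z. \<psi> i z \<noteq> 0} \<subseteq> cball 0 2"
      proof (rule closure_minimal[OF _ closed_cball], safe)
        fix x assume "\<psi> i x \<noteq> 0"
        then show "x \<in> cball 0 2" using \<psi>(2)[of x i] by (cases "norm x \<le> 2") auto
      qed
      then show ?thesis using z by auto
    qed
    ultimately show False using d_z_d_zbar_support[OF \<psi>(1)] by blast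
  qed
  have q: "(\<lambda>i. ?T a b (?q i a b)) \<longlonglongrightarrow> 0" for a b
  \<comment> \<open>Radius 3 and not 2: the second derivatives are known to vanish where
    \<open>norm z > 2\<close>, whereas the rule asks for vanishing on all of
    \<open>norm z \<ge> r\<close>.\<close>
  proof (rule bounded_functional_disjoint_supports[OF us(1), where r=3 and B=B])
    show "?q i a b \<in> Cc" for i by (rule hm[OF cq])
    show "?q i a b z = 0" if "norm z \<ge> 3" for i z using h2[of z] that by simp
    show "cmod (?q i a b z) \<le> B" for i z by (rule \<psi>(5))
    show "i = j" if "?q i a b z \<noteq> 0" "?q j a b z \<noteq> 0" for i j z using \<psi>(6)[of a b i z j] that by simp
  qed
  have key: "ddc_product (?S # us) [] (\<psi> i) - 2 * ddc_product (?N # us) [] (\<psi> i) =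
     (\<Sum>a\<in>UNIV. \<Sum>b\<in>UNIV. 2 * \<i> * ?T a b (?q i a b))" for i
  proof -
    have split: "?T a b (?q i a b) = ?T a b (\<lambda>z. of_real (?S z) * ?h i a b z) +
       (-2) * ?T a b (\<lambda>z. of_real (?N z) * ?h i a b z) + ?T a b (?h i a b)" for a b
    proof -
      \<comment> \<open>The square expands to \<open>(norm z)\<^sup>2 - 2 * norm z + 1\<close>; the
        constant term is the one that \<open>ddc_product_closed\<close> removes.\<close>
      have "?q i a b = (\<lambda>z. (of_real (?S z) * ?h i a b z + (-2) * (of_real (?N z) * ?h i a b z)) + ?h i a b z)"
        by (rule ext) (simp add: power2_eq_square algebra_simps)
      then have "?T a b (?q i a b) = ?T a b (\<lambda>z. (of_real (?S z) * ?h i a b z + (-2) * (of_real (?N z) * ?h i a b z)) + ?h i a b z)"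
        by (rule arg_cong)
      also have "\<dots> = ?T a b (\<lambda>z. of_real (?S z) * ?h i a b z + (-2) * (of_real (?N z) * ?h i a b z)) + ?T a b (?h i a b)"
        by (rule ddc_product_add[OF us(1) Cc_add[OF hm[OF cS] Cc_cmult[OF hm[OF cN]]] h])
      also have "?T a b (\<lambda>z. of_real (?S z) * ?h i a b z + (-2) * (of_real (?N z) * ?h i a b z)) =
          ?T a b (\<lambda>z. of_real (?S z) * ?h i a b z) + ?T a b (\<lambda>z. (-2) * (of_real (?N z) * ?h i a b z))"
        by (rule ddc_product_add[OF us(1) hm[OF cS] Cc_cmult[OF hm[OF cN]]])
      also have "?T a b (\<lambda>z. (-2) * (of_real (?N z) * ?h i a b z)) = (-2) * ?T a b (\<lambda>z. of_real (?N z) * ?h i a b z)"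
        by (rule ddc_product_cmult[OF us(1) hm[OF cN]])
      finally show ?thesis .
    qed
    have "(\<Sum>a\<in>UNIV. \<Sum>b\<in>UNIV. 2 * \<i> * ?T a b (?q i a b)) =
      (\<Sum>a\<in>UNIV. \<Sum>b\<in>UNIV. 2 * \<i> * ?T a b (\<lambda>z. of_real (?S z) * ?h i a b z)) -
      2 * (\<Sum>a\<in>UNIV. \<Sum>b\<in>UNIV. 2 * \<i> * ?T a b (\<lambda>z. of_real (?N z) * ?h i a b z)) +
      (\<Sum>a\<in>UNIV. \<Sum>b\<in>UNIV. 2 * \<i> * ?T a b (?h i a b))"
    proof -
      have "2 * \<i> * (x + (-2) * y + w) = 2 * \<i> * x - 2 * (2 * \<i> * y) + 2 * \<i> * w" for x y w :: complex
        by (simp add: algebra_simps)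
      then show ?thesis by (simp only: split sum.distrib sum_subtractf sum_distrib_left)
    qed
    also have "(\<Sum>a\<in>UNIV. \<Sum>b\<in>UNIV. 2 * \<i> * ?T a b (?h i a b)) = 0"
      by (rule ddc_product_closed[OF us(1) \<psi>(1)])
    finally show ?thesis
      using us(1) ap by (simp add: ddc_product_Cons \<psi>(1))
  qed
  have "(\<lambda>i. \<Sum>a\<in>UNIV. \<Sum>b\<in>UNIV. 2 * \<i> * ?T a b (?q i a b)) \<longlonglongrightarrow> (\<Sum>a\<in>(UNIV::'n set). \<Sum>b\<in>(UNIV::'n set). 2 * \<i> * 0)"
    by (intro tendsto_sum tendsto_mult tendsto_const q)
  then have 1: "(\<lambda>i. ddc_product (?S # us) [] (\<psi> i) - 2 * ddc_product (?N # us) [] (\<psi> i)) \<longlonglongrightarrow> 0"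
    unfolding key by simp
  have 2: "(\<lambda>i. ddc_product (u # us) [] (\<psi> i)) \<longlonglongrightarrow> of_real (ddc_ball_integral (u # us))" if "approximable u" for u
    using us that by (intro ddc_ball_integral_limit \<psi>C \<psi>(2-4)) auto
  have "(\<lambda>i. ddc_product (?S # us) [] (\<psi> i) - 2 * ddc_product (?N # us) [] (\<psi> i)) \<longlonglongrightarrow>
     complex_of_real (ddc_ball_integral (?S # us)) - 2 * of_real (ddc_ball_integral (?N # us))"
    by (intro tendsto_diff tendsto_mult tendsto_const 2 ap)
  from LIMSEQ_unique[OF this 1]
  have "complex_of_real (ddc_ball_integral (?S # us) - 2 * ddc_ball_integral (?N # us)) = of_real 0" by simp
  then show ?thesis by (simp only: of_real_eq_iff)
qed

section \<open>Exchanging the factors one at a time\<close>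

theorem corollary8p5:
  fixes As :: "(complex ^ 'n::finite) set list" and k l :: nat
  assumes "k \<le> CARD('n)" and "l \<le> CARD('n) - k"
    and "length As = k" and "\<forall>A\<in>set As. convex_body A"
  shows "ddc_ball_integral (map support_fun As @
             replicate (CARD('n) - k) (\<lambda>z. (support_fun (cball 0 1) z)\<^sup>2)) =
           2 ^ l * ddc_ball_integral (map support_fun As @
             replicate l (support_fun (cball 0 1)) @
             replicate (CARD('n) - k - l) (\<lambda>z. (support_fun (cball 0 1) z)\<^sup>2)) \<and>
         mixed_pseudovolume (As @ replicate (CARD('n) - k) (cball 0 1)) =
           1 / (2 ^ (CARD('n) - k) * fact CARD('n) * measure lborel (cball (0 :: real ^ 'n) 1)) *
           ddc_ball_integral (map support_fun As @
             replicate (CARD('n) - k) (\<lambda>z. (support_fun (cball 0 1) z)\<^sup>2))"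
proof -
  let ?N = "\<lambda>z::complex^'n. norm z" and ?S = "\<lambda>z::complex^'n. (norm z)\<^sup>2"
  let ?m = "CARD('n) - k"
  let ?h = "map support_fun As"
  have N: "support_fun (cball 0 1 :: (complex ^ 'n) set) = ?N" by (rule ext) (rule support_fun_ball)
  have apA: "approximable (support_fun A)" if "A \<in> set As" for A
    using that assms(4) unfolding approximable_def convex_body_def by (intro approximates_support_fun) auto
  have apN: "approximable ?N"
    unfolding N[symmetric] approximable_def by (rule approximates_support_fun) auto
  have apS: "approximable ?S" unfolding approximable_def using approximates_norm_squared by blast
  \<comment> \<open>Stated for every \<open>l\<close>, since the two conjuncts use different
    instances: the given \<open>l\<close>, and all of the \<open>?m\<close> factors.\<close>
  have main: "ddc_ball_integral (?h @ replicate ?m ?S) =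
     2 ^ l * ddc_ball_integral (?h @ replicate l ?N @ replicate (?m - l) ?S)" if "l \<le> ?m" for l
    using that
  proof (induction l)
    case 0
    then show ?case by simp
  next
    case (Suc l)
    define r where "r = ?m - Suc l"
    have r: "?m - l = Suc r" using Suc.prems by (simp add: r_def)
    let ?us = "?h @ replicate l ?N @ replicate r ?S"
    have us: "\<forall>u\<in>set ?us. approximable u" using apA apN apS by (auto split: if_splits)
    have len: "Suc (length ?us) = CARD('n)" using assms(1,3) Suc.prems by (simp add: r_def)
    \<comment> \<open>Symmetry brings one squared norm to the head of the list, where the comparison
      applies; afterwards the norm goes back to its place.\<close>
    have "ddc_ball_integral (?h @ replicate l ?N @ replicate (?m - l) ?S) = ddc_ball_integral (?S # ?us)"
      unfolding r using us apS by (intro ddc_ball_integral_mset) auto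
    also have "\<dots> = 2 * ddc_ball_integral (?N # ?us)"
      by (rule ddc_ball_integral_norm_squared[OF us len apN apS])
    also have "ddc_ball_integral (?N # ?us) = ddc_ball_integral (?h @ replicate (Suc l) ?N @ replicate r ?S)"
      using us apN by (intro ddc_ball_integral_mset) auto
    finally show ?case using Suc by (simp add: r_def)
  qed
  have "mixed_pseudovolume (As @ replicate ?m (cball 0 1)) =
    1 / (fact CARD('n) * measure lborel (cball (0 :: real ^ 'n) 1)) * ddc_ball_integral (?h @ replicate ?m ?N)"
    by (simp add: mixed_pseudovolume_def N)
  also have "\<dots> = 1 / (2 ^ ?m * fact CARD('n) * measure lborel (cball (0 :: real ^ 'n) 1)) *
      ddc_ball_integral (?h @ replicate ?m ?S)"
    using main[of ?m] by simp
  finally show ?thesis using main[OF assms(2)] by (simp add: N)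
qed

end
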